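(* Let $[a,b]\subset\mathbb{R}$ be a finite segment, let $m,n,r\in\mathbb{N}$ and $1\le p\le\infty$. Let $A(\cdot)\in (W_p^{n-1})^{m\times m}$ and let $B\colon (W_p^n)^m\to\mathbb{C}^r$ be an arbitrary continuous linear operator. Put $Ly:=y'+A(\cdot)y$ for $y\in (W_p^n)^m$. Then the operator $$(L,B)\colon (W_p^n)^m\to (W_p^{n-1})^m\times\mathbb{C}^r,\qquad y\mapsto (Ly,By),$$ is invertible if and only if $r=m$ and the matrix $[BY]\in\mathbb{C}^{m\times m}$ is nondegenerate (i.e. $\det[BY]\ne0$), where $Y(\cdot)\in (W_p^n)^{m\times m}$ is the unique solution of the matrix Cauchy problem $$Y'(t)+A(t)Y(t)=0,\quad t\in(a,b),\qquad Y(a)=I_m.$$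
   Context: $\mathbb{N}=\{1,2,\dots\}$ and $a<b$. $W_p^n:=W_p^n([a,b];\mathbb{C})$ is the complex Sobolev space on $[a,b]$ (functions whose derivatives up to order $n$ lie in $L_p$), with $W_p^0:=L_p$. $(W_p^n)^m:=W_p^n([a,b];\mathbb{C}^m)$ and $(W_p^n)^{m\times m}:=W_p^n([a,b];\mathbb{C}^{m\times m})$ are the spaces of vector-valued and matrix-valued functions whose entries lie in $W_p^n$; the norm $\|\cdot\|_{n,p}$ is the sum of the $W_p^n$-norms of the entries. Differential equations are understood to hold almost everywhere on $(a,b)$. Vectors are written as columns, and $I_m$ is the $m\times m$ identity matrix. Invertible means bijective with continuous inverse, i.e. the problem $Ly=f$, $By=c$ has a unique solution $y\in(W_p^n)^m$ for every $(f,c)\in (W_p^{n-1})^m\times\mathbb{C}^r$, and it depends continuously on $(f,c)$. In the case $r=m$, for $Y(\cdot)=(y_{i,j}(\cdot))_{i,j=1}^m$, $[BY]$ denotes the numerical $m\times m$ matrix whose $j$-th column is the vector $B\,(y_{1,j}(\cdot),\dots,y_{m,j}(\cdot))^{\top}\in\mathbb{C}^m$, i.e. the result of applying $B$ to the $j$-th column of $Y(\cdot)$, $j=1,\dots,m$. *)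

theory Defs
  imports
    "HOL-Analysis.Analysis"
    "HOL-Probability.Essential_Supremum"
    "Jordan_Normal_Form.Determinant"
begin

(* The dollar sign is kept for indexing the vectors of Jordan_Normal_Form. *)
unbundle no vec_syntax
hide_const (open) Finite_Cartesian_Product.vec Determinants.det
hide_type (open) Finite_Cartesian_Product.vec

(* Functions on [a,b] are represented by functions on the real line; only their values on [a,b]
   matter. Elements of L_p are represented by functions, and equality in L_p is written as
   equality almost everywhere. *)

definition Lp :: "ennreal \<Rightarrow> real \<Rightarrow> real \<Rightarrow> (real \<Rightarrow> complex) set" where
  "Lp p a b =
    {f. f \<in> borel_measurable (lebesgue_on {a..b}) \<and>
        (if p = \<infinity> then esssup (lebesgue_on {a..b}) (\<lambda>t. ereal (cmod (f t))) < \<infinity>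
         else integrable (lebesgue_on {a..b}) (\<lambda>t. cmod (f t) powr enn2real p))}"

definition Lp_norm :: "ennreal \<Rightarrow> real \<Rightarrow> real \<Rightarrow> (real \<Rightarrow> complex) \<Rightarrow> real" where
  "Lp_norm p a b f =
    (if p = \<infinity> then real_of_ereal (esssup (lebesgue_on {a..b}) (\<lambda>t. ereal (cmod (f t))))
     else (LINT t|lebesgue_on {a..b}. cmod (f t) powr enn2real p) powr (1 / enn2real p))"

(* The intervals of a division may share endpoints, but their interiors are disjoint. *)
definition abs_cont_on :: "real \<Rightarrow> real \<Rightarrow> (real \<Rightarrow> complex) \<Rightarrow> bool" where
  "abs_cont_on a b f \<longleftrightarrow>
    (\<forall>\<epsilon>>0. \<exists>\<delta>>0. \<forall>d S. d division_of S \<and> S \<subseteq> {a..b} \<and> (\<Sum>K\<in>d. Sup K - Inf K) < \<delta> \<longrightarrow>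
       (\<Sum>K\<in>d. cmod (f (Sup K) - f (Inf K))) < \<epsilon>)"

(* One-sided at the endpoints; an unspecified value where f is not differentiable. *)
definition deriv_on :: "real \<Rightarrow> real \<Rightarrow> (real \<Rightarrow> complex) \<Rightarrow> real \<Rightarrow> complex" where
  "deriv_on a b f t = vector_derivative f (at t within {a..b})"

(* For n > 0: f is in C^(n-1)[a,b], its derivative of order n-1 is absolutely continuous, and its
   derivative of order n, which exists almost everywhere, is in L_p. This selects the continuous
   representative. *)
definition sobolev :: "ennreal \<Rightarrow> real \<Rightarrow> real \<Rightarrow> nat \<Rightarrow> (real \<Rightarrow> complex) set" where
  "sobolev p a b n =
    {f. (\<forall>k<n. continuous_on {a..b} ((deriv_on a b ^^ k) f)) \<and>
        (\<forall>k. Suc k < n \<longrightarrow> (\<forall>t\<in>{a..b}. (deriv_on a b ^^ k) f differentiable (at t within {a..b}))) \<and>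
        (n > 0 \<longrightarrow> abs_cont_on a b ((deriv_on a b ^^ (n - 1)) f) \<and>
          (AE t in lebesgue_on {a..b}.
             (deriv_on a b ^^ (n - 1)) f differentiable (at t within {a..b}))) \<and>
        (deriv_on a b ^^ n) f \<in> Lp p a b}"

definition sobolev_norm :: "ennreal \<Rightarrow> real \<Rightarrow> real \<Rightarrow> nat \<Rightarrow> (real \<Rightarrow> complex) \<Rightarrow> real" where
  "sobolev_norm p a b n f = (\<Sum>k\<le>n. Lp_norm p a b ((deriv_on a b ^^ k) f))"

definition sobolev_vec ::
    "ennreal \<Rightarrow> real \<Rightarrow> real \<Rightarrow> nat \<Rightarrow> nat \<Rightarrow> (real \<Rightarrow> complex vec) set" where
  "sobolev_vec p a b n m =
    {y. (\<forall>t\<in>{a..b}. y t \<in> carrier_vec m) \<and> (\<forall>i<m. (\<lambda>t. y t $ i) \<in> sobolev p a b n)}"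

definition sobolev_vec_norm ::
    "ennreal \<Rightarrow> real \<Rightarrow> real \<Rightarrow> nat \<Rightarrow> nat \<Rightarrow> (real \<Rightarrow> complex vec) \<Rightarrow> real" where
  "sobolev_vec_norm p a b n m y = (\<Sum>i<m. sobolev_norm p a b n (\<lambda>t. y t $ i))"

definition sobolev_mat ::
    "ennreal \<Rightarrow> real \<Rightarrow> real \<Rightarrow> nat \<Rightarrow> nat \<Rightarrow> (real \<Rightarrow> complex mat) set" where
  "sobolev_mat p a b n m =
    {Y. (\<forall>t\<in>{a..b}. Y t \<in> carrier_mat m m) \<and>
        (\<forall>i<m. \<forall>j<m. (\<lambda>t. Y t $$ (i, j)) \<in> sobolev p a b n)}"

definition cvec_norm :: "complex vec \<Rightarrow> real" where
  "cvec_norm c = (\<Sum>i<dim_vec c. cmod (c $ i))"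

(* Continuity makes B u depend only on the restriction of u to [a,b]. *)
definition continuous_linear_op ::
    "ennreal \<Rightarrow> real \<Rightarrow> real \<Rightarrow> nat \<Rightarrow> nat \<Rightarrow> nat \<Rightarrow> ((real \<Rightarrow> complex vec) \<Rightarrow> complex vec) \<Rightarrow> bool"
  where
  "continuous_linear_op p a b n m r B \<longleftrightarrow>
    (\<forall>u\<in>sobolev_vec p a b n m. B u \<in> carrier_vec r) \<and>
    (\<forall>u\<in>sobolev_vec p a b n m. \<forall>v\<in>sobolev_vec p a b n m. B (\<lambda>t. u t + v t) = B u + B v) \<and>
    (\<forall>z. \<forall>u\<in>sobolev_vec p a b n m. B (\<lambda>t. z \<cdot>\<^sub>v u t) = z \<cdot>\<^sub>v B u) \<and>
    (\<forall>u\<in>sobolev_vec p a b n m. \<forall>\<epsilon>>0. \<exists>\<delta>>0. \<forall>v\<in>sobolev_vec p a b n m.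
       sobolev_vec_norm p a b n m (\<lambda>t. v t - u t) < \<delta> \<longrightarrow> cvec_norm (B v - B u) < \<epsilon>)"

definition diff_op ::
    "real \<Rightarrow> real \<Rightarrow> nat \<Rightarrow> (real \<Rightarrow> complex mat) \<Rightarrow> (real \<Rightarrow> complex vec) \<Rightarrow> real \<Rightarrow> complex vec"
  where
  "diff_op a b m A y t = vec m (\<lambda>i. deriv_on a b (\<lambda>s. y s $ i) t) + A t *\<^sub>v y t"

(* The operator y \<mapsto> (L y, B y) from (W_p^n)^m to (W_p^(n-1))^m \<times> C^r is well defined and
   bijective, and its inverse is continuous at every point (L y, B y) of the target space. *)
definition invertible_pair ::
    "ennreal \<Rightarrow> real \<Rightarrow> real \<Rightarrow> nat \<Rightarrow> nat \<Rightarrow> nat \<Rightarrow>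
     ((real \<Rightarrow> complex vec) \<Rightarrow> real \<Rightarrow> complex vec) \<Rightarrow>
     ((real \<Rightarrow> complex vec) \<Rightarrow> complex vec) \<Rightarrow> bool"
  where
  "invertible_pair p a b n m r L B \<longleftrightarrow>
    (\<forall>y\<in>sobolev_vec p a b n m. L y \<in> sobolev_vec p a b (n - 1) m \<and> B y \<in> carrier_vec r) \<and>
    (\<forall>f\<in>sobolev_vec p a b (n - 1) m. \<forall>c\<in>carrier_vec r.
       \<exists>y\<in>sobolev_vec p a b n m.
         (AE t in lebesgue_on {a..b}. L y t = f t) \<and> B y = c \<and>
         (\<forall>z\<in>sobolev_vec p a b n m.
            (AE t in lebesgue_on {a..b}. L z t = f t) \<and> B z = c \<longrightarrow> (\<forall>t\<in>{a..b}. z t = y t))) \<and>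
    (\<forall>y\<in>sobolev_vec p a b n m. \<forall>\<epsilon>>0. \<exists>\<delta>>0. \<forall>z\<in>sobolev_vec p a b n m.
       sobolev_vec_norm p a b (n - 1) m (\<lambda>t. L z t - L y t) + cvec_norm (B z - B y) < \<delta> \<longrightarrow>
       sobolev_vec_norm p a b n m (\<lambda>t. z t - y t) < \<epsilon>)"

definition solves_matrix_Cauchy ::
    "ennreal \<Rightarrow> real \<Rightarrow> real \<Rightarrow> nat \<Rightarrow> nat \<Rightarrow> (real \<Rightarrow> complex mat) \<Rightarrow> (real \<Rightarrow> complex mat) \<Rightarrow> bool"
  where
  "solves_matrix_Cauchy p a b n m A Y \<longleftrightarrow>
    Y \<in> sobolev_mat p a b n m \<and>
    (AE t in lebesgue_on {a..b}.
       mat m m (\<lambda>(i, j). deriv_on a b (\<lambda>s. Y s $$ (i, j)) t) + A t * Y t = 0\<^sub>m m m) \<and>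
    Y a = 1\<^sub>m m"

definition op_on_cols ::
    "nat \<Rightarrow> nat \<Rightarrow> ((real \<Rightarrow> complex vec) \<Rightarrow> complex vec) \<Rightarrow> (real \<Rightarrow> complex mat) \<Rightarrow> complex mat"
  where
  "op_on_cols r m B Y = mat_of_cols r (map (\<lambda>j. B (\<lambda>t. col (Y t) j)) [0..<m])"

end

theory Submission
  imports Defs
begin

text \<open>The solutions of L y = 0 in (W_p^n)^m are exactly the functions Y q with a vector q of C^m, and
q = y(a) is determined by the solution. By linearity B (Y q) = [BY] q, and [BY] has r rows and m
columns. If (L, B) is invertible, the problems L y = 0, B y = c have unique solutions, so
q \<mapsto> [BY] q is a bijection of C^m onto C^r; this forces r = m and det [BY] \<noteq> 0
(mat_bijective_imp_square_invertible).

Conversely, let r = m and let [BY] be invertible. For given f let y0 be the solution of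
L y0 = f, y0(a) = 0. Every solution of L y = f is y0 + Y q for one q, and B y = c holds exactly for
q = [BY]^-1 (c - B y0). This gives existence and uniqueness. The same formula gives continuity of
the inverse, since y0 depends boundedly on f as an element of (W_p^n)^m
(integral_solution_norm_bound).

Three analytic facts carry this argument. An absolutely continuous function is the integral of its
almost everywhere derivative, and an indefinite integral is absolutely continuous with the expected
derivative; so for n = 1 the differential equation is equivalent to an integral equation with
coefficients in L_1. The integral operator of that equation has norm at most 1/2 for the weight
exp (- 2 \<phi>), where \<phi>(t) is the integral of \<Sum> |A_ij| over [a,t]; Picard iteration then gives
existence, and the same weight gives uniqueness and a pointwise bound by the data. Finally,
multiplication maps W_p^k \<times> W_p^(max 1 k) boundedly into W_p^k, so if y and the data
have order k, then y' = f - A y has order k and y has order k + 1, with a norm bound at every step.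

All norm estimates are needed up to constant factors only. In particular the triangle inequality
of L_p is used with the factor 4, which has an elementary proof for all p \<ge> 1.\<close>

section \<open>Absolutely continuous functions\<close>

hide_const (open) Polynomial.content

lemma division_intervalD:
  fixes d :: "real set set"
  assumes "d division_of S" "S \<subseteq> {a..b}" "K \<in> d"
  shows "Inf K \<le> Sup K" "Inf K \<in> {a..b}" "Sup K \<in> {a..b}" "K = {Inf K..Sup K}"
proof -
  obtain u v where K: "K = cbox u v" using division_ofD(4)[OF assms(1,3)] by blast
  have "K \<noteq> {}" using division_ofD(3)[OF assms(1,3)] .
  then have uv: "u \<le> v" using K by auto
  have sub: "K \<subseteq> {a..b}" using division_ofD(2)[OF assms(1,3)] assms(2) by blast
  have e: "Inf K = u" "Sup K = v" using uv K by auto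
  have "u \<in> K" "v \<in> K" using uv K by auto
  then show "Inf K \<le> Sup K" "Inf K \<in> {a..b}" "Sup K \<in> {a..b}" "K = {Inf K..Sup K}"
    using e uv sub K by auto
qed

text \<open>Increments of f that are controlled by those of two absolutely continuous functions stay small
on divisions of small total length. Sums, products and Lipschitz functions of absolutely
continuous functions are all instances.\<close>

lemma abs_cont_on_comparison:
  assumes g: "abs_cont_on a b g" and h: "abs_cont_on a b h"
    and le: "\<And>x y. x \<in> {a..b} \<Longrightarrow> y \<in> {a..b} \<Longrightarrow>
               cmod (f x - f y) \<le> C * (cmod (g x - g y) + cmod (h x - h y))"
  shows "abs_cont_on a b f"
  unfolding abs_cont_on_def
proof (intro allI impI)
  fix e :: real assume e: "e > 0"
  define e' where "e' = e / (2 * (\<bar>C\<bar> + 1))"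
  have e': "e' > 0" using e by (auto simp: e'_def)
  obtain \<delta>1 where \<delta>1: "\<delta>1 > 0" "\<And>d S. d division_of S \<and> S \<subseteq> {a..b} \<and> (\<Sum>K\<in>d. Sup K - Inf K) < \<delta>1 \<Longrightarrow>
       (\<Sum>K\<in>d. cmod (g (Sup K) - g (Inf K))) < e'"
    using g e' unfolding abs_cont_on_def by blast
  obtain \<delta>2 where \<delta>2: "\<delta>2 > 0" "\<And>d S. d division_of S \<and> S \<subseteq> {a..b} \<and> (\<Sum>K\<in>d. Sup K - Inf K) < \<delta>2 \<Longrightarrow>
       (\<Sum>K\<in>d. cmod (h (Sup K) - h (Inf K))) < e'"
    using h e' unfolding abs_cont_on_def by blast
  show "\<exists>\<delta>>0. \<forall>d S. d division_of S \<and> S \<subseteq> {a..b} \<and> (\<Sum>K\<in>d. Sup K - Inf K) < \<delta> \<longrightarrow>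
       (\<Sum>K\<in>d. cmod (f (Sup K) - f (Inf K))) < e"
  proof (intro exI[of _ "min \<delta>1 \<delta>2"] conjI allI impI)
    show "min \<delta>1 \<delta>2 > 0" using \<delta>1 \<delta>2 by auto
    fix d S assume dS: "d division_of S \<and> S \<subseteq> {a..b} \<and> (\<Sum>K\<in>d. Sup K - Inf K) < min \<delta>1 \<delta>2"
    let ?g = "\<Sum>K\<in>d. cmod (g (Sup K) - g (Inf K))" and ?h = "\<Sum>K\<in>d. cmod (h (Sup K) - h (Inf K))"
    have gh: "?g < e'" "?h < e'" using \<delta>1(2)[of d S] \<delta>2(2)[of d S] dS by auto
    have "(\<Sum>K\<in>d. cmod (f (Sup K) - f (Inf K)))
        \<le> (\<Sum>K\<in>d. (\<bar>C\<bar> + 1) * (cmod (g (Sup K) - g (Inf K)) + cmod (h (Sup K) - h (Inf K))))"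
    proof (rule sum_mono)
      fix K assume K: "K \<in> d"
      have "cmod (f (Sup K) - f (Inf K)) \<le> C * (cmod (g (Sup K) - g (Inf K)) + cmod (h (Sup K) - h (Inf K)))"
        using division_intervalD[OF conjunct1[OF dS] _ K] dS le by blast
      also have "\<dots> \<le> (\<bar>C\<bar> + 1) * (cmod (g (Sup K) - g (Inf K)) + cmod (h (Sup K) - h (Inf K)))"
        by (rule mult_right_mono) auto
      finally show "cmod (f (Sup K) - f (Inf K)) \<le> \<dots>" .
    qed
    also have "\<dots> = (\<bar>C\<bar> + 1) * (?g + ?h)"
      by (simp only: sum_distrib_left[symmetric] sum.distrib)
    also have "\<dots> < (\<bar>C\<bar> + 1) * (e' + e')"
      using gh by (intro mult_strict_left_mono) auto
    also have "\<dots> = e"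
    proof -
      have "k * (e / (2 * k) + e / (2 * k)) = e" if "k \<noteq> 0" for k :: real
        using that by (simp add: field_simps)
      moreover have "\<bar>C\<bar> + 1 \<noteq> 0" by linarith
      ultimately show ?thesis unfolding e'_def by blast
    qed
    finally show "(\<Sum>K\<in>d. cmod (f (Sup K) - f (Inf K))) < e" .
  qed
qed

lemma abs_cont_on_subinterval:
  assumes "abs_cont_on a b f" "{c..d} \<subseteq> {a..b}"
  shows "abs_cont_on c d f"
  using assms unfolding abs_cont_on_def by (meson order_trans)

lemma abs_cont_on_cong:
  assumes "\<And>x. x \<in> {a..b} \<Longrightarrow> f x = g x"
  shows "abs_cont_on a b f \<longleftrightarrow> abs_cont_on a b g"
proof -
  have "abs_cont_on a b f \<Longrightarrow> abs_cont_on a b g"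
    if "\<And>x. x \<in> {a..b} \<Longrightarrow> f x = g x" for f g
    by (rule abs_cont_on_comparison[where g=f and h=f and C=1]) (auto simp: that)
  then show ?thesis using assms by metis
qed

lemma abs_cont_on_imp_continuous_on:
  assumes "abs_cont_on a b f"
  shows "continuous_on {a..b} f"
  unfolding continuous_on_iff
proof (intro ballI allI impI)
  fix x e :: real assume x: "x \<in> {a..b}" and e: "0 < e"
  obtain \<delta> where \<delta>: "\<delta> > 0" "\<And>d S. d division_of S \<and> S \<subseteq> {a..b} \<and> (\<Sum>K\<in>d. Sup K - Inf K) < \<delta> \<Longrightarrow>
       (\<Sum>K\<in>d. cmod (f (Sup K) - f (Inf K))) < e"
    using assms e unfolding abs_cont_on_def by blast
  have *: "cmod (f v - f u) < e" if "u \<in> {a..b}" "v \<in> {a..b}" "u \<le> v" "v - u < \<delta>" for u v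
  proof -
    have "{{u..v}} division_of {u..v}"
      using that(3) by (metis atLeastatMost_empty_iff box_real(2) division_of_self leD not_less)
    then show ?thesis using \<delta>(2)[of "{{u..v}}" "{u..v}"] that by auto
  qed
  show "\<exists>d>0. \<forall>x'\<in>{a..b}. dist x' x < d \<longrightarrow> dist (f x') (f x) < e"
  proof (intro exI[of _ \<delta>] conjI ballI impI)
    fix y assume y: "y \<in> {a..b}" "dist y x < \<delta>"
    show "dist (f y) (f x) < e"
      using *[of x y] *[of y x] x y by (cases "x \<le> y") (auto simp: dist_norm norm_minus_commute)
  qed (use \<delta> in auto)
qed

text \<open>The Henstock-Kurzweil integral disregards negligible sets, the spaces L_p disregard null sets of
the restricted Lebesgue measure. This lemma and the next one translate between the two.\<close>

lemma AE_lebesgue_on_negligible: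
  assumes "AE t in lebesgue_on {a..b::real}. P t"
  shows "negligible {t\<in>{a..b}. \<not> P t}"
proof -
  have "AE t in lebesgue. t \<in> {a..b} \<longrightarrow> P t"
    using assms by (subst (asm) AE_restrict_space_iff) auto
  then obtain N where N: "N \<in> null_sets lebesgue" "{t \<in> space lebesgue. \<not> (t \<in> {a..b} \<longrightarrow> P t)} \<subseteq> N"
    unfolding eventually_ae_filter by blast
  then have "negligible N" by (simp add: negligible_iff_null_sets)
  then show ?thesis by (rule negligible_subset) (use N in auto)
qed

lemma negligible_AE_lebesgue_on:
  assumes "negligible N" "\<And>t. t \<in> {a..b::real} \<Longrightarrow> t \<notin> N \<Longrightarrow> P t"
  shows "AE t in lebesgue_on {a..b}. P t"
proof -
  have "AE t in lebesgue. t \<in> {a..b} \<longrightarrow> P t"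
    by (rule AE_I'[of N]) (use assms in \<open>auto simp: negligible_iff_null_sets\<close>)
  then show ?thesis by (subst AE_restrict_space_iff) auto
qed

text \<open>Riemann sums for a fine gauge are compared with the telescoping sum of the increments of f. At a
tag where f is differentiable, the difference is small relative to the length of the interval.
The gauge sends the intervals tagged in the exceptional null set into an open set of measure less
than \<delta>; there absolute continuity bounds the increments themselves.\<close>

lemma abs_cont_on_fundamental_theorem:
  assumes ab: "a \<le> b" and ac: "abs_cont_on a b f"
    and der: "AE t in lebesgue_on {a..b}. (f has_vector_derivative g t) (at t within {a..b})"
  shows "(g has_integral (f b - f a)) {a..b}"
proof -
  define N where "N = {t\<in>{a..b}. \<not> (f has_vector_derivative g t) (at t within {a..b})}"
  have negN: "negligible N" unfolding N_def by (rule AE_lebesgue_on_negligible[OF der])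
  (* with the value 0 on N the exceptional tags contribute only increments of f *)
  define g' where "g' t = (if t \<in> N then 0 else g t)" for t
  have "(g' has_integral (f b - f a)) (cbox a b)"
    unfolding has_integral
  proof (intro allI impI)
    fix e :: real assume e: "e > 0"
    (* b - a + 1 instead of b - a covers the degenerate interval a = b *)
    define e1 where "e1 = e / (2 * (b - a + 1))"
    have e1: "e1 > 0" "e1 * (b - a) < e / 2" using ab e by (auto simp: e1_def field_simps)
    obtain \<delta> where \<delta>: "\<delta> > 0" "\<And>d S. d division_of S \<and> S \<subseteq> {a..b} \<and> (\<Sum>K\<in>d. Sup K - Inf K) < \<delta> \<Longrightarrow>
         (\<Sum>K\<in>d. cmod (f (Sup K) - f (Inf K))) < e / 2"
      using ac e unfolding abs_cont_on_def by (meson half_gt_zero)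
    have "N \<in> sets lebesgue" using negN by (simp add: negligible_imp_sets)
    then obtain U where U: "open U" "N \<subseteq> U" "U - N \<in> lmeasurable" "emeasure lebesgue (U - N) < ennreal \<delta>"
      using sets_lebesgue_outer_open \<delta>(1) by metis
    have Um: "U \<in> lmeasurable"
    proof -
      have "(U - N) \<union> N \<in> lmeasurable" by (intro fmeasurable.Un U negligible_imp_measurable negN)
      moreover have "(U - N) \<union> N = U" using U by auto
      ultimately show ?thesis by simp
    qed
    have Ud: "measure lebesgue U < \<delta>"
    proof -
      have "measure lebesgue U = measure lebesgue (U - N)"
        by (rule measure_Diff_null_set[symmetric])
          (use negN Um in \<open>auto simp: negligible_iff_null_sets\<close>)
      also have "\<dots> < \<delta>" using U(3,4) \<delta>(1) by (simp add: emeasure_eq_measure2 ennreal_less_iff)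
      finally show ?thesis .
    qed
    have "\<exists>r>0. (x \<in> N \<longrightarrow> ball x r \<subseteq> U) \<and> (x \<in> {a..b} - N \<longrightarrow>
           (\<forall>y\<in>{a..b}. norm (y-x) < r \<longrightarrow> norm (f y - f x - (y-x) *\<^sub>R g x) \<le> e1 * norm (y-x)))" for x
    proof (cases "x \<in> N")
      case True
      then obtain s where "s > 0" "ball x s \<subseteq> U" using openE[OF U(1)] U(2) by blast
      then show ?thesis using True by (intro exI[of _ s]) auto
    next
      case False
      show ?thesis
      proof (cases "x \<in> {a..b}")
        case True
        with False have "(f has_vector_derivative g x) (at x within {a..b})" by (auto simp: N_def)
        then obtain s where "s > 0" "\<forall>y\<in>{a..b}. norm (y-x) < s \<longrightarrow>
            norm (f y - f x - (y-x) *\<^sub>R g x) \<le> e1 * norm (y-x)"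
          using e1(1) unfolding has_vector_derivative_def has_derivative_within_alt by blast
        then show ?thesis using False by (intro exI[of _ s]) simp
      qed (use False in \<open>auto intro: exI[of _ 1]\<close>)
    qed
    then obtain r where r: "\<And>x. r x > 0" "\<And>x. x \<in> N \<Longrightarrow> ball x (r x) \<subseteq> U"
      "\<And>x y. x \<in> {a..b} - N \<Longrightarrow> y\<in>{a..b} \<Longrightarrow> norm (y-x) < r x \<Longrightarrow>
          norm (f y - f x - (y-x) *\<^sub>R g x) \<le> e1 * norm (y-x)"
      by metis
    show "\<exists>\<gamma>. gauge \<gamma> \<and> (\<forall>D. D tagged_division_of cbox a b \<and> \<gamma> fine D \<longrightarrow>
             norm ((\<Sum>(x,k)\<in>D. content k *\<^sub>R g' x) - (f b - f a)) < e)"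
    proof (intro exI[of _ "\<lambda>x. ball x (r x)"] conjI allI impI)
      show "gauge (\<lambda>x. ball x (r x))" using r(1) by (rule gauge_ball_dependent[rule_format])
      fix D assume D: "D tagged_division_of cbox a b \<and> (\<lambda>x. ball x (r x)) fine D"
      have finD: "finite D" using D by blast
      define DN where "DN = {(x,K)\<in>D. x \<in> N}"
      have DNsub: "DN \<subseteq> D" by (auto simp: DN_def)
      have DNt: "DN tagged_division_of (\<Union>(snd ` DN))"
        using D DNsub by (metis tagged_division_of_def tagged_partial_division_of_Union_self tagged_partial_division_subset)
      have DNd: "snd ` DN division_of (\<Union>(snd ` DN))" by (rule division_of_tagged_division[OF DNt])
      have Dint: "\<exists>u v. K = {u..v} \<and> x \<in> {u..v} \<and> u \<le> v \<and> {u..v} \<subseteq> {a..b} \<and> {u..v} \<subseteq> ball x (r x)"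
        if xKD: "(x,K) \<in> D" for x K
      proof -
        obtain u v where K: "K = cbox u v" using tagged_division_ofD(4)[OF conjunct1[OF D] xKD] by blast
        have "x \<in> K" "K \<subseteq> cbox a b" "K \<subseteq> ball x (r x)"
          using tagged_division_ofD(2,3)[OF conjunct1[OF D] xKD] fineD[OF conjunct2[OF D] xKD] by auto
        then show ?thesis using K by (intro exI[of _ u] exI[of _ v]) auto
      qed
      have sub: "\<Union>(snd ` DN) \<subseteq> {a..b}" using Dint DNsub by force
      have subU: "\<Union>(snd ` DN) \<subseteq> U"
      proof
        fix y assume "y \<in> \<Union>(snd ` DN)"
        then obtain x K where K: "(x, K) \<in> D" "x \<in> N" "y \<in> K" by (auto simp: DN_def)
        then have "y \<in> ball x (r x)" using Dint[OF K(1)] by blast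
        then show "y \<in> U" using r(2)[OF K(2)] by blast
      qed
      have "(\<Sum>K\<in>snd ` DN. Sup K - Inf K) = (\<Sum>K\<in>snd ` DN. measure lebesgue K)"
      proof (rule sum.cong[OF refl])
        fix K assume "K \<in> snd ` DN"
        then obtain x where "(x, K) \<in> D" using DNsub by auto
        then obtain u v where "K = {u..v}" "u \<le> v" using Dint by blast
        then show "Sup K - Inf K = measure lebesgue K" by simp
      qed
      also have "\<dots> = measure lebesgue (\<Union>(snd ` DN))"
        using content_division[OF DNd] by simp
      also have "\<dots> \<le> measure lebesgue U"
        using subU Um by (intro measure_mono_fmeasurable) (auto intro!: fmeasurableD lmeasurable_division[OF DNd])
      finally have "(\<Sum>K\<in>snd ` DN. Sup K - Inf K) < \<delta>" using Ud by simp
      then have "(\<Sum>K\<in>snd ` DN. cmod (f (Sup K) - f (Inf K))) < e / 2"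
        using \<delta>(2) DNd sub by blast
      moreover have "(\<Sum>(x,K)\<in>DN. cmod (f (Sup K) - f (Inf K))) = (\<Sum>K\<in>snd ` DN. cmod (f (Sup K) - f (Inf K)))"
      proof -
        (* Sup and Inf of the empty set are unspecified, so the summand is set to 0 there *)
        let ?d = "\<lambda>K. if K = {} then 0 else cmod (f (Sup K) - f (Inf K))"
        have "(\<Sum>(x,K)\<in>DN. ?d K) = (\<Sum>K\<in>snd ` DN. ?d K)"
          by (rule sum.over_tagged_division_lemma[OF DNt]) (auto simp: box_eq_empty)
        moreover have ne: "K \<noteq> {}" if "(x, K) \<in> DN" for x K using Dint DNsub that by blast
        moreover have "(\<Sum>(x,K)\<in>DN. ?d K) = (\<Sum>(x,K)\<in>DN. cmod (f (Sup K) - f (Inf K)))"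
          using ne by (intro sum.cong) auto
        moreover have "(\<Sum>K\<in>snd ` DN. ?d K) = (\<Sum>K\<in>snd ` DN. cmod (f (Sup K) - f (Inf K)))"
          using ne by (intro sum.cong) auto
        ultimately show ?thesis by simp
      qed
      ultimately have S1: "(\<Sum>(x,K)\<in>DN. cmod (f (Sup K) - f (Inf K))) < e / 2" by simp
      have ba: "b - a = (\<Sum>(x,K)\<in>D. Sup K - Inf K)" "f b - f a = (\<Sum>(x,K)\<in>D. f(Sup K) - f(Inf K))"
        using additive_tagged_division_1[OF ab, of D "\<lambda>x. x"] additive_tagged_division_1[OF ab, of D f] D
        by auto
      have term_le: "norm (content K *\<^sub>R g' x - (f (Sup K) - f (Inf K)))
           \<le> (if x \<in> N then cmod (f (Sup K) - f (Inf K)) else 0) + e1 * (Sup K - Inf K)"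
        if xKD: "(x,K) \<in> D" for x K
      proof -
        obtain u v where k: "K = {u..v}" and x: "x \<in> {u..v}" and uv: "u \<le> v"
          and sub: "{u..v} \<subseteq> {a..b}" and bal: "{u..v} \<subseteq> ball x (r x)" using Dint[OF xKD] by blast
        have uvm: "u \<in> {u..v}" "v \<in> {u..v}" using uv by auto
        show ?thesis
        proof (cases "x \<in> N")
          case True
          then show ?thesis using k uv e1(1) by (simp add: g'_def norm_minus_commute)
        next
          case False
          then have xN: "x \<in> {a..b} - N" using x sub by auto
          have "norm ((v - u) *\<^sub>R g x - (f v - f u)) = norm (f u - f x - (u - x) *\<^sub>R g x - (f v - f x - (v - x) *\<^sub>R g x))"
            by (auto simp: algebra_simps)
          also have "\<dots> \<le> norm (f u - f x - (u - x) *\<^sub>R g x) + norm (f v - f x - (v - x) *\<^sub>R g x)"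
            by (rule norm_triangle_ineq4)
          also have "\<dots> \<le> e1 * norm (u - x) + e1 * norm (v - x)"
            using uvm sub bal by (intro add_mono r(3)[OF xN]) (auto simp: subset_iff dist_real_def)
          also have "\<dots> = e1 * (v - u)"
          proof -
            have "norm (u - x) = x - u" "norm (v - x) = v - x" using x by auto
            then show ?thesis by (simp only: distrib_left[symmetric]) (simp only: algebra_simps)
          qed
          finally have "norm ((v - u) *\<^sub>R g x - (f v - f u)) \<le> e1 * (v - u)" .
          moreover have "content K = v - u" "Sup K = v" "Inf K = u" "g' x = g x"
            using k uv False by (simp_all add: g'_def)
          ultimately show ?thesis by (simp only: False if_False add_0)
        qed
      qed
      have "norm ((\<Sum>(x,k)\<in>D. content k *\<^sub>R g' x) - (f b - f a))
          = norm (\<Sum>(x,K)\<in>D. content K *\<^sub>R g' x - (f (Sup K) - f (Inf K)))"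
        by (simp only: ba(2) sum_subtractf[symmetric] split_def)
      also have "\<dots> \<le> (\<Sum>(x,K)\<in>D. (if x \<in> N then cmod (f (Sup K) - f (Inf K)) else 0) + e1 * (Sup K - Inf K))"
      proof (rule sum_norm_le)
        fix z assume "z \<in> D"
        then show "norm (case z of (x, K) \<Rightarrow> content K *\<^sub>R g' x - (f (Sup K) - f (Inf K)))
            \<le> (case z of (x, K) \<Rightarrow> (if x \<in> N then cmod (f (Sup K) - f (Inf K)) else 0) + e1 * (Sup K - Inf K))"
          by (cases z) (simp only: split_conv term_le)
      qed
      also have "\<dots> = (\<Sum>(x,K)\<in>D. (if x \<in> N then cmod (f (Sup K) - f (Inf K)) else 0)) + e1 * (b - a)"
      proof -
        have "(\<Sum>(x,K)\<in>D. e1 * (Sup K - Inf K)) = e1 * (b - a)"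
          unfolding ba(1) sum_distrib_left by (rule sum.cong) auto
        then show ?thesis by (simp only: split_def sum.distrib)
      qed
      also have "(\<Sum>(x,K)\<in>D. (if x \<in> N then cmod (f (Sup K) - f (Inf K)) else 0))
           = (\<Sum>(x,K)\<in>DN. cmod (f (Sup K) - f (Inf K)))"
        unfolding DN_def using finD
        by (intro sum.mono_neutral_cong_right) (auto split: if_splits)
      also have "\<dots> + e1 * (b - a) < e / 2 + e / 2" using S1 e1(2) by simp
      finally show "norm ((\<Sum>(x,k)\<in>D. content k *\<^sub>R g' x) - (f b - f a)) < e" by simp
    qed
  qed
  then have "(g has_integral (f b - f a)) (cbox a b)"
    by (intro has_integral_spike[OF negN _ \<open>(g' has_integral (f b - f a)) (cbox a b)\<close>]) (simp add: g'_def)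
  then show ?thesis by simp
qed

lemma L1_imp_integrable_on:
  fixes g :: "real \<Rightarrow> 'a::euclidean_space"
  assumes "integrable (lebesgue_on {a..b}) g" "{c..d} \<subseteq> {a..b}"
  shows "g integrable_on {c..d}"
  using integrable_on_lebesgue_on[OF assms(1)] integrable_on_subinterval[OF _ assms(2)] by simp

text \<open>A truncation min g k has almost the same integral as g by dominated convergence, and the integral
of a function bounded by k over S is at most k times the measure of S. Absolute continuity of
functions is about divisions, hence the restriction to sets S that have one.\<close>

lemma small_set_integral:
  fixes g :: "real \<Rightarrow> real"
  assumes int: "g integrable_on {a..b}" and nn: "\<And>x. x \<in> {a..b} \<Longrightarrow> 0 \<le> g x" and e: "e > 0"
  obtains \<delta> where "\<delta> > 0"
    "\<And>d S. d division_of S \<Longrightarrow> S \<subseteq> {a..b} \<Longrightarrow> measure lebesgue S < \<delta> \<Longrightarrow> integral S g < e"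
proof -
  have ai: "g absolutely_integrable_on {a..b}"
    using int nn by (intro nonnegative_absolutely_integrable_1) auto
  have "(\<lambda>x. min (g x) (real k)) absolutely_integrable_on {a..b}" for k
    by (intro absolutely_integrable_min_1 ai absolutely_integrable_continuous_real continuous_intros)
  then have mint: "(\<lambda>x. min (g x) (real k)) integrable_on {a..b}" for k
    by (simp add: absolutely_integrable_on_def)
  have "(\<lambda>k. integral {a..b} (\<lambda>x. min (g x) (real k))) \<longlonglongrightarrow> integral {a..b} g"
  proof (rule dominated_convergence(2)[OF mint int])
    show "norm (min (g x) (real k)) \<le> g x" if "x \<in> {a..b}" for k x using nn[OF that] by auto
    show "(\<lambda>k. min (g x) (real k)) \<longlonglongrightarrow> g x" if "x \<in> {a..b}" for x
    proof (rule tendsto_eventually)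
      obtain K where K: "g x \<le> real K" using real_arch_simple by blast
      show "\<forall>\<^sub>F k in sequentially. min (g x) (real k) = g x"
      proof (rule eventually_sequentiallyI)
        fix k assume "K \<le> k"
        then have "real K \<le> real k" by simp
        then show "min (g x) (real k) = g x" using K by linarith
      qed
    qed
  qed
  then obtain k where k: "\<bar>integral {a..b} (\<lambda>x. min (g x) (real k)) - integral {a..b} g\<bar> < e / 2"
    using LIMSEQ_D[of _ _ "e/2"] e by (metis half_gt_zero le_refl real_norm_def)
  show ?thesis
  proof
    show "e / (2 * (real k + 1)) > 0" using e by simp
    fix d S assume d: "d division_of S" and S: "S \<subseteq> {a..b}" and m: "measure lebesgue S < e / (2 * (real k + 1))"
    have Sm: "S \<in> lmeasurable" using lmeasurable_division[OF d] .
    have gS: "h integrable_on S" if "h absolutely_integrable_on {a..b}" for h :: "real \<Rightarrow> real"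
      using set_integrable_subset[OF that _ S] Sm by (auto simp: absolutely_integrable_on_def fmeasurableD)
    have mai: "(\<lambda>x. min (g x) (real k)) absolutely_integrable_on {a..b}"
      by (intro absolutely_integrable_min_1 ai absolutely_integrable_continuous_real continuous_intros)
    have "integral S (\<lambda>x. g x - min (g x) (real k)) \<le> integral {a..b} (\<lambda>x. g x - min (g x) (real k))"
      by (intro integral_subset_le[OF S] gS set_integral_diff ai mai integrable_diff int mint) auto
    also have "\<dots> = integral {a..b} g - integral {a..b} (\<lambda>x. min (g x) (real k))"
      by (intro integral_diff int mint)
    also have "\<dots> < e / 2" using k by linarith
    finally have "integral S g - integral S (\<lambda>x. min (g x) (real k)) < e / 2"
      by (subst (asm) integral_diff) (intro gS ai mai)+
    moreover have "integral S (\<lambda>x. min (g x) (real k)) \<le> integral S (\<lambda>x. real k)"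
      using Sm by (intro integral_le gS mai) (auto simp: integrable_on_const)
    moreover have "integral S (\<lambda>x. real k) = real k * measure lebesgue S"
      using lmeasure_integral[OF Sm] integral_mult_right[of S "real k" "\<lambda>x. 1"] by simp
    moreover have "real k * measure lebesgue S \<le> e / 2"
    proof -
      have "real k * measure lebesgue S \<le> (real k + 1) * (e / (2 * (real k + 1)))"
        using m by (intro mult_mono) auto
      also have "\<dots> = e / 2" by (simp add: field_simps)
      finally show ?thesis .
    qed
    ultimately show "integral S g < e" by linarith
  qed
qed

lemma indefinite_integral_diff:
  fixes g :: "real \<Rightarrow> 'a::banach"
  assumes "g integrable_on {a..b}" "x \<in> {a..b}" "y \<in> {a..b}" "x \<le> y"
  shows "integral {a..y} g - integral {a..x} g = integral {x..y} g"
proof -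
  have "g integrable_on {a..y}" by (rule integrable_on_subinterval[OF assms(1)]) (use assms in auto)
  then show ?thesis using Henstock_Kurzweil_Integration.integral_combine[where a=a and c=x and b=y and f=g] assms
    by (simp add: algebra_simps)
qed

lemma abs_cont_on_indefinite_integral:
  assumes g: "integrable (lebesgue_on {a..b}) g"
  shows "abs_cont_on a b (\<lambda>t. c + integral {a..t} g)"
  unfolding abs_cont_on_def
proof (intro allI impI)
  fix e :: real assume e: "e > 0"
  have gi: "g integrable_on {a..b}" using integrable_on_lebesgue_on[OF g] by simp
  have ni: "(\<lambda>x. cmod (g x)) integrable_on {a..b}" using integrable_on_lebesgue_on[OF integrable_norm[OF g]] by simp
  obtain \<delta> where \<delta>: "\<delta> > 0"
    "\<And>d S. d division_of S \<Longrightarrow> S \<subseteq> {a..b} \<Longrightarrow> measure lebesgue S < \<delta> \<Longrightarrow> integral S (\<lambda>x. cmod (g x)) < e"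
    using small_set_integral[OF ni _ e] by auto
  show "\<exists>\<delta>>0. \<forall>d S. d division_of S \<and> S \<subseteq> {a..b} \<and> (\<Sum>K\<in>d. Sup K - Inf K) < \<delta> \<longrightarrow>
       (\<Sum>K\<in>d. cmod ((c + integral {a..Sup K} g) - (c + integral {a..Inf K} g))) < e"
  proof (intro exI[of _ \<delta>] conjI allI impI)
    fix d S assume a: "d division_of S \<and> S \<subseteq> {a..b} \<and> (\<Sum>K\<in>d. Sup K - Inf K) < \<delta>"
    then have d: "d division_of S" and S: "S \<subseteq> {a..b}" by auto
    note D = division_intervalD[OF d S]
    have "(\<Sum>K\<in>d. Sup K - Inf K) = (\<Sum>K\<in>d. measure lebesgue K)"
    proof (rule sum.cong[OF refl])
      fix K assume K: "K \<in> d"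
      have "measure lebesgue K = measure lebesgue {Inf K..Sup K}" using D(4)[OF K] by simp
      also have "\<dots> = Sup K - Inf K" using D(1)[OF K] by simp
      finally show "Sup K - Inf K = measure lebesgue K" by simp
    qed
    also have "\<dots> = measure lebesgue S" using content_division[OF d] by simp
    finally have m: "measure lebesgue S < \<delta>" using a by simp
    have "(\<Sum>K\<in>d. cmod ((c + integral {a..Sup K} g) - (c + integral {a..Inf K} g)))
        \<le> (\<Sum>K\<in>d. integral K (\<lambda>x. cmod (g x)))"
    proof (rule sum_mono)
      fix K assume K: "K \<in> d"
      have sub: "{Inf K..Sup K} \<subseteq> {a..b}" using D(2,3)[OF K] by auto
      have "cmod ((c + integral {a..Sup K} g) - (c + integral {a..Inf K} g)) = cmod (integral {Inf K..Sup K} g)"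
        using indefinite_integral_diff[OF gi D(2)[OF K] D(3)[OF K] D(1)[OF K]] by simp
      also have "\<dots> \<le> integral {Inf K..Sup K} (\<lambda>x. cmod (g x))"
        by (intro integral_norm_bound_integral integrable_on_subinterval[OF gi sub]
            integrable_on_subinterval[OF ni sub]) auto
      also have "\<dots> = integral K (\<lambda>x. cmod (g x))" using D(4)[OF K] by simp
      finally show "cmod ((c + integral {a..Sup K} g) - (c + integral {a..Inf K} g)) \<le> integral K (\<lambda>x. cmod (g x))" .
    qed
    also have "\<dots> = integral S (\<lambda>x. cmod (g x))"
    proof (rule integral_combine_division_bottomup[OF d, symmetric])
      fix K assume K: "K \<in> d"
      have sub: "{Inf K..Sup K} \<subseteq> {a..b}" using D(2,3)[OF K] by auto
      show "(\<lambda>x. cmod (g x)) integrable_on K"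
        using integrable_on_subinterval[OF ni sub] D(4)[OF K] by simp
    qed
    also have "\<dots> < e" using \<delta>(2)[OF d S m] .
    finally show "(\<Sum>K\<in>d. cmod ((c + integral {a..Sup K} g) - (c + integral {a..Inf K} g))) < e" .
  qed (use \<delta> in auto)
qed

lemma integrable_restrict_cbox:
  fixes f :: "real \<Rightarrow> complex"
  assumes "f integrable_on {a..b}"
  shows "(\<lambda>x. if x \<in> {a..b} then f x else 0) integrable_on cbox u v"
proof -
  have "(\<lambda>x. if x \<in> {a..b} then f x else 0) integrable_on UNIV"
    using assms by (simp only: integrable_restrict_UNIV)
  then show ?thesis by (rule integrable_on_subcbox) simp
qed

text \<open>Lebesgue's differentiation theorem on the line. Its form for cubes with a fixed corner controls
the difference quotients to the right of almost every point; applied to the reflected function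
f(-x) it controls those to the left.\<close>

lemma indefinite_integral_has_vector_derivative_AE:
  fixes g :: "real \<Rightarrow> complex"
  assumes g: "g integrable_on {a..b}"
  shows "AE t in lebesgue_on {a..b}. ((\<lambda>t. c + integral {a..t} g) has_vector_derivative g t) (at t within {a..b})"
proof -
  define f where "f x = (if x \<in> {a..b} then g x else 0)" for x
  define f' where "f' = (\<lambda>x. f (- x))"
  have fi: "f integrable_on cbox u v" for u v unfolding f_def by (rule integrable_restrict_cbox[OF g])
  have fi': "f' integrable_on cbox u v" for u v
  proof -
    have "f integrable_on {- v..- u}" using fi[of "-v" "-u"] by simp
    then have "(\<lambda>x. f (- x)) integrable_on {- (- u)..- (- v)}"
      by (rule Henstock_Kurzweil_Integration.integrable_reflect_real[where f=f, THEN iffD2])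
    then show ?thesis by (simp add: f'_def)
  qed
  have fg: "integral {u..v} g = integral {u..v} f" if uv: "{u..v} \<subseteq> {a..b}" for u v
    by (rule integral_cong) (use uv in \<open>auto simp: f_def subset_iff\<close>)
  obtain N where N: "negligible N" "\<And>x e. x \<notin> N \<Longrightarrow> 0 < e \<Longrightarrow>
      \<exists>d>0. \<forall>h. 0 < h \<and> h < d \<longrightarrow> norm (integral (cbox x (x + h *\<^sub>R One)) f /\<^sub>R h ^ DIM(real) - f x) < e"
  proof (rule integrable_ccontinuous_explicit[of f, OF fi])
    fix M assume M: "negligible M" "\<And>x e. x \<notin> M \<Longrightarrow> 0 < e \<Longrightarrow>
      \<exists>d>0. \<forall>h. 0 < h \<and> h < d \<longrightarrow> norm (integral (cbox x (x + h *\<^sub>R One)) f /\<^sub>R h ^ DIM(real) - f x) < e"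
    show thesis by (rule that[OF M(1)]) (rule M(2))
  qed
  obtain N' where N': "negligible N'" "\<And>x e. x \<notin> N' \<Longrightarrow> 0 < e \<Longrightarrow>
      \<exists>d>0. \<forall>h. 0 < h \<and> h < d \<longrightarrow> norm (integral (cbox x (x + h *\<^sub>R One)) f' /\<^sub>R h ^ DIM(real) - f' x) < e"
  proof (rule integrable_ccontinuous_explicit[of f', OF fi'])
    fix M assume M: "negligible M" "\<And>x e. x \<notin> M \<Longrightarrow> 0 < e \<Longrightarrow>
      \<exists>d>0. \<forall>h. 0 < h \<and> h < d \<longrightarrow> norm (integral (cbox x (x + h *\<^sub>R One)) f' /\<^sub>R h ^ DIM(real) - f' x) < e"
    show thesis by (rule that[OF M(1)]) (rule M(2))
  qed
  have neg: "negligible (N \<union> uminus ` N')"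
  proof (rule negligible_Un[OF N(1)])
    show "negligible (uminus ` N')"
    proof (rule negligible_locally_Lipschitz_image[OF _ N'(1)])
      fix x :: real
      show "\<exists>T B. open T \<and> x \<in> T \<and> (\<forall>y\<in>N' \<inter> T. norm (- y - - x) \<le> B * norm (y - x))"
        by (intro exI[of _ UNIV] exI[of _ "1::real"]) auto
    qed simp
  qed
  show ?thesis
  proof (rule negligible_AE_lebesgue_on[OF neg])
    fix t assume t: "t \<in> {a..b}" and tN: "t \<notin> N \<union> uminus ` N'"
    have t1: "t \<notin> N" and t2: "-t \<notin> N'" using tN by (auto simp: image_iff)
    show "((\<lambda>t. c + integral {a..t} g) has_vector_derivative g t) (at t within {a..b})"
      unfolding has_vector_derivative_def has_derivative_within_alt
    proof (intro conjI allI impI)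
      show "bounded_linear (\<lambda>x. x *\<^sub>R g t)" by (rule bounded_linear_scaleR_left)
      fix e :: real assume e: "e > 0"
      obtain d1 where d1: "d1 > 0" "\<And>h. 0 < h \<Longrightarrow> h < d1 \<Longrightarrow> norm (integral {t..t + h} f /\<^sub>R h - f t) < e"
        using N(2)[OF t1 e] by auto
      obtain d2 where d2: "d2 > 0" "\<And>h. 0 < h \<Longrightarrow> h < d2 \<Longrightarrow> norm (integral {-t..-t + h} f' /\<^sub>R h - f' (-t)) < e"
        using N'(2)[OF t2 e] by auto
      have scale: "norm (I - h *\<^sub>R z) \<le> e * h" if "norm (I /\<^sub>R h - z) < e" "h > 0" for I z :: complex and h
      proof -
        have "I - h *\<^sub>R z = h *\<^sub>R (I /\<^sub>R h - z)" using that(2) by (simp add: scaleR_right_diff_distrib)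
        then have "norm (I - h *\<^sub>R z) = h * norm (I /\<^sub>R h - z)" using that(2) by simp
        also have "\<dots> \<le> h * e" using that by (intro mult_left_mono) auto
        finally show ?thesis by (simp add: mult.commute)
      qed
      show "\<exists>d>0. \<forall>y\<in>{a..b}. norm (y - t) < d \<longrightarrow>
          norm (c + integral {a..y} g - (c + integral {a..t} g) - (y - t) *\<^sub>R g t) \<le> e * norm (y - t)"
      proof (intro exI[of _ "min d1 d2"] conjI ballI impI)
        fix y assume y: "y \<in> {a..b}" "norm (y - t) < min d1 d2"
        consider "y = t" | "y > t" | "y < t" by linarith
        then show "norm (c + integral {a..y} g - (c + integral {a..t} g) - (y - t) *\<^sub>R g t) \<le> e * norm (y - t)"
        proof cases
          case 1 then show ?thesis by simp
        next
          case 2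
          have "integral {a..y} g - integral {a..t} g = integral {t..y} f"
            using indefinite_integral_diff[OF g t y(1)] fg[of t y] 2 t y(1) by auto
          moreover have "norm (integral {t..y} f - (y - t) *\<^sub>R f t) \<le> e * (y - t)"
            using scale[OF d1(2)[of "y - t"]] 2 y(2) by auto
          ultimately show ?thesis using 2 t by (simp add: f_def)
        next
          case 3
          have "integral {a..t} g - integral {a..y} g = integral {y..t} f"
            using indefinite_integral_diff[OF g y(1) t] fg[of y t] 3 t y(1) by auto
          moreover have "integral {y..t} f = integral {-t..-t + (t - y)} f'"
            unfolding f'_def using Henstock_Kurzweil_Integration.integral_reflect_real[where f=f and a="y" and b="t"] by simp
          moreover have "norm (integral {-t..-t + (t - y)} f' - (t - y) *\<^sub>R f' (- t)) \<le> e * (t - y)"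
            using scale[OF d2(2)[of "t - y"]] 3 y(2) by auto
          ultimately have "norm (integral {a..t} g - integral {a..y} g - (t - y) *\<^sub>R g t) \<le> e * (t - y)"
            using t by (simp add: f_def f'_def)
          moreover have "c + integral {a..y} g - (c + integral {a..t} g) - (y - t) *\<^sub>R g t
             = - (integral {a..t} g - integral {a..y} g - (t - y) *\<^sub>R g t)"
            by (simp add: scaleR_left_diff_distrib)
          ultimately show ?thesis using 3 by (simp only: norm_minus_cancel) simp
        qed
      qed (use d1 d2 in auto)
    qed
  qed
qed

lemma abs_exp_diff_le:
  fixes u v M :: real
  assumes "u \<le> M" "v \<le> M"
  shows "\<bar>exp u - exp v\<bar> \<le> exp M * \<bar>u - v\<bar>"
proof -
  have *: "exp y - exp x \<le> exp M * (y - x)" if "x \<le> y" "y \<le> M" for x y :: real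
  proof -
    have "exp y - exp x = exp y * (1 - exp (x - y))" by (simp add: right_diff_distrib exp_add[symmetric])
    also have "\<dots> \<le> exp y * (y - x)" 
    proof (rule mult_left_mono)
      show "1 - exp (x - y) \<le> y - x" using exp_ge_add_one_self[of "x - y"] by linarith
    qed simp
    also have "\<dots> \<le> exp M * (y - x)" using that by (intro mult_right_mono) auto
    finally show ?thesis .
  qed
  show ?thesis
  proof (cases "v \<le> u")
    case True
    then show ?thesis using *[OF True assms(1)] by simp
  next
    case False
    then show ?thesis using *[of u v] assms(2) by simp
  qed
qed

text \<open>The chain rule for an absolutely continuous exponent. Because the integral of \<alpha> exp (2 \<phi>), with
\<phi> a primitive of \<alpha>, is at most half of exp (2 \<phi>), this exponential is the right weight for a
linear system whose coefficients are merely integrable.\<close>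

lemma integral_times_exp_primitive:
  fixes \<alpha> :: "real \<Rightarrow> real"
  assumes int: "integrable (lebesgue_on {a..b}) \<alpha>" and nn: "\<And>x. x \<in> {a..b} \<Longrightarrow> 0 \<le> \<alpha> x"
    and t: "t \<in> {a..b}"
  shows "((\<lambda>s. \<alpha> s * exp (2 * integral {a..s} \<alpha>)) has_integral (exp (2 * integral {a..t} \<alpha>) - 1) / 2) {a..t}"
proof -
  define \<phi> where "\<phi> s = integral {a..s} \<alpha>" for s
  define G where "G s = complex_of_real (\<phi> s)" for s
  define F where "F s = complex_of_real (exp (2 * \<phi> s))" for s
  have ii: "\<alpha> integrable_on {a..b}" using integrable_on_lebesgue_on[OF int] by simp
  have cint: "integrable (lebesgue_on {a..b}) (\<lambda>s. complex_of_real (\<alpha> s))" using int by simp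
  have G: "G s = 0 + integral {a..s} (\<lambda>s. complex_of_real (\<alpha> s))" if s: "s \<in> {a..b}" for s
  proof -
    have "\<alpha> integrable_on {a..s}" by (rule integrable_on_subinterval[OF ii]) (use s in auto)
    then have "((\<lambda>s. complex_of_real (\<alpha> s)) has_integral complex_of_real (integral {a..s} \<alpha>)) {a..s}"
      by (intro has_integral_of_real integrable_integral)
    then show ?thesis by (simp add: G_def \<phi>_def integral_unique)
  qed
  have acG: "abs_cont_on a b G"
    using abs_cont_on_indefinite_integral[OF cint, of 0] G by (subst abs_cont_on_cong) auto
  have \<phi>_le: "\<phi> s \<le> \<phi> b" if s: "s \<in> {a..b}" for s
    unfolding \<phi>_def using s nn
    by (intro integral_subset_le integrable_on_subinterval[OF ii]) auto
  have acF: "abs_cont_on a b F"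
  proof (rule abs_cont_on_comparison[OF acG acG])
    fix x y assume xy: "x \<in> {a..b}" "y \<in> {a..b}"
    have "cmod (F x - F y) = \<bar>exp (2 * \<phi> x) - exp (2 * \<phi> y)\<bar>"
      unfolding F_def of_real_diff[symmetric] norm_of_real ..
    also have "\<dots> \<le> exp (2 * \<phi> b) * \<bar>2 * \<phi> x - 2 * \<phi> y\<bar>"
      using \<phi>_le[OF xy(1)] \<phi>_le[OF xy(2)] by (intro abs_exp_diff_le) auto
    also have "\<bar>2 * \<phi> x - 2 * \<phi> y\<bar> = cmod (G x - G y) + cmod (G x - G y)"
      unfolding G_def of_real_diff[symmetric] norm_of_real by linarith
    finally show "cmod (F x - F y) \<le> exp (2 * \<phi> b) * (cmod (G x - G y) + cmod (G x - G y))" .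
  qed
  have sub: "{a..t} \<subseteq> {a..b}" using t by auto
  have ab_sets: "{a..b} \<in> sets lebesgue" by simp
  have derF: "AE s in lebesgue_on {a..b}. (F has_vector_derivative complex_of_real (2 * (\<alpha> s * exp (2 * \<phi> s)))) (at s within {a..b})"
    using indefinite_integral_has_vector_derivative_AE[OF integrable_on_lebesgue_on[OF cint ab_sets], of 0] AE_space
  proof eventually_elim
    case (elim s)
    then have s: "s \<in> {a..b}" by simp
    have dG: "(G has_vector_derivative complex_of_real (\<alpha> s)) (at s within {a..b})"
      by (rule has_vector_derivative_transform[OF s G elim(1)])
    have "((\<lambda>z. exp (2 * z)) has_field_derivative 2 * exp (2 * G s)) (at (G s) within G ` {a..b})"
      by (auto intro!: derivative_eq_intros)
    from field_vector_diff_chain_within[OF dG this]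
    have "((\<lambda>s. exp (2 * G s)) has_vector_derivative complex_of_real (\<alpha> s) * (2 * exp (2 * G s))) (at s within {a..b})"
      by (simp add: o_def)
    moreover have "(\<lambda>s. exp (2 * G s)) = F" by (rule ext) (simp add: F_def G_def exp_of_real[symmetric])
    moreover have "exp (2 * G s) = complex_of_real (exp (2 * \<phi> s))" by (simp add: G_def exp_of_real[symmetric])
    ultimately show ?case by (simp add: mult.assoc mult.left_commute)
  qed
  have "AE s in lebesgue_on {a..t}. (F has_vector_derivative complex_of_real (2 * (\<alpha> s * exp (2 * \<phi> s)))) (at s within {a..t})"
  proof (rule negligible_AE_lebesgue_on[OF AE_lebesgue_on_negligible[OF derF]])
    fix s assume "s \<in> {a..t}" "s \<notin> {s \<in> {a..b}. \<not> (F has_vector_derivative complex_of_real (2 * (\<alpha> s * exp (2 * \<phi> s)))) (at s within {a..b})}"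
    then show "(F has_vector_derivative complex_of_real (2 * (\<alpha> s * exp (2 * \<phi> s)))) (at s within {a..t})"
      using has_vector_derivative_within_subset[OF _ sub] sub by blast
  qed
  from abs_cont_on_fundamental_theorem[OF _ abs_cont_on_subinterval[OF acF sub] this]
  have "((\<lambda>s. complex_of_real (2 * (\<alpha> s * exp (2 * \<phi> s)))) has_integral F t - F a) {a..t}" using t by simp
  from has_integral_linear[OF this bounded_linear_Re]
  have "((\<lambda>s. 2 * (\<alpha> s * exp (2 * \<phi> s))) has_integral exp (2 * \<phi> t) - 1) {a..t}"
    by (simp add: o_def F_def \<phi>_def)
  from has_integral_mult_right[OF this, of "1/2"]
  show ?thesis by (simp add: \<phi>_def)
qed

section \<open>The spaces L_p of an interval\<close>

locale sobolev_interval =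
  fixes p :: ennreal and a b :: real
  assumes ab: "a < b" and p1: "1 \<le> p"
begin

abbreviation "M \<equiv> lebesgue_on {a..b}"
abbreviation "LP \<equiv> Lp p a b"
abbreviation "pexp \<equiv> enn2real p"
abbreviation "pnorm \<equiv> Lp_norm p a b"
abbreviation "Wp \<equiv> sobolev p a b"
abbreviation "wnorm \<equiv> sobolev_norm p a b"

lemma emeasure_M: "emeasure M (space M) = ennreal (b - a)"
  using ab by (simp add: emeasure_restrict_space)

lemma finite_measure_M: "finite_measure M"
  by (rule finite_measureI) (simp only: emeasure_M, simp)

lemma measure_M: "measure M (space M) = b - a"
  unfolding measure_def emeasure_M using ab by simp

lemma measure_M_interval: "measure M {a..b} = b - a"
  using measure_M by simp

lemma pexp_ge_1: "p \<noteq> \<infinity> \<Longrightarrow> 1 \<le> pexp"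
  using p1 enn2real_mono[of 1 p] by (simp add: top.not_eq_extremum)

lemma Lp_measurable: "f \<in> LP \<Longrightarrow> f \<in> borel_measurable M"
  by (simp add: Lp_def)

lemma esssup_nonneg:
  assumes "f \<in> borel_measurable M"
  shows "0 \<le> esssup M (\<lambda>t. ereal (cmod (f t)))"
proof -
  have "esssup M (\<lambda>t. 0 :: ereal) \<le> esssup M (\<lambda>t. ereal (cmod (f t)))"
    by (rule esssup_mono) auto
  moreover have "esssup M (\<lambda>t. 0 :: ereal) = 0"
    by (rule esssup_const) (use ab emeasure_M in auto)
  ultimately show ?thesis by simp
qed

lemma Lp_norm_nonneg: "f \<in> LP \<Longrightarrow> 0 \<le> pnorm f"
  unfolding Lp_norm_def using esssup_nonneg[OF Lp_measurable, of f]
  by (auto simp: real_of_ereal_pos)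

lemma Lp_infty_AE_bound:
  assumes "p = \<infinity>" "f \<in> LP"
  shows "AE t in M. cmod (f t) \<le> pnorm f"
proof -
  let ?s = "esssup M (\<lambda>t. ereal (cmod (f t)))"
  have "?s < \<infinity>" "0 \<le> ?s" using assms esssup_nonneg[OF Lp_measurable[OF assms(2)]] by (auto simp: Lp_def)
  then have s: "?s = ereal (pnorm f)" using assms(1) by (cases ?s) (auto simp: Lp_norm_def)
  have "AE t in M. ereal (cmod (f t)) \<le> ?s" by (rule esssup_AE)
  then show ?thesis unfolding s by simp
qed

lemma Lp_infty_I:
  assumes p: "p = \<infinity>" and f: "f \<in> borel_measurable M" and le: "AE t in M. cmod (f t) \<le> K" and K: "0 \<le> K"
  shows "f \<in> LP \<and> pnorm f \<le> K"
proof -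
  let ?s = "esssup M (\<lambda>t. ereal (cmod (f t)))"
  have s: "?s \<le> ereal K" by (rule esssup_I) (use f le in auto)
  have nn: "0 \<le> ?s" by (rule esssup_nonneg[OF f])
  have "?s < \<infinity>" using s by (rule le_less_trans) simp
  moreover have "real_of_ereal ?s \<le> K"
    using s nn by (cases ?s) auto
  ultimately show ?thesis using p f by (simp add: Lp_def Lp_norm_def)
qed

lemma Lp_norm_powr:
  assumes "p \<noteq> \<infinity>" "f \<in> LP"
  shows "(LINT t|M. cmod (f t) powr pexp) = pnorm f powr pexp"
proof -
  have "pexp > 0" using pexp_ge_1[OF assms(1)] by simp
  moreover have "0 \<le> (LINT t|M. cmod (f t) powr pexp)" by (rule integral_nonneg_AE) simp
  ultimately show ?thesis using assms(1) by (simp add: Lp_norm_def powr_powr)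
qed

lemma Lp_finite_I:
  assumes p: "p \<noteq> \<infinity>" and f: "f \<in> borel_measurable M"
    and h: "integrable M h" and le: "AE t in M. cmod (f t) powr pexp \<le> h t"
  shows "f \<in> LP \<and> pnorm f \<le> (LINT t|M. h t) powr (1 / pexp)"
proof -
  have i: "integrable M (\<lambda>t. cmod (f t) powr pexp)"
    by (rule Bochner_Integration.integrable_bound[OF h]) (use f le in \<open>auto elim!: eventually_mono\<close>)
  have "(LINT t|M. cmod (f t) powr pexp) \<le> (LINT t|M. h t)" by (rule integral_mono_AE[OF i h le])
  moreover have "0 \<le> (LINT t|M. cmod (f t) powr pexp)" by (rule integral_nonneg_AE) simp
  ultimately show ?thesis using p i f pexp_ge_1[OF p]
    by (auto simp: Lp_def Lp_norm_def intro!: powr_mono2)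
qed

text \<open>Scalar multiples, products with bounded functions and modifications on null sets are instances of
this rule.\<close>

lemma Lp_dominated:
  assumes f: "f \<in> LP" and g: "g \<in> borel_measurable M" and K: "0 \<le> K"
    and le: "AE t in M. cmod (g t) \<le> K * cmod (f t)"
  shows "g \<in> LP \<and> pnorm g \<le> K * pnorm f"
proof (cases "p = \<infinity>")
  case True
  have "AE t in M. cmod (g t) \<le> K * pnorm f"
    using le Lp_infty_AE_bound[OF True f]
    by eventually_elim (meson K mult_left_mono order_trans)
  then show ?thesis using Lp_infty_I[OF True g] K Lp_norm_nonneg[OF f] by simp
next
  case False
  have pexp: "pexp \<ge> 1" by (rule pexp_ge_1[OF False])
  have i: "integrable M (\<lambda>t. K powr pexp * cmod (f t) powr pexp)"
    using f False by (intro integrable_mult_right) (simp add: Lp_def)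
  have "AE t in M. cmod (g t) powr pexp \<le> K powr pexp * cmod (f t) powr pexp"
    using le by eventually_elim (use pexp in \<open>simp add: powr_mult[symmetric] powr_mono2\<close>)
  from Lp_finite_I[OF False g i this]
  have "g \<in> LP" "pnorm g \<le> (K powr pexp * (LINT t|M. cmod (f t) powr pexp)) powr (1 / pexp)" by auto
  moreover have "(K powr pexp * (LINT t|M. cmod (f t) powr pexp)) powr (1 / pexp) = K * pnorm f"
    using pexp K Lp_norm_nonneg[OF f] by (simp add: Lp_norm_powr[OF False f] powr_mult powr_powr)
  ultimately show ?thesis by simp
qed

lemma add_powr_le:
  fixes x y s :: real
  assumes "0 \<le> x" "0 \<le> y" "0 < s"
  shows "(x + y) powr s \<le> 2 powr s * (x powr s + y powr s)"
proof -
  have "(x + y) powr s \<le> (2 * max x y) powr s" using assms by (intro powr_mono2) auto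
  also have "\<dots> = 2 powr s * max x y powr s" by (simp add: powr_mult)
  also have "max x y powr s \<le> x powr s + y powr s" by (auto simp: max_def)
  finally show ?thesis by simp
qed

text \<open>For finite p the bound (x + y)^s \<le> 2^s (x^s + y^s) is applied with s = p under the integral and
with s = 1/p outside it, which gives the factor 2 * 2^(1/p) \<le> 4.\<close>

lemma Lp_add:
  assumes f: "f \<in> LP" and g: "g \<in> LP"
  shows "(\<lambda>t. f t + g t) \<in> LP \<and>
    pnorm (\<lambda>t. f t + g t) \<le> 4 * (pnorm f + pnorm g)"
proof -
  have m: "(\<lambda>t. f t + g t) \<in> borel_measurable M"
    using Lp_measurable[OF f] Lp_measurable[OF g] by simp
  note nn = Lp_norm_nonneg[OF f] Lp_norm_nonneg[OF g]
  show ?thesis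
  proof (cases "p = \<infinity>")
    case True
    have "AE t in M. cmod (f t + g t) \<le> pnorm f + pnorm g"
      using Lp_infty_AE_bound[OF True f] Lp_infty_AE_bound[OF True g]
      by eventually_elim (meson add_mono norm_triangle_ineq order_trans)
    from Lp_infty_I[OF True m this] nn show ?thesis by simp
  next
    case False
    have pexp: "pexp \<ge> 1" by (rule pexp_ge_1[OF False])
    let ?h = "\<lambda>t. 2 powr pexp * (cmod (f t) powr pexp + cmod (g t) powr pexp)"
    have i: "integrable M (\<lambda>t. cmod (f t) powr pexp)" "integrable M (\<lambda>t. cmod (g t) powr pexp)"
      using f g False by (auto simp: Lp_def)
    have ih: "integrable M ?h" using i by simp
    have "AE t in M. cmod (f t + g t) powr pexp \<le> ?h t"
    proof (intro AE_I2)
      fix t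
      have "cmod (f t + g t) powr pexp \<le> (cmod (f t) + cmod (g t)) powr pexp"
        using pexp by (intro powr_mono2 norm_triangle_ineq) auto
      also have "\<dots> \<le> ?h t" using pexp by (intro add_powr_le) auto
      finally show "cmod (f t + g t) powr pexp \<le> ?h t" .
    qed
    from Lp_finite_I[OF False m ih this]
    have 1: "(\<lambda>t. f t + g t) \<in> LP" and
      2: "pnorm (\<lambda>t. f t + g t) \<le> (LINT t|M. ?h t) powr (1 / pexp)" by auto
    have "(LINT t|M. ?h t) = 2 powr pexp * (pnorm f powr pexp + pnorm g powr pexp)"
      using i by (simp add: Lp_norm_powr[OF False f] Lp_norm_powr[OF False g])
    also have "\<dots> powr (1 / pexp) = 2 * (pnorm f powr pexp + pnorm g powr pexp) powr (1 / pexp)"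
      using pexp by (simp add: powr_mult powr_powr)
    also have "\<dots> \<le> 2 * (2 powr (1 / pexp) * ((pnorm f powr pexp) powr (1 / pexp) + (pnorm g powr pexp) powr (1 / pexp)))"
      using pexp by (intro mult_left_mono add_powr_le) auto
    also have "\<dots> = 2 * (2 powr (1 / pexp) * (pnorm f + pnorm g))"
      using pexp nn by (simp add: powr_powr)
    also have "\<dots> \<le> 2 * (2 * (pnorm f + pnorm g))"
    proof -
      have "(2::real) powr (1 / pexp) \<le> 2 powr 1" using pexp by (intro powr_mono) auto
      then show ?thesis using nn by (intro mult_left_mono mult_right_mono) auto
    qed
    finally show ?thesis using 1 2 by simp
  qed
qed

lemma one_in_Lp: "(\<lambda>_. 1) \<in> LP"
proof (cases "p = \<infinity>")
  case True
  show ?thesis using Lp_infty_I[OF True, of "\<lambda>_. 1" 1] by simp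
next
  case False
  interpret finite_measure M by (rule finite_measure_M)
  show ?thesis using Lp_finite_I[OF False, of "\<lambda>_. 1" "\<lambda>_. 1"] by simp
qed

lemma bounded_in_Lp:
  assumes "g \<in> borel_measurable M" "0 \<le> K" "\<And>t. t \<in> {a..b} \<Longrightarrow> cmod (g t) \<le> K"
  shows "g \<in> LP \<and> pnorm g \<le> K * pnorm (\<lambda>_. 1)"
  by (rule Lp_dominated[OF one_in_Lp assms(1,2)]) (use assms(3) in auto)

text \<open>For finite p the integral of x \<le> s + s^(1-p) x^p, with any s larger than the L_p norm, bounds the
L_1 norm by (b - a + 1) s, and s may tend to the L_p norm. This takes the place of Hoelder's
inequality.\<close>

lemma Lp_imp_L1:
  assumes f: "f \<in> LP"
  shows "integrable M f \<and> (LINT t|M. cmod (f t)) \<le> (b - a + 1) * pnorm f"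
proof -
  interpret finite_measure M by (rule finite_measure_M)
  note m = Lp_measurable[OF f] and nn = Lp_norm_nonneg[OF f]
  show ?thesis
  proof (cases "p = \<infinity>")
    case True
    have le: "AE t in M. cmod (f t) \<le> pnorm f" by (rule Lp_infty_AE_bound[OF True f])
    have i: "integrable M f" by (rule integrable_const_bound[OF le m])
    have "(LINT t|M. cmod (f t)) \<le> (LINT t|M. pnorm f)"
      by (rule integral_mono_AE) (use i le in auto)
    also have "\<dots> = (b - a) * pnorm f" by (simp add: measure_M_interval)
    also have "\<dots> \<le> (b - a + 1) * pnorm f" using nn by (intro mult_right_mono) auto
    finally show ?thesis using i by simp
  next
    case False
    have pexp: "pexp \<ge> 1" by (rule pexp_ge_1[OF False])
    have ip: "integrable M (\<lambda>t. cmod (f t) powr pexp)" using f False by (simp add: Lp_def)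
    have pt: "x \<le> s + s powr (1 - pexp) * x powr pexp" if s: "s > 0" and x: "x \<ge> 0" for s x :: real
    proof (cases "x \<le> s")
      case True
      then show ?thesis by (simp add: add_increasing2)
    next
      case False
      then have xs: "x > s" "x > 0" using s by auto
      have "s powr (1 - pexp) \<ge> x powr (1 - pexp)" using xs s pexp by (intro powr_mono2') auto
      then have "s powr (1 - pexp) * x powr pexp \<ge> x powr (1 - pexp) * x powr pexp" by (intro mult_right_mono) auto
      moreover have "x powr (1 - pexp) * x powr pexp = x" using xs by (simp add: powr_add[symmetric])
      ultimately show ?thesis using s by linarith
    qed
    have i: "integrable M f"
      by (rule Bochner_Integration.integrable_bound[of M "\<lambda>t. 1 + 1 powr (1 - pexp) * cmod (f t) powr pexp"])
        (use ip m pt[of 1] in auto)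
    (* s > pnorm f and not s = pnorm f, as the latter may be 0 *)
    have b1: "(LINT t|M. cmod (f t)) / (b - a + 1) \<le> s" if s: "pnorm f < s" for s
    proof -
      have s0: "s > 0" using s nn by simp
      have "(LINT t|M. cmod (f t)) \<le> (LINT t|M. s + s powr (1 - pexp) * cmod (f t) powr pexp)"
        by (rule integral_mono_AE) (use i ip pt s0 in auto)
      also have "\<dots> = s * (b - a) + s powr (1 - pexp) * pnorm f powr pexp"
        using ip by (simp add: measure_M_interval Lp_norm_powr[OF False f])
      also have "\<dots> \<le> s * (b - a) + s powr (1 - pexp) * s powr pexp"
        using s nn pexp by (intro add_left_mono mult_left_mono powr_mono2) auto
      also have "s powr (1 - pexp) * s powr pexp = s" using s0 by (simp add: powr_add[symmetric])
      finally show ?thesis using ab by (simp add: field_simps)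
    qed
    have "(LINT t|M. cmod (f t)) / (b - a + 1) \<le> pnorm f"
      by (rule dense_ge) (rule b1)
    then show ?thesis using i ab by (simp add: field_simps)
  qed
qed

section \<open>Sobolev spaces of an interval\<close>

abbreviation "D \<equiv> deriv_on a b"

lemma continuous_on_interval_bounded:
  fixes f :: "real \<Rightarrow> complex"
  assumes "continuous_on {a..b} f"
  shows "\<exists>B\<ge>0. \<forall>t\<in>{a..b}. cmod (f t) \<le> B"
proof -
  have "bounded (f ` {a..b})" using assms by (intro compact_imp_bounded compact_continuous_image) auto
  then obtain B where "B > 0" "\<forall>x\<in>f ` {a..b}. cmod x \<le> B" unfolding bounded_pos by blast
  then show ?thesis by (intro exI[of _ B]) auto
qed

lemma deriv_on_eq:
  assumes "t \<in> {a..b}" "(f has_vector_derivative f') (at t within {a..b})"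
  shows "D f t = f'"
  unfolding deriv_on_def by (rule vector_derivative_within_closed_interval[OF ab assms])

lemma deriv_on_works:
  "(f differentiable (at t within {a..b})) \<longleftrightarrow> (f has_vector_derivative D f t) (at t within {a..b})"
  by (simp add: deriv_on_def vector_derivative_works)

lemma has_vector_derivative_cong_on:
  assumes "\<And>s. s \<in> {a..b} \<Longrightarrow> f s = g s" "t \<in> {a..b}"
  shows "(f has_vector_derivative d) (at t within {a..b}) \<longleftrightarrow> (g has_vector_derivative d) (at t within {a..b})"
  using has_vector_derivative_transform[OF assms(2), of f g d] has_vector_derivative_transform[OF assms(2), of g f d]
    assms(1) by auto

lemma deriv_on_cong:
  assumes "\<And>s. s \<in> {a..b} \<Longrightarrow> f s = g s" "t \<in> {a..b}"
  shows "D f t = D g t"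
  unfolding deriv_on_def vector_derivative_def using has_vector_derivative_cong_on[OF assms] by simp

abbreviation "has_deriv f d t \<equiv> (f has_vector_derivative d) (at t within {a..b})"

text \<open>The sense in which f in W_p^(k+1) has the derivative g in W_p^k: almost everywhere for k = 0, at
every point for k > 0. In both cases f is absolutely continuous, so that g determines f up to a
constant.\<close>

definition sob_deriv :: "nat \<Rightarrow> (real \<Rightarrow> complex) \<Rightarrow> (real \<Rightarrow> complex) \<Rightarrow> bool" where
  "sob_deriv k f g \<longleftrightarrow> abs_cont_on a b f \<and>
     (if k = 0 then AE t in M. has_deriv f (g t) t
      else \<forall>t\<in>{a..b}. has_deriv f (g t) t)"

lemma sob_deriv_AE:
  assumes "sob_deriv k f g"
  shows "AE t in M. has_deriv f (g t) t"
  using assms unfolding sob_deriv_def by (cases "k = 0") (auto intro!: AE_I2)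

lemma sob_deriv_AE_eq:
  assumes "sob_deriv k f g"
  shows "AE t in M. D f t = g t"
  using sob_deriv_AE[OF assms] AE_space
  by eventually_elim (simp add: deriv_on_eq)

lemma sob_deriv_eq:
  assumes "sob_deriv k f g" "k > 0" "t \<in> {a..b}"
  shows "D f t = g t"
  using assms deriv_on_eq by (simp add: sob_deriv_def)

lemma sobolev_0: "f \<in> Wp 0 \<longleftrightarrow> f \<in> LP"
  by (simp add: sobolev_def)

lemma sobolev_norm_0: "wnorm 0 f = pnorm f"
  by (simp add: sobolev_norm_def)

lemma abs_cont_on_of_bounded_derivative:
  assumes der: "\<And>t. t \<in> {a..b} \<Longrightarrow> has_deriv f (g t) t"
    and B: "\<And>t. t \<in> {a..b} \<Longrightarrow> cmod (g t) \<le> B"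
  shows "abs_cont_on a b f"
proof -
  have id: "abs_cont_on a b complex_of_real"
    unfolding abs_cont_on_def
  proof (intro allI impI)
    fix e :: real assume e: "0 < e"
    show "\<exists>\<delta>>0. \<forall>d S. d division_of S \<and> S \<subseteq> {a..b} \<and> (\<Sum>K\<in>d. Sup K - Inf K) < \<delta> \<longrightarrow>
          (\<Sum>K\<in>d. cmod (complex_of_real (Sup K) - complex_of_real (Inf K))) < e"
    proof (intro exI[of _ e] conjI allI impI)
      fix d S assume d: "d division_of S \<and> S \<subseteq> {a..b} \<and> (\<Sum>K\<in>d. Sup K - Inf K) < e"
      have "(\<Sum>K\<in>d. cmod (complex_of_real (Sup K) - complex_of_real (Inf K))) = (\<Sum>K\<in>d. Sup K - Inf K)"
      proof (rule sum.cong[OF refl])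
        fix K assume "K \<in> d"
        then have "Inf K \<le> Sup K" using division_intervalD(1) d by blast
        then show "cmod (complex_of_real (Sup K) - complex_of_real (Inf K)) = Sup K - Inf K"
          unfolding of_real_diff[symmetric] norm_of_real by simp
      qed
      then show "(\<Sum>K\<in>d. cmod (complex_of_real (Sup K) - complex_of_real (Inf K))) < e" using d by simp
    qed (use e in simp)
  qed
  show ?thesis
  proof (rule abs_cont_on_comparison[OF id id, where C = B])
    fix x y assume xy: "x \<in> {a..b}" "y \<in> {a..b}"
    have B0: "0 \<le> B" using B[OF xy(1)] norm_ge_zero order_trans by blast
    have "cmod (f x - f y) \<le> B * norm (x - y)"
    proof (rule differentiable_bound[of "{a..b}" f "\<lambda>t s. s *\<^sub>R g t" B x y])
      fix t assume t: "t \<in> {a..b}"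
      show "(f has_derivative (\<lambda>s. s *\<^sub>R g t)) (at t within {a..b})"
        using der[OF t] by (simp add: has_vector_derivative_def)
      show "onorm (\<lambda>s. s *\<^sub>R g t) \<le> B"
      proof (rule onorm_le)
        fix s :: real
        have "\<bar>s\<bar> * cmod (g t) \<le> \<bar>s\<bar> * B" using B[OF t] by (intro mult_left_mono) auto
        then show "norm (s *\<^sub>R g t) \<le> B * norm s" by (simp add: mult.commute)
      qed
    qed (use xy in auto)
    also have "\<dots> \<le> B * (cmod (complex_of_real x - complex_of_real y) + cmod (complex_of_real x - complex_of_real y))"
      unfolding of_real_diff[symmetric] norm_of_real using B0 by (intro mult_left_mono) auto
    finally show "cmod (f x - f y) \<le> \<dots>" .
  qed
qed

text \<open>The recursive form of the definition, on which all inductions over the order rest. For k > 0 the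
derivative is continuous, hence bounded, and so f is Lipschitz continuous; this is the source of
the absolute continuity of f itself.\<close>

lemma sobolev_Suc:
  "f \<in> Wp (Suc k) \<longleftrightarrow> sob_deriv k f (D f) \<and> D f \<in> Wp k"
proof (cases k)
  case 0
  then show ?thesis
    by (auto simp: sobolev_def sob_deriv_def deriv_on_works abs_cont_on_imp_continuous_on)
next
  case (Suc l)
  have shift: "(D ^^ Suc j) f = (D ^^ j) (D f)" for j by (simp only: funpow_Suc_right o_def)
  have AEiff: "(AE t in M. (D ^^ l) (D f) differentiable (at t within {a..b})) \<longleftrightarrow>
      (AE t in M. (D ^^ (Suc l - 1)) (D f) differentiable (at t within {a..b}))" by simp
  show ?thesis
  proof
    assume f: "f \<in> Wp (Suc k)"
    have c: "continuous_on {a..b} ((D ^^ j) f)" if "j < Suc k" for j using f that by (simp add: sobolev_def)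
    have d: "(D ^^ j) f differentiable (at t within {a..b})" if "Suc j < Suc k" "t \<in> {a..b}" for j t
      using f that unfolding sobolev_def by blast
    have r: "abs_cont_on a b ((D ^^ k) f)" "AE t in M. (D ^^ k) f differentiable (at t within {a..b})"
       "(D ^^ Suc k) f \<in> LP"
      using f unfolding sobolev_def by (auto simp del: funpow.simps)
    have Df: "D f \<in> Wp k"
      using c[of "Suc _", unfolded shift] d[of "Suc _", unfolded shift] r[unfolded shift Suc] Suc
      unfolding sobolev_def by (auto simp del: funpow.simps)
    have der: "has_deriv f (D f t) t" if "t \<in> {a..b}" for t
      using d[of 0 t] that Suc by (simp add: deriv_on_works)
    have "continuous_on {a..b} (D f)" using c[of 1] Suc by simp
    from continuous_on_interval_bounded[OF this]
    obtain B where B: "\<forall>t\<in>{a..b}. cmod (D f t) \<le> B" by blast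
    from abs_cont_on_of_bounded_derivative[OF der B[rule_format]] have "abs_cont_on a b f" .
    then show "sob_deriv k f (D f) \<and> D f \<in> Wp k"
      using der Df Suc by (simp add: sob_deriv_def)
  next
    assume R: "sob_deriv k f (D f) \<and> D f \<in> Wp k"
    have der: "has_deriv f (D f t) t" if "t \<in> {a..b}" for t
      using R that Suc by (simp add: sob_deriv_def)
    have ac: "abs_cont_on a b f" using R by (simp add: sob_deriv_def)
    have "continuous_on {a..b} ((D ^^ j) f)" if "j < Suc k" for j
    proof (cases j)
      case 0
      then show ?thesis using abs_cont_on_imp_continuous_on[OF ac] by simp
    next
      case (Suc i)
      then show ?thesis using R that unfolding sobolev_def by (simp add: shift del: funpow.simps)
    qed
    moreover have "(D ^^ j) f differentiable (at t within {a..b})" if "Suc j < Suc k" "t \<in> {a..b}" for j t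
    proof (cases j)
      case 0
      then show ?thesis using der[OF that(2)] by (simp add: deriv_on_works)
    next
      case (Suc i)
      then show ?thesis using R that unfolding sobolev_def by (simp add: shift del: funpow.simps)
    qed
    moreover have "abs_cont_on a b ((D ^^ k) f)" "AE t in M. (D ^^ k) f differentiable (at t within {a..b})"
       "(D ^^ Suc k) f \<in> LP"
      using R Suc unfolding sobolev_def by (simp_all add: shift del: funpow.simps)
    ultimately show "f \<in> Wp (Suc k)"
      unfolding sobolev_def by (simp del: funpow.simps)
  qed
qed

lemma sobolev_norm_Suc: "wnorm (Suc k) f = pnorm f + wnorm k (D f)"
  unfolding sobolev_norm_def
  by (simp only: sum.atMost_Suc_shift funpow_Suc_right o_def) simp

lemma Lp_cong_AE:
  assumes "f \<in> LP" "g \<in> borel_measurable M" "AE t in M. f t = g t"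
  shows "g \<in> LP \<and> pnorm g = pnorm f"
proof -
  have 1: "g \<in> LP \<and> pnorm g \<le> 1 * pnorm f"
    by (rule Lp_dominated[OF assms(1,2)]) (use assms(3) in \<open>auto elim!: eventually_mono\<close>)
  have "f \<in> LP \<and> pnorm f \<le> 1 * pnorm g"
    by (rule Lp_dominated[OF conjunct1[OF 1] Lp_measurable[OF assms(1)]])
      (use assms(3) in \<open>auto elim!: eventually_mono\<close>)
  then show ?thesis using 1 by simp
qed

lemma measurable_cong_AE:
  fixes f :: "real \<Rightarrow> complex"
  assumes f: "f \<in> borel_measurable M" and eq: "AE t in M. f t = g t"
  shows "g \<in> borel_measurable M"
proof -
  have "(\<lambda>x. if x \<in> {a..b} then f x else 0) \<in> borel_measurable lebesgue"
    using f by (intro borel_measurable_if_I) auto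
  moreover have "AE x in lebesgue. (if x \<in> {a..b} then f x else 0) = (if x \<in> {a..b} then g x else 0)"
    using eq by (subst (asm) AE_restrict_space_iff) (auto elim!: eventually_mono)
  ultimately show ?thesis
    by (intro borel_measurable_if_D) (rule borel_measurable_AE)
qed

lemma sob_deriv_cong:
  assumes fg: "\<And>t. t \<in> {a..b} \<Longrightarrow> f t = f' t" and gg: "\<And>t. t \<in> {a..b} \<Longrightarrow> g t = g' t"
    and d: "sob_deriv k f g"
  shows "sob_deriv k f' g'"
proof -
  have ac: "abs_cont_on a b f'" using d abs_cont_on_cong[OF fg] by (simp add: sob_deriv_def)
  have tr: "has_deriv f' (g' t) t"
    if "has_deriv f (g t) t" "t \<in> {a..b}" for t
    using that(1) has_vector_derivative_cong_on[of f f' t, OF fg that(2)] gg[OF that(2)] by simp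
  show ?thesis
  proof (cases "k = 0")
    case True
    have "AE t in M. has_deriv f' (g' t) t"
      using sob_deriv_AE[OF d] AE_space
      by eventually_elim (simp add: tr)
    then show ?thesis using ac True by (simp add: sob_deriv_def)
  next
    case False
    then show ?thesis using d ac tr by (simp add: sob_deriv_def)
  qed
qed

lemma continuous_in_Lp:
  assumes c: "continuous_on {a..b} f"
  shows "f \<in> LP"
proof -
  have m: "f \<in> borel_measurable M" by (rule continuous_imp_measurable_on_sets_lebesgue[OF c]) simp
  obtain B where B: "0 \<le> B" "\<forall>t\<in>{a..b}. cmod (f t) \<le> B"
    using continuous_on_interval_bounded[OF c] by blast
  show ?thesis using bounded_in_Lp[OF m B(1)] B(2) by simp
qed

lemma sobolev_cong:
  assumes "\<And>t. t \<in> {a..b} \<Longrightarrow> f t = g t" "f \<in> Wp k"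
  shows "g \<in> Wp k \<and> wnorm k g = wnorm k f"
  using assms
proof (induction k arbitrary: f g)
  case 0
  have fL: "f \<in> LP" using 0 by (simp add: sobolev_0)
  have ae: "AE t in M. f t = g t" by (rule AE_I2) (use 0 in simp)
  have "g \<in> borel_measurable M" by (rule measurable_cong_AE[OF Lp_measurable[OF fL] ae])
  from Lp_cong_AE[OF fL this ae] show ?case by (simp add: sobolev_0 sobolev_norm_0)
next
  case (Suc k)
  have DD: "D f t = D g t" if "t \<in> {a..b}" for t by (rule deriv_on_cong[OF Suc.prems(1) that])
  have f: "sob_deriv k f (D f)" "D f \<in> Wp k" using Suc.prems(2) by (auto simp: sobolev_Suc)
  have fL: "f \<in> LP"
    using f(1) by (intro continuous_in_Lp abs_cont_on_imp_continuous_on) (simp add: sob_deriv_def)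
  have ae: "AE t in M. f t = g t" by (rule AE_I2) (use Suc.prems(1) in simp)
  have "g \<in> borel_measurable M" by (rule measurable_cong_AE[OF Lp_measurable[OF fL] ae])
  then have "pnorm g = pnorm f" using Lp_cong_AE[OF fL _ ae] by simp
  then show ?case
    using sob_deriv_cong[OF Suc.prems(1) DD f(1)] Suc.IH[OF DD f(2)] by (auto simp: sobolev_Suc sobolev_norm_Suc)
qed

lemma sobolev_Suc_abs_cont: "f \<in> Wp (Suc k) \<Longrightarrow> abs_cont_on a b f"
  by (simp add: sobolev_Suc sob_deriv_def)

lemma sobolev_Suc_continuous: "f \<in> Wp (Suc k) \<Longrightarrow> continuous_on {a..b} f"
  by (intro abs_cont_on_imp_continuous_on sobolev_Suc_abs_cont)

lemma sobolev_SucI: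
  assumes d: "sob_deriv k f g" and g: "g \<in> Wp k"
  shows "f \<in> Wp (Suc k) \<and> wnorm (Suc k) f = pnorm f + wnorm k g"
proof (cases "k = 0")
  case True
  have ae: "AE t in M. g t = D f t" using sob_deriv_AE_eq[OF d] by (auto elim!: eventually_mono)
  have gL: "g \<in> LP" using g True by (simp add: sobolev_0)
  have Dm: "D f \<in> borel_measurable M" by (rule measurable_cong_AE[OF Lp_measurable[OF gL] ae])
  have DL: "D f \<in> LP \<and> pnorm (D f) = pnorm g" by (rule Lp_cong_AE[OF gL Dm ae])
  have "AE t in M. has_deriv f (D f t) t"
    using sob_deriv_AE[OF d] ae by eventually_elim simp
  then have "sob_deriv k f (D f)" using d True by (simp add: sob_deriv_def)
  then show ?thesis using DL True by (simp add: sobolev_Suc sobolev_norm_Suc sobolev_0 sobolev_norm_0)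
next
  case False
  have eq: "g t = D f t" if "t \<in> {a..b}" for t using sob_deriv_eq[OF d _ that] False by simp
  have "sob_deriv k f (D f)" by (rule sob_deriv_cong[OF refl eq d])
  then show ?thesis using sobolev_cong[OF eq g] by (auto simp: sobolev_Suc sobolev_norm_Suc)
qed

lemma sobolev_SucE:
  assumes "f \<in> Wp (Suc k)"
  shows "sob_deriv k f (D f)" "D f \<in> Wp k" "f \<in> LP"
    "wnorm (Suc k) f = pnorm f + wnorm k (D f)"
  using assms continuous_in_Lp[OF sobolev_Suc_continuous[OF assms]] by (auto simp: sobolev_Suc sobolev_norm_Suc)

lemma sobolev_norm_nonneg: "f \<in> Wp k \<Longrightarrow> 0 \<le> wnorm k f"
proof (induction k arbitrary: f)
  case 0
  then show ?case by (simp add: sobolev_0 sobolev_norm_0 Lp_norm_nonneg)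
next
  case (Suc k)
  then show ?case using sobolev_SucE[OF Suc.prems] Lp_norm_nonneg by auto
qed

lemma sobolev_Suc_subset:
  "f \<in> Wp (Suc k) \<Longrightarrow> f \<in> Wp k \<and> wnorm k f \<le> wnorm (Suc k) f"
proof (induction k arbitrary: f)
  case 0
  then show ?case using sobolev_SucE[OF 0] sobolev_norm_nonneg[of _ 0] by (auto simp: sobolev_0 sobolev_norm_0)
next
  case (Suc k)
  note E = sobolev_SucE[OF Suc.prems]
  have "sob_deriv k f (D f)" using E(1) sob_deriv_AE[OF E(1)] by (auto simp: sob_deriv_def)
  from sobolev_SucI[OF this] Suc.IH[OF E(2)] E(4) show ?case by auto
qed

lemma sobolev_subset:
  assumes "f \<in> Wp l" "k \<le> l"
  shows "f \<in> Wp k \<and> wnorm k f \<le> wnorm l f"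
  using assms(2,1)
proof (induction rule: dec_induct)
  case (step n)
  then show ?case using sobolev_Suc_subset[of f n] by auto
qed simp

lemma sob_deriv_add:
  assumes "sob_deriv k f f'" "sob_deriv k g g'"
  shows "sob_deriv k (\<lambda>t. f t + g t) (\<lambda>t. f' t + g' t)"
proof -
  have "abs_cont_on a b (\<lambda>t. f t + g t)"
  proof (rule abs_cont_on_comparison[of a b f g _ 1])
    fix x y
    have "f x + g x - (f y + g y) = (f x - f y) + (g x - g y)" by simp
    then show "cmod (f x + g x - (f y + g y)) \<le> 1 * (cmod (f x - f y) + cmod (g x - g y))"
      by (metis mult_1 norm_triangle_ineq)
  qed (use assms in \<open>auto simp: sob_deriv_def\<close>)
  moreover have "AE t in M. has_deriv (\<lambda>t. f t + g t) (f' t + g' t) t"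
    using sob_deriv_AE[OF assms(1)] sob_deriv_AE[OF assms(2)]
    by eventually_elim (rule has_vector_derivative_add)
  ultimately show ?thesis using assms by (auto simp: sob_deriv_def intro: has_vector_derivative_add)
qed

lemma sob_deriv_mult:
  assumes "sob_deriv k f f'" "sob_deriv k g g'"
  shows "sob_deriv k (\<lambda>t. f t * g t) (\<lambda>t. f' t * g t + f t * g' t)"
proof -
  have ac: "abs_cont_on a b f" "abs_cont_on a b g" using assms by (auto simp: sob_deriv_def)
  obtain B1 where B1: "\<forall>t\<in>{a..b}. cmod (f t) \<le> B1"
    using continuous_on_interval_bounded[OF abs_cont_on_imp_continuous_on[OF ac(1)]] by blast
  obtain B2 where B2: "\<forall>t\<in>{a..b}. cmod (g t) \<le> B2"
    using continuous_on_interval_bounded[OF abs_cont_on_imp_continuous_on[OF ac(2)]] by blast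
  have "abs_cont_on a b (\<lambda>t. f t * g t)"
  proof (rule abs_cont_on_comparison[OF ac])
    fix x y assume xy: "x \<in> {a..b}" "y \<in> {a..b}"
    have "f x * g x - f y * g y = (f x - f y) * g x + f y * (g x - g y)" by (simp add: algebra_simps)
    then have "cmod (f x * g x - f y * g y) \<le> cmod (f x - f y) * cmod (g x) + cmod (f y) * cmod (g x - g y)"
      by (metis norm_mult norm_triangle_ineq)
    also have "\<dots> \<le> cmod (f x - f y) * max B1 B2 + max B1 B2 * cmod (g x - g y)"
    proof (intro add_mono mult_left_mono mult_right_mono norm_ge_zero)
      show "cmod (g x) \<le> max B1 B2" using bspec[OF B2 xy(1)] by simp
      show "cmod (f y) \<le> max B1 B2" using bspec[OF B1 xy(2)] by simp
    qed
    also have "\<dots> = max B1 B2 * (cmod (f x - f y) + cmod (g x - g y))" by (simp add: distrib_left)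
    finally show "cmod (f x * g x - f y * g y) \<le> \<dots>" .
  qed
  moreover have der: "has_deriv (\<lambda>t. f t * g t) (f' t * g t + f t * g' t) t"
    if "has_deriv f (f' t) t" "has_deriv g (g' t) t" for t
    using has_vector_derivative_mult[OF that] by (simp add: add.commute)
  moreover have "AE t in M. has_deriv (\<lambda>t. f t * g t) (f' t * g t + f t * g' t) t"
    using sob_deriv_AE[OF assms(1)] sob_deriv_AE[OF assms(2)]
    by eventually_elim (rule der)
  ultimately show ?thesis using assms by (simp add: sob_deriv_def)
qed

lemma sob_deriv_const: "sob_deriv k (\<lambda>_. c) (\<lambda>_. 0)"
proof -
  have "abs_cont_on a b (\<lambda>_. c)" by (simp add: abs_cont_on_def gt_ex)
  then show ?thesis by (simp add: sob_deriv_def)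
qed

lemma sobolev_zero: "(\<lambda>_. 0) \<in> Wp k \<and> wnorm k (\<lambda>_. 0) = 0"
proof (induction k)
  case 0
  show ?case using bounded_in_Lp[of "\<lambda>_. 0" 0] Lp_norm_nonneg[of "\<lambda>_. 0"] by (auto simp: sobolev_0 sobolev_norm_0)
next
  case (Suc k)
  then show ?case using sobolev_SucI[OF sob_deriv_const[of k 0]] sobolev_SucE(3)[of "\<lambda>_. 0" k] 
      bounded_in_Lp[of "\<lambda>_. 0" 0] Lp_norm_nonneg[of "\<lambda>_. 0"] by auto
qed

lemma sobolev_add:
  "f \<in> Wp k \<Longrightarrow> g \<in> Wp k \<Longrightarrow>
    (\<lambda>t. f t + g t) \<in> Wp k \<and>
    wnorm k (\<lambda>t. f t + g t) \<le> 4 * (wnorm k f + wnorm k g)"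
proof (induction k arbitrary: f g)
  case 0
  then show ?case using Lp_add by (simp add: sobolev_0 sobolev_norm_0)
next
  case (Suc k)
  note F = sobolev_SucE[OF Suc.prems(1)] and G = sobolev_SucE[OF Suc.prems(2)]
  show ?case
    using sobolev_SucI[OF sob_deriv_add[OF F(1) G(1)]] Suc.IH[OF F(2) G(2)] Lp_add[OF F(3) G(3)] F(4) G(4)
    by auto
qed

lemma sob_deriv_cmult:
  assumes "sob_deriv k f f'"
  shows "sob_deriv k (\<lambda>t. c * f t) (\<lambda>t. c * f' t)"
  using sob_deriv_mult[OF sob_deriv_const assms, of c] by simp

lemma Lp_cmult:
  assumes "f \<in> LP"
  shows "(\<lambda>t. c * f t) \<in> LP \<and> pnorm (\<lambda>t. c * f t) \<le> cmod c * pnorm f"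
  by (rule Lp_dominated[OF assms]) (use Lp_measurable[OF assms] in \<open>auto simp: norm_mult\<close>)

lemma sobolev_cmult:
  "f \<in> Wp k \<Longrightarrow> (\<lambda>t. c * f t) \<in> Wp k \<and>
    wnorm k (\<lambda>t. c * f t) \<le> cmod c * wnorm k f"
proof (induction k arbitrary: f)
  case 0
  then show ?case using Lp_cmult by (simp add: sobolev_0 sobolev_norm_0)
next
  case (Suc k)
  note F = sobolev_SucE[OF Suc.prems(1)]
  show ?case
    using sobolev_SucI[OF sob_deriv_cmult[OF F(1), of c]] Suc.IH[OF F(2)] Lp_cmult[OF F(3), of c] F(4)
    by (auto simp: distrib_left)
qed

lemma sobolev_diff:
  assumes "f \<in> Wp k" "g \<in> Wp k"
  shows "(\<lambda>t. f t - g t) \<in> Wp k \<and>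
    wnorm k (\<lambda>t. f t - g t) \<le> 4 * (wnorm k f + wnorm k g)"
  using sobolev_add[OF assms(1) conjunct1[OF sobolev_cmult[OF assms(2), of "-1"]]] sobolev_cmult[OF assms(2), of "-1"]
  by simp

lemma sobolev_sum:
  assumes "finite I" "\<And>i. i \<in> I \<Longrightarrow> f i \<in> Wp k"
  shows "(\<lambda>t. \<Sum>i\<in>I. f i t) \<in> Wp k \<and>
    wnorm k (\<lambda>t. \<Sum>i\<in>I. f i t) \<le> 4 ^ card I * (\<Sum>i\<in>I. wnorm k (f i))"
  using assms
proof (induction I rule: finite_induct)
  case empty
  then show ?case using sobolev_zero by simp
next
  case (insert i I)
  let ?S = "\<lambda>t. \<Sum>i\<in>I. f i t" and ?N = "\<Sum>i\<in>I. wnorm k (f i)"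
  have S: "?S \<in> Wp k" "wnorm k ?S \<le> 4 ^ card I * ?N" using insert by auto
  have fi: "f i \<in> Wp k" using insert by auto
  have "wnorm k (\<lambda>t. f i t + ?S t) \<le> 4 * (wnorm k (f i) + wnorm k ?S)"
    using sobolev_add[OF fi S(1)] by simp
  also have "\<dots> \<le> 4 * (4 ^ card I * wnorm k (f i) + 4 ^ card I * ?N)"
  proof -
    have "1 * wnorm k (f i) \<le> 4 ^ card I * wnorm k (f i)"
      by (intro mult_right_mono sobolev_norm_nonneg fi) simp
    then show ?thesis using S(2) by simp
  qed
  finally show ?case using insert sobolev_add[OF fi S(1)] by (simp add: algebra_simps)
qed

lemma interval_sets: "{a..b} \<in> sets lebesgue"
  by simp

lemma sob_deriv_has_integral:
  assumes d: "sob_deriv k f g" and xy: "x \<in> {a..b}" "y \<in> {a..b}" "x \<le> y"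
  shows "(g has_integral (f y - f x)) {x..y}"
proof (rule abs_cont_on_fundamental_theorem[OF xy(3)])
  have sub: "{x..y} \<subseteq> {a..b}" using xy by auto
  show "abs_cont_on x y f" using abs_cont_on_subinterval[OF _ sub] d by (simp add: sob_deriv_def)
  show "AE t in lebesgue_on {x..y}. (f has_vector_derivative g t) (at t within {x..y})"
  proof (rule negligible_AE_lebesgue_on[OF AE_lebesgue_on_negligible[OF sob_deriv_AE[OF d]]])
    fix t assume "t \<in> {x..y}" "t \<notin> {t \<in> {a..b}. \<not> has_deriv f (g t) t}"
    then show "(f has_vector_derivative g t) (at t within {x..y})"
      using has_vector_derivative_within_subset[OF _ sub] sub by blast
  qed
qed

lemma sobolev_in_Lp: "f \<in> Wp k \<Longrightarrow> f \<in> LP"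
  using sobolev_subset[of f k 0] by (simp add: sobolev_0)

lemma sob_deriv_indefinite_integral:
  assumes g: "g \<in> Wp k" and f: "\<And>t. t \<in> {a..b} \<Longrightarrow> f t = c + integral {a..t} g"
  shows "sob_deriv k f g"
proof (rule sob_deriv_cong[of "\<lambda>t. c + integral {a..t} g" f g g])
  have gi: "integrable M g" using Lp_imp_L1[OF sobolev_in_Lp[OF g]] by simp
  have ac: "abs_cont_on a b (\<lambda>t. c + integral {a..t} g)" by (rule abs_cont_on_indefinite_integral[OF gi])
  show "sob_deriv k (\<lambda>t. c + integral {a..t} g) g"
  proof (cases k)
    case 0
    then show ?thesis
      using ac indefinite_integral_has_vector_derivative_AE[OF integrable_on_lebesgue_on[OF gi interval_sets]]
      by (simp add: sob_deriv_def)
  next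
    case (Suc l)
    have cg: "continuous_on {a..b} g" using g Suc by (simp add: sobolev_Suc_continuous)
    have "has_deriv (\<lambda>t. c + integral {a..t} g) (g t) t" if "t \<in> {a..b}" for t
      using has_vector_derivative_add[OF has_vector_derivative_const integral_has_vector_derivative[OF cg that]]
      by simp
    then show ?thesis using ac Suc by (simp add: sob_deriv_def)
  qed
qed (use f in auto)

text \<open>A bound for the norm of the embedding of W_p^1 into the continuous functions.\<close>

definition sup_const :: real where "sup_const = (b - a + 1) / (b - a) + (b - a + 1)"

lemma sup_const_nonneg: "0 \<le> sup_const"
  using ab by (simp add: sup_const_def)

text \<open>The oscillation of f is at most the integral of |f'|, so |f t| exceeds the mean of |f| by at most
that amount.\<close>

lemma sobolev_sup_bound:
  assumes f: "f \<in> Wp 1" and t: "t \<in> {a..b}"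
  shows "cmod (f t) \<le> sup_const * wnorm 1 f"
proof -
  note F = sobolev_SucE[OF f[unfolded One_nat_def]]
  define L where "L = b - a + 1"
  have L: "L \<ge> 0" using ab by (simp add: L_def)
  have DL: "D f \<in> LP" using F(2) by (simp add: sobolev_0)
  have i1: "integrable M (D f)" and i2: "integrable M f"
    and J: "(LINT t|M. cmod (D f t)) \<le> L * pnorm (D f)"
    and J2: "(LINT t|M. cmod (f t)) \<le> L * pnorm f"
    using Lp_imp_L1[OF DL] Lp_imp_L1[OF F(3)] by (auto simp: L_def)
  define J' where "J' = (LINT t|M. cmod (D f t))"
  have J'_eq: "J' = integral {a..b} (\<lambda>t. cmod (D f t))"
    unfolding J'_def by (rule lebesgue_integral_eq_integral) (use i1 in auto)
  have ion: "(\<lambda>t. cmod (D f t)) integrable_on {a..b}"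
    by (rule integrable_on_lebesgue_on) (use i1 in auto)
  have osc: "cmod (f y - f x) \<le> J'" if xy: "x \<in> {a..b}" "y \<in> {a..b}" "x \<le> y" for x y
  proof -
    have sub: "{x..y} \<subseteq> {a..b}" using xy by auto
    have hi: "(D f has_integral (f y - f x)) {x..y}" by (rule sob_deriv_has_integral[OF F(1) xy])
    have "cmod (integral {x..y} (D f)) \<le> integral {x..y} (\<lambda>t. cmod (D f t))"
      by (intro integral_norm_bound_integral integrable_on_subinterval[OF ion sub])
        (use hi in \<open>auto simp: has_integral_iff\<close>)
    also have "\<dots> \<le> J'" unfolding J'_eq
      by (intro integral_subset_le[OF sub] integrable_on_subinterval[OF ion sub] ion) auto
    finally show ?thesis using hi by (simp add: integral_unique)
  qed
  have le: "cmod (f t) \<le> cmod (f s) + J'" if s: "s \<in> {a..b}" for s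
  proof -
    have "cmod (f t - f s) \<le> J'"
      using osc[OF s t] osc[OF t s] by (cases "s \<le> t") (auto simp: norm_minus_commute)
    moreover have "cmod (f t) \<le> cmod (f s) + cmod (f t - f s)"
      using norm_triangle_ineq[of "f s" "f t - f s"] by simp
    ultimately show ?thesis by simp
  qed
  interpret finite_measure M by (rule finite_measure_M)
  have "(LINT s|M. cmod (f t)) \<le> (LINT s|M. cmod (f s) + J')"
    by (rule integral_mono_AE) (use i2 le in auto)
  also have "\<dots> = (LINT s|M. cmod (f s)) + (b - a) * J'"
    using i2 by (simp add: measure_M_interval)
  also have "(LINT s|M. cmod (f t)) = (b - a) * cmod (f t)" by (simp add: measure_M_interval)
  finally have "(b - a) * cmod (f t) \<le> (LINT s|M. cmod (f s)) + (b - a) * J'" .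
  moreover have "(b - a) * J' \<le> (b - a) * (L * pnorm (D f))"
    using J ab by (intro mult_left_mono) (auto simp: J'_def)
  ultimately have "(b - a) * cmod (f t) \<le> L * pnorm f + (b - a) * (L * pnorm (D f))"
    using J2 by linarith
  then have "cmod (f t) \<le> (L * pnorm f + (b - a) * (L * pnorm (D f))) / (b - a)"
    using ab by (simp add: field_simps)
  also have "\<dots> = L / (b - a) * pnorm f + L * pnorm (D f)"
    using ab by (simp add: field_simps)
  also have "\<dots> \<le> sup_const * pnorm f + sup_const * pnorm (D f)"
  proof (intro add_mono mult_right_mono Lp_norm_nonneg F DL)
    show "L / (b - a) \<le> sup_const" "L \<le> sup_const" using ab by (auto simp: sup_const_def L_def)
  qed
  also have "\<dots> = sup_const * wnorm 1 f"
    using F(4) by (simp add: sobolev_norm_0 distrib_left)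
  finally show ?thesis .
qed

lemma Lp_mult_sobolev_1:
  assumes f: "f \<in> LP" and h: "h \<in> Wp 1"
  shows "(\<lambda>t. f t * h t) \<in> LP \<and>
    pnorm (\<lambda>t. f t * h t) \<le> sup_const * wnorm 1 h * pnorm f"
proof (rule Lp_dominated[OF f])
  show "(\<lambda>t. f t * h t) \<in> borel_measurable M"
    by (intro borel_measurable_times Lp_measurable f sobolev_in_Lp[OF h])
  show "0 \<le> sup_const * wnorm 1 h"
    by (intro mult_nonneg_nonneg sup_const_nonneg sobolev_norm_nonneg h)
  show "AE t in M. cmod (f t * h t) \<le> sup_const * wnorm 1 h * cmod (f t)"
  proof (rule AE_I2)
    fix t assume "t \<in> space M"
    then have "cmod (h t) \<le> sup_const * wnorm 1 h" by (intro sobolev_sup_bound h) simp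
    then have "cmod (f t) * cmod (h t) \<le> cmod (f t) * (sup_const * wnorm 1 h)"
      by (intro mult_left_mono) auto
    then show "cmod (f t * h t) \<le> sup_const * wnorm 1 h * cmod (f t)"
      by (simp add: norm_mult mult.commute)
  qed
qed

text \<open>The Leibniz rule reduces order k + 1 to two products of order k. At order 0 one factor must be
bounded, and it is when it lies in W_p^1; this is the reason for max 1 k.\<close>

lemma sobolev_mult:
  "\<exists>C\<ge>0. \<forall>f\<in>Wp k. \<forall>h\<in>Wp (max 1 k). (\<lambda>t. f t * h t) \<in> Wp k \<and>
     wnorm k (\<lambda>t. f t * h t) \<le> C * (wnorm k f * wnorm (max 1 k) h)"
proof (induction k)
  case 0
  show ?case
    by (rule exI[of _ sup_const])
      (use Lp_mult_sobolev_1 in \<open>auto simp: sobolev_0 sobolev_norm_0 sup_const_nonneg mult_ac\<close>)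
next
  case (Suc k)
  from Suc.IH obtain C where C: "C \<ge> 0"
    "\<forall>f\<in>Wp k. \<forall>h\<in>Wp (max 1 k). (\<lambda>t. f t * h t) \<in> Wp k \<and>
     wnorm k (\<lambda>t. f t * h t) \<le> C * (wnorm k f * wnorm (max 1 k) h)"
    by blast
  define N where "N = wnorm (Suc k)"
  have N0: "0 \<le> N u" if "u \<in> Wp (Suc k)" for u
    unfolding N_def by (rule sobolev_norm_nonneg[OF that])
  (* one half of the Leibniz rule; the other half is the same with f and h exchanged *)
  have half: "(\<lambda>t. D f t * h t) \<in> Wp k \<and> wnorm k (\<lambda>t. D f t * h t) \<le> C * (N f * N h)"
    if f: "f \<in> Wp (Suc k)" and h: "h \<in> Wp (Suc k)" for f h
  proof -
    note F = sobolev_SucE[OF f]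
    have h1: "h \<in> Wp (max 1 k)" "wnorm (max 1 k) h \<le> N h"
      using sobolev_subset[OF h, of "max 1 k"] by (auto simp: N_def)
    have "wnorm k (D f) * wnorm (max 1 k) h \<le> N f * N h"
      using h1 F(4) Lp_norm_nonneg[OF F(3)] N0[OF f]
      by (intro mult_mono sobolev_norm_nonneg) (auto simp: N_def)
    then have "C * (wnorm k (D f) * wnorm (max 1 k) h) \<le> C * (N f * N h)"
      by (rule mult_left_mono[OF _ C(1)])
    moreover note bspec[OF bspec[OF C(2) F(2)] h1(1)]
    ultimately show ?thesis by (meson order_trans)
  qed
  show ?case
  proof (intro exI[of _ "sup_const + 8 * C"] conjI ballI)
    show "0 \<le> sup_const + 8 * C" using sup_const_nonneg C(1) by simp
    fix f h assume f: "f \<in> Wp (Suc k)" and "h \<in> Wp (max 1 (Suc k))"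
    then have h: "h \<in> Wp (Suc k)" by simp
    note F = sobolev_SucE[OF f] and H = sobolev_SucE[OF h]
    have h1: "h \<in> Wp 1" "wnorm 1 h \<le> N h"
      using sobolev_subset[OF h, of 1] by (auto simp: N_def)
    have "pnorm (\<lambda>t. f t * h t) \<le> sup_const * wnorm 1 h * pnorm f"
      using Lp_mult_sobolev_1[OF F(3) h1(1)] by simp
    also have "\<dots> \<le> sup_const * N h * N f"
      using h1(2) F(4) sobolev_norm_nonneg[OF F(2)] N0[OF h] sup_const_nonneg
      by (intro mult_mono mult_left_mono mult_nonneg_nonneg sobolev_norm_nonneg Lp_norm_nonneg h1 F) (auto simp: N_def)
    finally have L: "pnorm (\<lambda>t. f t * h t) \<le> sup_const * (N f * N h)" by (simp add: mult_ac)
    have a1: "(\<lambda>t. D f t * h t) \<in> Wp k" "wnorm k (\<lambda>t. D f t * h t) \<le> C * (N f * N h)"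
      using half[OF f h] by auto
    have a2: "(\<lambda>t. f t * D h t) \<in> Wp k" "wnorm k (\<lambda>t. f t * D h t) \<le> C * (N f * N h)"
      using half[OF h f] by (auto simp: mult_ac)
    have s: "(\<lambda>t. D f t * h t + f t * D h t) \<in> Wp k"
      "wnorm k (\<lambda>t. D f t * h t + f t * D h t) \<le> 8 * C * (N f * N h)"
      using sobolev_add[OF a1(1) a2(1)] a1(2) a2(2) by auto
    have r: "(\<lambda>t. f t * h t) \<in> Wp (Suc k)"
      "N (\<lambda>t. f t * h t) = pnorm (\<lambda>t. f t * h t) + wnorm k (\<lambda>t. D f t * h t + f t * D h t)"
      unfolding N_def using sobolev_SucI[OF sob_deriv_mult[OF F(1) H(1)] s(1)] by auto
    show "(\<lambda>t. f t * h t) \<in> Wp (Suc k)" by (rule r)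
    show "wnorm (Suc k) (\<lambda>t. f t * h t)
        \<le> (sup_const + 8 * C) * (wnorm (Suc k) f * wnorm (max 1 (Suc k)) h)"
      using r(2) L s(2) by (simp add: N_def distrib_right)
  qed
qed

end

section \<open>Linear systems with integrable coefficients\<close>

locale linear_system = sobolev_interval +
  fixes m :: nat and A :: "nat \<Rightarrow> nat \<Rightarrow> real \<Rightarrow> complex"
  assumes A_integrable: "\<And>i j. i < m \<Longrightarrow> j < m \<Longrightarrow> integrable (lebesgue_on {a..b}) (A i j)"
begin

definition \<alpha> :: "real \<Rightarrow> real" where "\<alpha> t = (\<Sum>i<m. \<Sum>j<m. cmod (A i j t))"

definition \<phi> :: "real \<Rightarrow> real" where "\<phi> t = integral {a..t} \<alpha>"

definition Au :: "(nat \<Rightarrow> real \<Rightarrow> complex) \<Rightarrow> nat \<Rightarrow> real \<Rightarrow> complex" where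
  "Au u i t = (\<Sum>j<m. A i j t * u j t)"

definition vnorm :: "(nat \<Rightarrow> real \<Rightarrow> complex) \<Rightarrow> real \<Rightarrow> real" where
  "vnorm u t = (\<Sum>i<m. cmod (u i t))"

text \<open>The Cauchy problem u' + A u = f, u(a) = c as an integral equation, which makes sense for
integrable A and f and continuous u.\<close>

definition integral_solution ::
    "(nat \<Rightarrow> complex) \<Rightarrow> (nat \<Rightarrow> real \<Rightarrow> complex) \<Rightarrow> (nat \<Rightarrow> real \<Rightarrow> complex) \<Rightarrow> bool" where
  "integral_solution c f u \<longleftrightarrow>
     (\<forall>i<m. continuous_on {a..b} (u i) \<and>
        (\<forall>t\<in>{a..b}. u i t = c i + integral {a..t} (\<lambda>s. f i s - Au u i s)))"

lemma \<alpha>_integrable: "integrable M \<alpha>"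
  unfolding \<alpha>_def[abs_def]
  by (intro Bochner_Integration.integrable_sum integrable_norm A_integrable) auto

lemma \<alpha>_nonneg: "0 \<le> \<alpha> t"
  unfolding \<alpha>_def by (intro sum_nonneg) auto

lemma \<alpha>_integrable_on: "\<alpha> integrable_on {a..b}"
  using integrable_on_lebesgue_on[OF \<alpha>_integrable] by simp

lemma \<phi>_nonneg: "t \<in> {a..b} \<Longrightarrow> 0 \<le> \<phi> t"
  unfolding \<phi>_def
  by (rule integral_nonneg) (auto intro: integrable_on_subinterval[OF \<alpha>_integrable_on] \<alpha>_nonneg)

lemma \<phi>_le: "t \<in> {a..b} \<Longrightarrow> \<phi> t \<le> \<phi> b"
  unfolding \<phi>_def
  by (rule integral_subset_le) (auto intro: integrable_on_subinterval[OF \<alpha>_integrable_on] \<alpha>_nonneg)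

lemma \<phi>_continuous: "continuous_on {a..b} \<phi>"
  unfolding \<phi>_def by (rule indefinite_integral_continuous_1) (rule \<alpha>_integrable_on)

lemma integrable_mult_continuous:
  fixes g h :: "real \<Rightarrow> complex"
  assumes g: "integrable M g" and h: "continuous_on {a..b} h"
  shows "integrable M (\<lambda>t. g t * h t)"
proof -
  obtain B where B: "B \<ge> 0" "\<forall>t\<in>{a..b}. cmod (h t) \<le> B" using continuous_on_interval_bounded[OF h] by blast
  have hm: "h \<in> borel_measurable M" by (rule continuous_imp_measurable_on_sets_lebesgue[OF h]) simp
  show ?thesis
  proof (rule Bochner_Integration.integrable_bound)
    show "integrable M (\<lambda>t. complex_of_real B * g t)" using g by simp
    show "(\<lambda>t. g t * h t) \<in> borel_measurable M" using g hm by simp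
    show "AE t in M. norm (g t * h t) \<le> norm (complex_of_real B * g t)"
    proof (rule AE_I2)
      fix t assume "t \<in> space M"
      then have "cmod (h t) * cmod (g t) \<le> B * cmod (g t)" using B(2) by (intro mult_right_mono) auto
      then show "norm (g t * h t) \<le> norm (complex_of_real B * g t)" using B(1) by (simp add: norm_mult mult.commute)
    qed
  qed
qed

lemma Au_integrable:
  assumes "\<And>j. j < m \<Longrightarrow> continuous_on {a..b} (u j)" "i < m"
  shows "integrable M (Au u i)"
proof -
  have "integrable M (\<lambda>t. \<Sum>j<m. A i j t * u j t)"
    using assms A_integrable by (intro Bochner_Integration.integrable_sum integrable_mult_continuous) auto
  then show ?thesis by (simp add: Au_def[abs_def])
qed

lemma sum_norm_Au_le: "(\<Sum>i<m. cmod (Au u i t)) \<le> \<alpha> t * vnorm u t"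
proof -
  have "(\<Sum>i<m. cmod (Au u i t)) \<le> (\<Sum>i<m. \<Sum>j<m. cmod (A i j t) * vnorm u t)"
  proof (rule sum_mono)
    fix i
    have "cmod (Au u i t) \<le> (\<Sum>j<m. cmod (A i j t) * cmod (u j t))"
      unfolding Au_def by (rule order_trans[OF norm_sum]) (simp add: norm_mult)
    also have "\<dots> \<le> (\<Sum>j<m. cmod (A i j t) * vnorm u t)"
      by (intro sum_mono mult_left_mono) (auto simp: vnorm_def intro: member_le_sum)
    finally show "cmod (Au u i t) \<le> (\<Sum>j<m. cmod (A i j t) * vnorm u t)" .
  qed
  also have "\<dots> = \<alpha> t * vnorm u t" by (simp add: \<alpha>_def sum_distrib_right)
  finally show ?thesis .
qed

text \<open>In the norm with weight exp (- 2 \<phi>) the integral operator of the system has norm at most 1/2.\<close>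

lemma integral_Au_contraction:
  assumes u: "\<And>j. j < m \<Longrightarrow> continuous_on {a..b} (u j)"
    and le: "\<And>s. s \<in> {a..b} \<Longrightarrow> vnorm u s \<le> K * exp (2 * \<phi> s)" and K: "0 \<le> K"
    and t: "t \<in> {a..b}"
  shows "(\<Sum>i<m. cmod (integral {a..t} (Au u i))) \<le> K / 2 * exp (2 * \<phi> t)"
proof -
  have sub: "{a..t} \<subseteq> {a..b}" using t by auto
  have i1: "Au u i integrable_on {a..t}" if "i < m" for i
    by (rule L1_imp_integrable_on[OF Au_integrable[OF u that] sub])
  have i2: "(\<lambda>s. cmod (Au u i s)) integrable_on {a..t}" if "i < m" for i
    by (rule L1_imp_integrable_on[OF integrable_norm[OF Au_integrable[OF u that]] sub])
  have hi: "((\<lambda>s. K * (\<alpha> s * exp (2 * \<phi> s))) has_integral K * ((exp (2 * \<phi> t) - 1) / 2)) {a..t}"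
    unfolding \<phi>_def
    by (intro has_integral_mult_right integral_times_exp_primitive[OF \<alpha>_integrable _ t] \<alpha>_nonneg)
  have "(\<Sum>i<m. cmod (integral {a..t} (Au u i))) \<le> (\<Sum>i<m. integral {a..t} (\<lambda>s. cmod (Au u i s)))"
    by (intro sum_mono integral_norm_bound_integral i1 i2) auto
  also have "\<dots> = integral {a..t} (\<lambda>s. \<Sum>i<m. cmod (Au u i s))"
    by (rule integral_sum[symmetric]) (auto intro: i2)
  also have "\<dots> \<le> integral {a..t} (\<lambda>s. K * (\<alpha> s * exp (2 * \<phi> s)))"
  proof (rule integral_le)
    show "(\<lambda>s. \<Sum>i<m. cmod (Au u i s)) integrable_on {a..t}" by (intro integrable_sum i2) auto
    show "(\<lambda>s. K * (\<alpha> s * exp (2 * \<phi> s))) integrable_on {a..t}" using hi by blast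
    fix s assume "s \<in> {a..t}"
    then have "\<alpha> s * vnorm u s \<le> \<alpha> s * (K * exp (2 * \<phi> s))" using sub by (intro mult_left_mono le \<alpha>_nonneg) auto
    with sum_norm_Au_le[of u s] show "(\<Sum>i<m. cmod (Au u i s)) \<le> K * (\<alpha> s * exp (2 * \<phi> s))"
      by (simp add: mult.left_commute)
  qed
  also have "\<dots> = K / 2 * (exp (2 * \<phi> t) - 1)" unfolding integral_unique[OF hi] by simp
  also have "\<dots> \<le> K / 2 * exp (2 * \<phi> t)" using K by (intro mult_left_mono) auto
  finally show ?thesis .
qed

text \<open>Gronwall's inequality by absorption: if l is the maximum of exp (- 2 \<phi>) \<Sum> |u_i|, the
contraction estimate at a point where it is attained gives l \<le> K + l/2.\<close>

lemma gronwall: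
  assumes u: "\<And>j. j < m \<Longrightarrow> continuous_on {a..b} (u j)"
    and le: "\<And>t. t \<in> {a..b} \<Longrightarrow> vnorm u t \<le> K + (\<Sum>i<m. cmod (integral {a..t} (Au u i)))"
    and t: "t \<in> {a..b}" and K: "0 \<le> K"
  shows "vnorm u t \<le> 2 * K * exp (2 * \<phi> b)"
proof -
  have c: "continuous_on {a..b} (\<lambda>t. vnorm u t * exp (- (2 * \<phi> t)))"
    unfolding vnorm_def using u by (intro continuous_intros \<phi>_continuous) auto
  obtain t0 where t0: "t0 \<in> {a..b}"
    "\<forall>s\<in>{a..b}. vnorm u s * exp (- (2 * \<phi> s)) \<le> vnorm u t0 * exp (- (2 * \<phi> t0))"
    using continuous_attains_sup[OF _ _ c] t by auto
  define L where "L = vnorm u t0 * exp (- (2 * \<phi> t0))"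
  have L0: "0 \<le> L" by (auto simp: L_def vnorm_def intro!: mult_nonneg_nonneg sum_nonneg)
  have uL: "vnorm u s \<le> L * exp (2 * \<phi> s)" if "s \<in> {a..b}" for s
  proof -
    have "vnorm u s * exp (- (2 * \<phi> s)) \<le> L" using t0(2) that by (simp add: L_def)
    then show ?thesis by (simp add: exp_minus field_simps)
  qed
  have "vnorm u t0 \<le> K + L / 2 * exp (2 * \<phi> t0)"
    using le[OF t0(1)] integral_Au_contraction[OF u uL L0 t0(1)] by simp
  then have "L \<le> (K + L / 2 * exp (2 * \<phi> t0)) * exp (- (2 * \<phi> t0))"
    unfolding L_def by (rule mult_right_mono) simp
  also have "\<dots> = K * exp (- (2 * \<phi> t0)) + L / 2 * (exp (2 * \<phi> t0) * exp (- (2 * \<phi> t0)))"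
    by (simp only: distrib_right mult.assoc)
  also have "exp (2 * \<phi> t0) * exp (- (2 * \<phi> t0)) = 1" by (simp add: exp_minus)
  also have "K * exp (- (2 * \<phi> t0)) \<le> K * 1" using K \<phi>_nonneg[OF t0(1)] by (intro mult_left_mono) auto
  finally have "L \<le> 2 * K" by simp
  have "vnorm u t \<le> L * exp (2 * \<phi> t)" by (rule uL[OF t])
  also have "\<dots> \<le> 2 * K * exp (2 * \<phi> b)"
    using \<open>L \<le> 2 * K\<close> L0 K \<phi>_le[OF t] by (intro mult_mono) auto
  finally show ?thesis .
qed

lemma integral_solution_bound:
  assumes sol: "integral_solution c f u" and f: "\<And>i. i < m \<Longrightarrow> integrable M (f i)" and t: "t \<in> {a..b}"
  shows "vnorm u t \<le> 2 * (\<Sum>i<m. cmod (c i) + (LINT s|M. cmod (f i s))) * exp (2 * \<phi> b)"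
proof (rule gronwall[OF _ _ t])
  have u: "continuous_on {a..b} (u j)" if "j < m" for j using sol that by (simp add: integral_solution_def)
  show "continuous_on {a..b} (u j)" if "j < m" for j by (rule u[OF that])
  show "0 \<le> (\<Sum>i<m. cmod (c i) + (LINT s|M. cmod (f i s)))"
    by (rule sum_nonneg) (simp add: integral_nonneg_AE)
  fix t assume t: "t \<in> {a..b}"
  then have sub: "{a..t} \<subseteq> {a..b}" by auto
  have "vnorm u t \<le> (\<Sum>i<m. cmod (c i) + (LINT s|M. cmod (f i s)) + cmod (integral {a..t} (Au u i)))"
    unfolding vnorm_def
  proof (rule sum_mono)
    fix i assume "i \<in> {..<m}"
    then have i: "i < m" by simp
    have fi: "f i integrable_on {a..t}" by (rule L1_imp_integrable_on[OF f[OF i] sub])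
    have ni: "(\<lambda>s. cmod (f i s)) integrable_on {x..y}" if "{x..y} \<subseteq> {a..b}" for x y
      by (rule L1_imp_integrable_on[OF integrable_norm[OF f[OF i]] that])
    have ai: "Au u i integrable_on {a..t}"
      by (rule L1_imp_integrable_on[OF Au_integrable[OF u i] sub])
    have "cmod (integral {a..t} (f i)) \<le> integral {a..t} (\<lambda>s. cmod (f i s))"
      by (intro integral_norm_bound_integral fi ni sub) auto
    also have "\<dots> \<le> integral {a..b} (\<lambda>s. cmod (f i s))"
      by (intro integral_subset_le sub ni) auto
    also have "\<dots> = (LINT s|M. cmod (f i s))"
      by (rule lebesgue_integral_eq_integral[symmetric]) (use f[OF i] in auto)
    finally have 1: "cmod (integral {a..t} (f i)) \<le> (LINT s|M. cmod (f i s))" .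
    have "u i t = c i + integral {a..t} (\<lambda>s. f i s - Au u i s)"
      using sol i t by (simp add: integral_solution_def)
    also have "\<dots> = c i + (integral {a..t} (f i) - integral {a..t} (Au u i))"
      by (simp add: integral_diff[OF fi ai])
    finally have "u i t = c i + (integral {a..t} (f i) - integral {a..t} (Au u i))" .
    then have "cmod (u i t) \<le> cmod (c i) + (cmod (integral {a..t} (f i)) + cmod (integral {a..t} (Au u i)))"
      using norm_triangle_ineq[of "c i" "integral {a..t} (f i) - integral {a..t} (Au u i)"]
        norm_triangle_ineq4[of "integral {a..t} (f i)" "integral {a..t} (Au u i)"] by simp
    with 1 show "cmod (u i t) \<le> cmod (c i) + (LINT s|M. cmod (f i s)) + cmod (integral {a..t} (Au u i))" by simp
  qed
  then show "vnorm u t \<le> (\<Sum>i<m. cmod (c i) + (LINT s|M. cmod (f i s))) + (\<Sum>i<m. cmod (integral {a..t} (Au u i)))"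
    by (simp add: sum.distrib)
qed

fun picard :: "(nat \<Rightarrow> complex) \<Rightarrow> (nat \<Rightarrow> real \<Rightarrow> complex) \<Rightarrow> nat \<Rightarrow> nat \<Rightarrow> real \<Rightarrow> complex" where
  "picard c f 0 = (\<lambda>i t. 0)"
| "picard c f (Suc k) = (\<lambda>i t. c i + integral {a..t} (\<lambda>s. f i s - Au (picard c f k) i s))"

lemma picard_continuous:
  assumes f: "\<And>i. i < m \<Longrightarrow> integrable M (f i)" and i: "i < m"
  shows "continuous_on {a..b} (picard c f k i)"
  using i
proof (induction k arbitrary: i)
  case (Suc k)
  have "integrable M (\<lambda>s. f i s - Au (picard c f k) i s)"
    by (intro Bochner_Integration.integrable_diff f Au_integrable Suc)
  then have "(\<lambda>s. f i s - Au (picard c f k) i s) integrable_on {a..b}"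
    by (rule integrable_on_lebesgue_on) simp
  then show ?case by (simp, intro continuous_intros indefinite_integral_continuous_1)
qed simp

text \<open>Picard iteration. The increments of the iterates decay like exp (2 \<phi>) / 2^k by the contraction
estimate, so the iterates converge uniformly, and dominated convergence carries the integral
equation over to the limit.\<close>

lemma integral_solution_exists:
  assumes f: "\<And>i. i < m \<Longrightarrow> integrable M (f i)"
  shows "\<exists>u. integral_solution c f u"
proof -
  define U where "U = picard c f"
  define V where "V k i t = U (Suc k) i t - U k i t" for k i t
  have U0: "U 0 i t = 0" for i t by (simp add: U_def)
  have US: "U (Suc k) i t = c i + integral {a..t} (\<lambda>s. f i s - Au (U k) i s)" for k i t by (simp add: U_def)
  have cU: "continuous_on {a..b} (U k i)" if "i < m" for k i
    unfolding U_def by (rule picard_continuous[OF f that])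
  have cV: "continuous_on {a..b} (V k i)" if "i < m" for k i
    unfolding V_def by (intro continuous_intros cU that)
  have iAU: "Au (U k) i integrable_on {a..t}" "f i integrable_on {a..t}" if "i < m" "t \<in> {a..b}" for k i t
    using that L1_imp_integrable_on[OF Au_integrable[OF cU]]
      L1_imp_integrable_on[OF f] by auto
  have V_Suc: "V (Suc k) i t = - integral {a..t} (Au (V k) i)" if i: "i < m" and t: "t \<in> {a..b}" for k i t
  proof -
    have "Au (V k) i = (\<lambda>s. Au (U (Suc k)) i s - Au (U k) i s)"
      by (rule ext) (simp add: Au_def V_def right_diff_distrib sum_subtractf)
    then have "integral {a..t} (Au (V k) i) = integral {a..t} (Au (U (Suc k)) i) - integral {a..t} (Au (U k) i)"
      by (simp only: integral_diff[OF iAU(1)[OF i t] iAU(1)[OF i t]])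
    moreover have "V (Suc k) i t = integral {a..t} (\<lambda>s. f i s - Au (U (Suc k)) i s) - integral {a..t} (\<lambda>s. f i s - Au (U k) i s)"
      unfolding V_def by (simp only: US) simp
    ultimately show ?thesis by (simp add: integral_diff[OF iAU(2)[OF i t] iAU(1)[OF i t]])
  qed
  have cv: "continuous_on {a..b} (\<lambda>t. complex_of_real (vnorm (V 0) t))"
    unfolding vnorm_def by (intro continuous_intros cV) auto
  obtain K where K: "K \<ge> 0" "\<forall>t\<in>{a..b}. cmod (complex_of_real (vnorm (V 0) t)) \<le> K"
    using continuous_on_interval_bounded[OF cv] by blast
  have V_le: "vnorm (V k) t \<le> K * (1/2) ^ k * exp (2 * \<phi> t)" if t: "t \<in> {a..b}" for k t
    using t
  proof (induction k arbitrary: t)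
    case 0
    have "\<bar>vnorm (V 0) t\<bar> \<le> K" using bspec[OF K(2) 0] by simp
    then have "vnorm (V 0) t \<le> K * 1" by simp
    also have "\<dots> \<le> K * exp (2 * \<phi> t)" using K(1) \<phi>_nonneg[OF 0] by (intro mult_left_mono) auto
    finally show ?case by simp
  next
    case (Suc k)
    have "vnorm (V (Suc k)) t = (\<Sum>i<m. cmod (integral {a..t} (Au (V k) i)))"
      unfolding vnorm_def by (rule sum.cong) (use V_Suc Suc.prems in auto)
    also have "\<dots> \<le> K * (1/2) ^ k / 2 * exp (2 * \<phi> t)"
      by (rule integral_Au_contraction[OF cV Suc.IH _ Suc.prems]) (use K(1) in auto)
    finally show ?case by simp
  qed
  define K' where "K' = K * exp (2 * \<phi> b)"
  have V_le': "cmod (V k i t) \<le> K' * (1/2) ^ k" if i: "i < m" and t: "t \<in> {a..b}" for k i t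
  proof -
    have "cmod (V k i t) \<le> vnorm (V k) t" unfolding vnorm_def by (rule member_le_sum) (use i in auto)
    also have "\<dots> \<le> K * (1/2) ^ k * exp (2 * \<phi> t)" by (rule V_le[OF t])
    also have "\<dots> \<le> K * (1/2) ^ k * exp (2 * \<phi> b)" using K(1) \<phi>_le[OF t] by (intro mult_left_mono) auto
    finally show ?thesis by (simp add: K'_def mult_ac)
  qed
  (* the iteration starts at 0, so the increments sum up to the iterates *)
  have tele: "(\<Sum>l<k. V l i t) = U k i t" for k i t
    by (induction k) (auto simp: V_def U0)
  have sm: "summable (\<lambda>k. K' * (1/2::real) ^ k)" by (intro summable_mult summable_geometric) simp
  define u where "u i t = (\<Sum>k. V k i t)" for i t
  have ul: "uniform_limit {a..b} (\<lambda>k. U k i) (u i) sequentially" if i: "i < m" for i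
  proof -
    have "uniform_limit {a..b} (\<lambda>k t. \<Sum>l<k. V l i t) (\<lambda>t. \<Sum>l. V l i t) sequentially"
      by (rule Weierstrass_m_test[where M = "\<lambda>k. K' * (1/2) ^ k"]) (use V_le'[OF i] sm in auto)
    then show ?thesis by (simp add: tele u_def[abs_def])
  qed
  have cu: "continuous_on {a..b} (u i)" if i: "i < m" for i
    by (rule uniform_limit_theorem[OF _ ul[OF i]]) (simp_all add: cU i)
  have lim: "(\<lambda>k. U k i t) \<longlonglongrightarrow> u i t" if i: "i < m" and t: "t \<in> {a..b}" for i t
    by (rule tendsto_uniform_limitI[OF ul[OF i] t])
  have U_le: "cmod (U k i t) \<le> 2 * K'" if i: "i < m" and t: "t \<in> {a..b}" for k i t
  proof -
    have "cmod (U k i t) \<le> (\<Sum>l<k. K' * (1/2) ^ l)"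
      unfolding tele[symmetric] by (rule order_trans[OF norm_sum]) (intro sum_mono V_le' i t)
    also have "\<dots> \<le> (\<Sum>l. K' * (1/2) ^ l)"
      by (rule sum_le_suminf[OF sm]) (use K(1) in \<open>auto simp: K'_def\<close>)
    also have "\<dots> = 2 * K'" using suminf_mult[OF summable_geometric[of "1/2::real"], of K'] by (simp add: suminf_geometric)
    finally show ?thesis .
  qed
  have "u i t = c i + integral {a..t} (\<lambda>s. f i s - Au u i s)" if i: "i < m" and t: "t \<in> {a..b}" for i t
  proof -
    have sub: "{a..t} \<subseteq> {a..b}" using t by auto
    let ?h = "\<lambda>s. cmod (f i s) + (\<Sum>j<m. cmod (A i j s) * (2 * K'))"
    have "integrable M ?h"
      by (intro Bochner_Integration.integrable_add Bochner_Integration.integrable_sum integrable_mult_left integrable_norm f A_integrable i) auto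
    then have hi: "?h integrable_on {a..t}" by (rule L1_imp_integrable_on[OF _ sub])
    have "(\<lambda>k. integral {a..t} (\<lambda>s. f i s - Au (U k) i s)) \<longlonglongrightarrow> integral {a..t} (\<lambda>s. f i s - Au u i s)"
    proof (rule dominated_convergence(2)[OF _ hi])
      show "(\<lambda>s. f i s - Au (U k) i s) integrable_on {a..t}" for k by (intro integrable_diff iAU i t)
      show "norm (f i s - Au (U k) i s) \<le> ?h s" if "s \<in> {a..t}" for k s
      proof -
        have s: "s \<in> {a..b}" using that sub by auto
        have "norm (f i s - Au (U k) i s) \<le> cmod (f i s) + cmod (Au (U k) i s)" by (rule norm_triangle_ineq4)
        also have "cmod (Au (U k) i s) \<le> (\<Sum>j<m. cmod (A i j s) * cmod (U k j s))"
          unfolding Au_def by (rule order_trans[OF norm_sum]) (simp add: norm_mult)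
        also have "\<dots> \<le> (\<Sum>j<m. cmod (A i j s) * (2 * K'))"
          by (intro sum_mono mult_left_mono U_le s) auto
        finally show ?thesis by simp
      qed
      show "(\<lambda>k. f i s - Au (U k) i s) \<longlonglongrightarrow> f i s - Au u i s" if "s \<in> {a..t}" for s
        unfolding Au_def using that sub by (intro tendsto_intros lim) auto
    qed
    then have "(\<lambda>k. U (Suc k) i t) \<longlonglongrightarrow> c i + integral {a..t} (\<lambda>s. f i s - Au u i s)"
      unfolding US by (intro tendsto_intros)
    moreover have "(\<lambda>k. U (Suc k) i t) \<longlonglongrightarrow> u i t" by (rule LIMSEQ_Suc[OF lim[OF i t]])
    ultimately show ?thesis by (rule LIMSEQ_unique[symmetric])
  qed
  then show ?thesis using cu unfolding integral_solution_def by blast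
qed

lemma integral_solution_initial: "integral_solution c f u \<Longrightarrow> i < m \<Longrightarrow> u i a = c i"
  using ab by (simp add: integral_solution_def)

lemma integral_solution_unique:
  assumes u: "integral_solution c f u" and v: "integral_solution c f v"
    and f: "\<And>i. i < m \<Longrightarrow> integrable M (f i)" and i: "i < m" and t: "t \<in> {a..b}"
  shows "u i t = v i t"
proof -
  have c: "continuous_on {a..b} (u j)" "continuous_on {a..b} (v j)" if "j < m" for j
    using u v that by (auto simp: integral_solution_def)
  have "integral_solution (\<lambda>_. 0) (\<lambda>_ _. 0) (\<lambda>i t. u i t - v i t)"
    unfolding integral_solution_def
  proof (intro allI impI conjI ballI)
    fix i assume i: "i < m"
    show "continuous_on {a..b} (\<lambda>t. u i t - v i t)" by (intro continuous_intros c i)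
    fix t assume t: "t \<in> {a..b}"
    then have sub: "{a..t} \<subseteq> {a..b}" by auto
    have I: "(\<lambda>s. f i s - Au w i s) integrable_on {a..t}" if "\<And>j. j < m \<Longrightarrow> continuous_on {a..b} (w j)" for w
      by (rule L1_imp_integrable_on[OF Bochner_Integration.integrable_diff[OF f[OF i] Au_integrable[OF that i]] sub])
    have "u i t - v i t = integral {a..t} (\<lambda>s. f i s - Au u i s) - integral {a..t} (\<lambda>s. f i s - Au v i s)"
      using u v i t by (simp add: integral_solution_def)
    also have "\<dots> = integral {a..t} (\<lambda>s. (f i s - Au u i s) - (f i s - Au v i s))"
      by (rule integral_diff[OF I[OF c(1)] I[OF c(2)], symmetric])
    also have "(\<lambda>s. (f i s - Au u i s) - (f i s - Au v i s)) = (\<lambda>s. 0 - Au (\<lambda>i t. u i t - v i t) i s)"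
      by (rule ext) (simp add: Au_def right_diff_distrib sum_subtractf)
    finally show "u i t - v i t = 0 + integral {a..t} (\<lambda>s. 0 - Au (\<lambda>i t. u i t - v i t) i s)" by simp
  qed
  from integral_solution_bound[OF this _ t]
  have "vnorm (\<lambda>i t. u i t - v i t) t \<le> 0" by simp
  moreover have "cmod (u i t - v i t) \<le> vnorm (\<lambda>i t. u i t - v i t) t"
    unfolding vnorm_def by (rule member_le_sum) (use i in auto)
  ultimately have "cmod (u i t - v i t) \<le> 0" by (rule order_trans[rotated])
  then show ?thesis by simp
qed

end

section \<open>Regularity and bounds in Sobolev spaces\<close>

locale sobolev_system = sobolev_interval +
  fixes m :: nat and A :: "nat \<Rightarrow> nat \<Rightarrow> real \<Rightarrow> complex" and k :: nat
  assumes A_sobolev: "\<And>i j. i < m \<Longrightarrow> j < m \<Longrightarrow> A i j \<in> Wp k"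

sublocale sobolev_system \<subseteq> linear_system
  by unfold_locales (use Lp_imp_L1 sobolev_in_Lp A_sobolev in blast)

context sobolev_system
begin

definition sum_norm :: "nat \<Rightarrow> (nat \<Rightarrow> real \<Rightarrow> complex) \<Rightarrow> real" where
  "sum_norm l u = (\<Sum>i<m. wnorm l (u i))"

lemma sum_norm_nonneg: "(\<And>i. i < m \<Longrightarrow> u i \<in> Wp l) \<Longrightarrow> 0 \<le> sum_norm l u"
  unfolding sum_norm_def by (intro sum_nonneg sobolev_norm_nonneg) auto

lemma norm_le_sum_norm:
  assumes "\<And>i. i < m \<Longrightarrow> u i \<in> Wp l" "i < m"
  shows "wnorm l (u i) \<le> sum_norm l u"
  unfolding sum_norm_def
  by (rule member_le_sum) (use assms sobolev_norm_nonneg in auto)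

lemma Au_sobolev:
  assumes l: "l \<le> k"
  shows "\<exists>C\<ge>0. \<forall>u. (\<forall>j<m. u j \<in> Wp (max 1 l)) \<longrightarrow>
     (\<forall>i<m. Au u i \<in> Wp l \<and> wnorm l (Au u i) \<le> C * sum_norm (max 1 l) u)"
proof -
  obtain C where C: "C \<ge> 0" "\<forall>f\<in>Wp l. \<forall>h\<in>Wp (max 1 l). (\<lambda>t. f t * h t) \<in> Wp l \<and>
     wnorm l (\<lambda>t. f t * h t) \<le> C * (wnorm l f * wnorm (max 1 l) h)"
    using sobolev_mult by blast
  have Al: "A i j \<in> Wp l" if "i < m" "j < m" for i j
    using sobolev_subset[OF A_sobolev[OF that] l] by simp
  define N where "N = (\<Sum>i<m. \<Sum>j<m. wnorm l (A i j))"
  have N_ge: "wnorm l (A i j) \<le> N" if "i < m" "j < m" for i j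
  proof -
    have "wnorm l (A i j) \<le> (\<Sum>j<m. wnorm l (A i j))"
      by (rule member_le_sum) (use that Al sobolev_norm_nonneg in auto)
    also have "\<dots> \<le> N" unfolding N_def
      by (rule member_le_sum) (use that Al sobolev_norm_nonneg in \<open>auto intro!: sum_nonneg\<close>)
    finally show ?thesis .
  qed
  have N0: "0 \<le> N" unfolding N_def by (intro sum_nonneg sobolev_norm_nonneg Al) auto
  show ?thesis
  proof (intro exI[of _ "4 ^ m * (C * N)"] conjI allI impI)
    show "0 \<le> 4 ^ m * (C * N)" using C(1) N0 by simp
    fix u i assume u: "\<forall>j<m. u j \<in> Wp (max 1 l)" and i: "i < m"
    have pr: "(\<lambda>t. A i j t * u j t) \<in> Wp l"
      "wnorm l (\<lambda>t. A i j t * u j t) \<le> C * N * wnorm (max 1 l) (u j)" if j: "j < m" for j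
    proof -
      have uj: "u j \<in> Wp (max 1 l)" using u j by simp
      have r: "(\<lambda>t. A i j t * u j t) \<in> Wp l"
         "wnorm l (\<lambda>t. A i j t * u j t) \<le> C * (wnorm l (A i j) * wnorm (max 1 l) (u j))"
        using C(2) Al[OF i j] uj by auto
      show "(\<lambda>t. A i j t * u j t) \<in> Wp l" by (rule r)
      have "C * (wnorm l (A i j) * wnorm (max 1 l) (u j))
        \<le> C * (N * wnorm (max 1 l) (u j))"
        by (intro mult_left_mono mult_right_mono N_ge i j C sobolev_norm_nonneg uj)
      with r(2) show "wnorm l (\<lambda>t. A i j t * u j t) \<le> C * N * wnorm (max 1 l) (u j)"
        by (simp add: mult.assoc)
    qed
    have S: "Au u i \<in> Wp l"
      "wnorm l (Au u i) \<le> 4 ^ m * (\<Sum>j<m. wnorm l (\<lambda>t. A i j t * u j t))"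
      using sobolev_sum[of "{..<m}" "\<lambda>j t. A i j t * u j t" l] pr(1) by (auto simp: Au_def[abs_def])
    show "Au u i \<in> Wp l" by (rule S)
    note S(2)
    also have "4 ^ m * (\<Sum>j<m. wnorm l (\<lambda>t. A i j t * u j t))
       \<le> 4 ^ m * (\<Sum>j<m. C * N * wnorm (max 1 l) (u j))"
      by (intro mult_left_mono sum_mono pr(2)) auto
    also have "\<dots> = 4 ^ m * (C * N) * sum_norm (max 1 l) u"
      by (simp add: sum_norm_def sum_distrib_left mult.assoc)
    finally show "wnorm l (Au u i) \<le> 4 ^ m * (C * N) * sum_norm (max 1 l) u" .
  qed
qed

lemma Au_in_sobolev:
  assumes "\<And>j. j < m \<Longrightarrow> u j \<in> Wp (max 1 l)" "i < m" "l \<le> k"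
  shows "Au u i \<in> Wp l"
  using Au_sobolev[OF assms(3)] assms(1,2) by blast

text \<open>The bound by the supremum of u starts the induction over the order: at order 0 the norm of u in
W_p^1, which the product rule for Sobolev functions would require, is the quantity to be
estimated.\<close>

lemma Au_in_Lp:
  assumes c: "\<And>j. j < m \<Longrightarrow> continuous_on {a..b} (u j)" and i: "i < m"
    and le: "\<And>t. t \<in> {a..b} \<Longrightarrow> vnorm u t \<le> S" and S: "0 \<le> S"
  shows "Au u i \<in> LP \<and> pnorm (Au u i) \<le> 4 ^ m * (\<Sum>j<m. S * pnorm (A i j))"
proof -
  have AL: "A i j \<in> LP" if "j < m" for j by (rule sobolev_in_Lp[OF A_sobolev[OF i that]])
  have pr: "(\<lambda>t. A i j t * u j t) \<in> LP \<and> pnorm (\<lambda>t. A i j t * u j t) \<le> S * pnorm (A i j)"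
    if j: "j < m" for j
  proof (rule Lp_dominated[OF AL[OF j] _ S])
    have "u j \<in> borel_measurable M" by (rule continuous_imp_measurable_on_sets_lebesgue[OF c[OF j]]) simp
    then show "(\<lambda>t. A i j t * u j t) \<in> borel_measurable M" using Lp_measurable[OF AL[OF j]] by simp
    show "AE t in M. cmod (A i j t * u j t) \<le> S * cmod (A i j t)"
    proof (rule AE_I2)
      fix t assume t: "t \<in> space M"
      have "cmod (u j t) \<le> vnorm u t" unfolding vnorm_def by (rule member_le_sum) (use j in auto)
      also have "\<dots> \<le> S" using le t by simp
      finally have "cmod (u j t) * cmod (A i j t) \<le> S * cmod (A i j t)" by (intro mult_right_mono) auto
      then show "cmod (A i j t * u j t) \<le> S * cmod (A i j t)" by (simp add: norm_mult mult.commute)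
    qed
  qed
  have "Au u i \<in> LP"
    "pnorm (Au u i) \<le> 4 ^ m * (\<Sum>j<m. pnorm (\<lambda>t. A i j t * u j t))"
    using sobolev_sum[of "{..<m}" "\<lambda>j t. A i j t * u j t" 0] pr
    by (auto simp: Au_def[abs_def] sobolev_0 sobolev_norm_0)
  moreover have "4 ^ m * (\<Sum>j<m. pnorm (\<lambda>t. A i j t * u j t)) \<le> 4 ^ m * (\<Sum>j<m. S * pnorm (A i j))"
    by (intro mult_left_mono sum_mono) (use pr in auto)
  ultimately show ?thesis by linarith
qed

lemma integral_solution_sob_deriv:
  assumes sol: "integral_solution c f u" and g: "(\<lambda>s. f i s - Au u i s) \<in> Wp l" and i: "i < m"
  shows "sob_deriv l (u i) (\<lambda>s. f i s - Au u i s)"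
  by (rule sob_deriv_indefinite_integral[OF g, of _ "c i"]) (use sol i in \<open>auto simp: integral_solution_def\<close>)

text \<open>Bootstrapping: if u has order l \<le> k, then so does f - A u (for l = 0 because u is bounded), and u
has order l + 1 as its indefinite integral.\<close>

lemma integral_solution_regular:
  assumes sol: "integral_solution c f u" and f: "\<And>i. i < m \<Longrightarrow> f i \<in> Wp k" and i: "i < m"
  shows "u i \<in> Wp (Suc k) \<and> sob_deriv k (u i) (\<lambda>s. f i s - Au u i s)"
proof -
  have cu: "continuous_on {a..b} (u j)" if "j < m" for j using sol that by (simp add: integral_solution_def)
  have fl: "f i \<in> Wp l" if "i < m" "l \<le> k" for i l using sobolev_subset[OF f[OF that(1)] that(2)] by simp
  have rhs: "(\<lambda>s. f i s - Au u i s) \<in> Wp l"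
    if "\<And>j. j < m \<Longrightarrow> u j \<in> Wp l" "i < m" "l \<le> k" for i l
  proof (cases "l = 0")
    case True
    have "\<And>t. t \<in> {a..b} \<Longrightarrow> vnorm u t \<le> 2 * (\<Sum>i<m. cmod (c i) + (LINT s|M. cmod (f i s))) * exp (2 * \<phi> b)"
      by (rule integral_solution_bound[OF sol]) (use f Lp_imp_L1 sobolev_in_Lp in blast)
    then have "Au u i \<in> LP"
      using Au_in_Lp[where u=u and i=i and S="2 * (\<Sum>i<m. cmod (c i) + (LINT s|M. cmod (f i s))) * exp (2 * \<phi> b)",
          OF cu that(2)] by (simp add: sum_nonneg integral_nonneg_AE)
    then show ?thesis using sobolev_diff[OF fl[OF that(2,3)], of "Au u i"] True by (simp add: sobolev_0)
  next
    case False
    then have "max 1 l = l" by simp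
    then have "Au u i \<in> Wp l" using Au_in_sobolev[of u l i] that by simp
    then show ?thesis using sobolev_diff[OF fl[OF that(2,3)]] by simp
  qed
  have reg: "\<forall>j<m. u j \<in> Wp l" if "l \<le> Suc k" for l
    using that
  proof (induction l)
    case 0
    then show ?case using continuous_in_Lp[OF cu] by (simp add: sobolev_0)
  next
    case (Suc l)
    then have u: "\<And>j. j < m \<Longrightarrow> u j \<in> Wp l" and l: "l \<le> k" by auto
    show ?case
      using sobolev_SucI[OF integral_solution_sob_deriv[OF sol rhs[OF u _ l]] rhs[OF u _ l]] by auto
  qed
  have "u j \<in> Wp k" if "j < m" for j using reg[of k] that by simp
  from integral_solution_sob_deriv[OF sol rhs[OF this i order_refl] i] reg[of "Suc k"] i show ?thesis by auto
qed

text \<open>The quantitative form of the regularity lemma for zero initial values. The Gronwall bound controls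
the supremum of u by the L_1 norm of f; through u' = f - A u this controls the norm of u in W_p^1,
and each further order costs one application of the bounded product.\<close>

lemma integral_solution_norm_bound:
  "\<exists>C\<ge>0. \<forall>f u. (\<forall>i<m. f i \<in> Wp k) \<and> integral_solution (\<lambda>_. 0) f u \<longrightarrow>
     sum_norm (Suc k) u \<le> C * sum_norm k f"
proof -
  define C1 where "C1 = 2 * (b - a + 1) * exp (2 * \<phi> b)"
  have C1: "C1 \<ge> 0" using ab by (simp add: C1_def)
  have sup: "vnorm u t \<le> C1 * sum_norm k f"
    if f: "\<forall>i<m. f i \<in> Wp k" and sol: "integral_solution (\<lambda>_. 0) f u" and t: "t \<in> {a..b}" for f u t
  proof -
    have L: "f i \<in> LP" if "i < m" for i using f that by (auto intro: sobolev_in_Lp)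
    have "vnorm u t \<le> 2 * (\<Sum>i<m. cmod 0 + (LINT s|M. cmod (f i s))) * exp (2 * \<phi> b)"
      by (rule integral_solution_bound[OF sol _ t]) (use Lp_imp_L1[OF L] in auto)
    moreover have "(\<Sum>i<m. cmod 0 + (LINT s|M. cmod (f i s))) \<le> (\<Sum>i<m. (b - a + 1) * wnorm k (f i))"
    proof (rule sum_mono)
      fix i assume "i \<in> {..<m}"
      then have i: "i < m" by simp
      have "pnorm (f i) \<le> wnorm k (f i)"
        using sobolev_subset[of "f i" k 0] f i by (simp add: sobolev_norm_0)
      then have "(b - a + 1) * pnorm (f i) \<le> (b - a + 1) * wnorm k (f i)"
        using ab by (intro mult_left_mono) auto
      then show "cmod 0 + (LINT s|M. cmod (f i s)) \<le> (b - a + 1) * wnorm k (f i)"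
        using Lp_imp_L1[OF L[OF i]] by simp
    qed
    then have "2 * (\<Sum>i<m. cmod 0 + (LINT s|M. cmod (f i s))) * exp (2 * \<phi> b)
        \<le> 2 * ((b - a + 1) * sum_norm k f) * exp (2 * \<phi> b)"
      by (intro mult_right_mono mult_left_mono) (auto simp: sum_norm_def sum_distrib_left)
    ultimately show ?thesis unfolding C1_def by (simp only: mult_ac)
  qed
  have main: "\<exists>C\<ge>0. \<forall>f u. (\<forall>i<m. f i \<in> Wp k) \<and> integral_solution (\<lambda>_. 0) f u \<longrightarrow>
     (\<forall>i<m. wnorm l (u i) \<le> C * sum_norm k f)" if "1 \<le> l" "l \<le> Suc k" for l :: nat
    using that
  proof (induction l rule: dec_induct)
    (* order 1, from the Gronwall bound for the supremum *)
    case base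
    define N where "N = (\<Sum>i<m. \<Sum>j<m. pnorm (A i j))"
    define K1 where "K1 = pnorm (\<lambda>_. 1)"
    have AL: "A i j \<in> LP" if "i < m" "j < m" for i j by (rule sobolev_in_Lp[OF A_sobolev[OF that]])
    have N0: "0 \<le> N" unfolding N_def by (intro sum_nonneg Lp_norm_nonneg AL) auto
    have K1: "0 \<le> K1" unfolding K1_def by (rule Lp_norm_nonneg[OF one_in_Lp])
    show ?case
    proof (intro exI[of _ "C1 * K1 + 4 * (1 + 4 ^ m * (C1 * N))"] conjI allI impI)
      show "0 \<le> C1 * K1 + 4 * (1 + 4 ^ m * (C1 * N))" using C1 K1 N0 by simp
      fix f u i
      assume fu: "(\<forall>i<m. f i \<in> Wp k) \<and> integral_solution (\<lambda>_. 0) f u" and i: "i < m"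
      define F where "F = sum_norm k f"
      have f: "f i \<in> Wp k" if "i < m" for i using fu that by simp
      have sol: "integral_solution (\<lambda>_. 0) f u" using fu by simp
      have F0: "0 \<le> F" unfolding F_def by (rule sum_norm_nonneg) (rule f)
      have C1F: "0 \<le> C1 * F" using C1 F0 by simp
      have vb: "vnorm u t \<le> C1 * F" if "t \<in> {a..b}" for t using sup that fu by (simp add: F_def)
      have cu: "continuous_on {a..b} (u j)" if "j < m" for j using sol that by (simp add: integral_solution_def)
      have um: "u i \<in> borel_measurable M" by (rule continuous_imp_measurable_on_sets_lebesgue[OF cu[OF i]]) simp
      have "cmod (u i t) \<le> C1 * F" if "t \<in> {a..b}" for t
      proof -
        have "cmod (u i t) \<le> vnorm u t" unfolding vnorm_def by (rule member_le_sum) (use i in auto)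
        then show ?thesis using vb[OF that] by simp
      qed
      from bounded_in_Lp[OF um C1F this] have b1: "pnorm (u i) \<le> C1 * K1 * F" by (simp add: K1_def mult_ac)
      have AuL: "Au u i \<in> LP" "pnorm (Au u i) \<le> 4 ^ m * (\<Sum>j<m. C1 * F * pnorm (A i j))"
        using Au_in_Lp[where u=u and i=i and S="C1 * F", OF cu i vb C1F] by auto
      have "(\<Sum>j<m. pnorm (A i j)) \<le> N" unfolding N_def
        by (rule member_le_sum) (use i AL Lp_norm_nonneg in \<open>auto intro!: sum_nonneg\<close>)
      then have "C1 * F * (\<Sum>j<m. pnorm (A i j)) \<le> C1 * F * N" using C1F by (rule mult_left_mono)
      then have "4 ^ m * (C1 * F * (\<Sum>j<m. pnorm (A i j))) \<le> 4 ^ m * (C1 * F * N)"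
        by (rule mult_left_mono) simp
      with AuL(2) have b2: "pnorm (Au u i) \<le> 4 ^ m * (C1 * N) * F"
        by (simp only: sum_distrib_left[symmetric] mult_ac)
      have fi0: "f i \<in> Wp 0" "wnorm 0 (f i) \<le> F"
        using sobolev_subset[OF f[OF i], of 0] norm_le_sum_norm[of f k i, OF f i] by (auto simp: F_def)
      have rhs: "(\<lambda>s. f i s - Au u i s) \<in> Wp 0"
        "wnorm 0 (\<lambda>s. f i s - Au u i s) \<le> 4 * (F + 4 ^ m * (C1 * N) * F)"
        using sobolev_diff[OF fi0(1), of "Au u i"] AuL(1) fi0(2) b2 by (auto simp: sobolev_0 sobolev_norm_0)
      have "wnorm 1 (u i) = pnorm (u i) + wnorm 0 (\<lambda>s. f i s - Au u i s)"
        using sobolev_SucI[OF integral_solution_sob_deriv[OF sol rhs(1) i] rhs(1)] by simp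
      also have "\<dots> \<le> C1 * K1 * F + 4 * (F + 4 ^ m * (C1 * N) * F)" using b1 rhs(2) by simp
      finally show "wnorm 1 (u i) \<le> (C1 * K1 + 4 * (1 + 4 ^ m * (C1 * N))) * sum_norm k f"
        by (simp add: F_def algebra_simps)
    qed
  next
    case (step l)
    then have l: "l \<le> k" "max 1 l = l" by auto
    from step obtain C where C: "C \<ge> 0"
      "\<forall>f u. (\<forall>i<m. f i \<in> Wp k) \<and> integral_solution (\<lambda>_. 0) f u \<longrightarrow>
         (\<forall>i<m. wnorm l (u i) \<le> C * sum_norm k f)" by auto
    from Au_sobolev[OF l(1)] obtain CA where CA: "CA \<ge> 0"
      "\<forall>u. (\<forall>j<m. u j \<in> Wp l) \<longrightarrow>
        (\<forall>i<m. Au u i \<in> Wp l \<and> wnorm l (Au u i) \<le> CA * sum_norm l u)"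
      unfolding l(2) by blast
    show ?case
    proof (intro exI[of _ "C + 4 * (1 + CA * (real m * C))"] conjI allI impI)
      show "0 \<le> C + 4 * (1 + CA * (real m * C))" using C(1) CA(1) by simp
      fix f u i
      assume fu: "(\<forall>i<m. f i \<in> Wp k) \<and> integral_solution (\<lambda>_. 0) f u" and i: "i < m"
      define F where "F = sum_norm k f"
      have f: "f i \<in> Wp k" if "i < m" for i using fu that by simp
      have sol: "integral_solution (\<lambda>_. 0) f u" using fu by simp
      have u: "u j \<in> Wp l" if "j < m" for j
        using integral_solution_regular[OF sol f that] sobolev_subset[of "u j" "Suc k" l] l(1) by simp
      have ub: "wnorm l (u j) \<le> C * F" if "j < m" for j using C(2) fu that by (simp add: F_def)
      have "sum_norm l u \<le> (\<Sum>j<m. C * F)" unfolding sum_norm_def by (rule sum_mono) (use ub in auto)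
      then have sb: "CA * sum_norm l u \<le> CA * (real m * C) * F"
        using CA(1) mult_left_mono by (fastforce simp: mult.assoc)
      have fl: "f i \<in> Wp l" "wnorm l (f i) \<le> F"
        using sobolev_subset[OF f[OF i] l(1)] norm_le_sum_norm[of f k i, OF f i] by (auto simp: F_def)
      have "Au u i \<in> Wp l \<and> wnorm l (Au u i) \<le> CA * sum_norm l u"
        using CA(2) u i by simp
      then have Ai: "Au u i \<in> Wp l" "wnorm l (Au u i) \<le> CA * (real m * C) * F"
        using sb by auto
      have rhs: "(\<lambda>s. f i s - Au u i s) \<in> Wp l"
        "wnorm l (\<lambda>s. f i s - Au u i s) \<le> 4 * (F + CA * (real m * C) * F)"
        using sobolev_diff[OF fl(1) Ai(1)] fl(2) Ai(2) by auto
      have "pnorm (u i) \<le> C * F"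
        using sobolev_subset[OF u[OF i], of 0] ub[OF i] by (simp add: sobolev_norm_0)
      moreover have "wnorm (Suc l) (u i) = pnorm (u i) + wnorm l (\<lambda>s. f i s - Au u i s)"
        using sobolev_SucI[OF integral_solution_sob_deriv[OF sol rhs(1) i] rhs(1)] by simp
      ultimately have "wnorm (Suc l) (u i) \<le> C * F + 4 * (F + CA * (real m * C) * F)" using rhs(2) by simp
      then show "wnorm (Suc l) (u i) \<le> (C + 4 * (1 + CA * (real m * C))) * sum_norm k f"
        by (simp add: F_def algebra_simps)
    qed
  qed
  from main[of "Suc k"] obtain C where C: "C \<ge> 0"
      "\<forall>f u. (\<forall>i<m. f i \<in> Wp k) \<and> integral_solution (\<lambda>_. 0) f u \<longrightarrow>
         (\<forall>i<m. wnorm (Suc k) (u i) \<le> C * sum_norm k f)" by auto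
  show ?thesis
  proof (intro exI[of _ "real m * C"] conjI allI impI)
    show "0 \<le> real m * C" using C(1) by simp
    fix f u assume "(\<forall>i<m. f i \<in> Wp k) \<and> integral_solution (\<lambda>_. 0) f u"
    then have "wnorm (Suc k) (u i) \<le> C * sum_norm k f" if "i < m" for i using C(2) that by blast
    then have "sum_norm (Suc k) u \<le> (\<Sum>i<m. C * sum_norm k f)" unfolding sum_norm_def[of "Suc k"] by (intro sum_mono) auto
    then show "sum_norm (Suc k) u \<le> real m * C * sum_norm k f" by (simp add: mult.assoc)
  qed
qed

text \<open>The fundamental theorem for absolutely continuous functions turns the almost everywhere form of
the differential equation into the integral equation.\<close>

lemma integral_solution_of_sobolev:
  assumes u: "\<And>i. i < m \<Longrightarrow> u i \<in> Wp (Suc k)"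
    and eq: "\<And>i. i < m \<Longrightarrow> AE t in M. D (u i) t + Au u i t = f i t"
  shows "integral_solution (\<lambda>i. u i a) f u"
  unfolding integral_solution_def
proof (intro allI impI conjI ballI)
  fix i assume i: "i < m"
  show "continuous_on {a..b} (u i)" by (rule sobolev_Suc_continuous[OF u[OF i]])
  fix t assume t: "t \<in> {a..b}"
  have a: "a \<in> {a..b}" "a \<le> t" using ab t by auto
  have "(D (u i) has_integral (u i t - u i a)) {a..t}"
    by (rule sob_deriv_has_integral[OF sobolev_SucE(1)[OF u[OF i]] a(1) t a(2)])
  then have "((\<lambda>s. f i s - Au u i s) has_integral (u i t - u i a)) {a..t}"
  proof (rule has_integral_spike[OF AE_lebesgue_on_negligible[OF eq[OF i]], rotated])
    fix s assume "s \<in> {a..t} - {t \<in> {a..b}. \<not> (D (u i) t + Au u i t = f i t)}"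
    then have "D (u i) s + Au u i s = f i s" using t by auto
    then show "f i s - Au u i s = D (u i) s" by (metis add_diff_cancel_right')
  qed
  then show "u i t = u i a + integral {a..t} (\<lambda>s. f i s - Au u i s)" by (simp add: integral_unique)
qed

lemma integral_solution_AE:
  assumes sol: "integral_solution c f u" and f: "\<And>i. i < m \<Longrightarrow> f i \<in> Wp k" and i: "i < m"
  shows "AE t in M. D (u i) t + Au u i t = f i t"
proof -
  have "sob_deriv k (u i) (\<lambda>s. f i s - Au u i s)" using integral_solution_regular[OF sol f i] by simp
  from sob_deriv_AE_eq[OF this] show ?thesis by eventually_elim simp
qed

end

section \<open>Matrices and finite-dimensional vectors\<close>

text \<open>P * Q and Q * P have the same trace, which is r for the one and m for the other.\<close>

lemma mat_inverse_imp_dims_eq: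
  fixes P Q :: "complex mat"
  assumes P: "P \<in> carrier_mat r m" and Q: "Q \<in> carrier_mat m r" and PQ: "P * Q = 1\<^sub>m r" and QP: "Q * P = 1\<^sub>m m"
  shows "r = m"
proof -
  have "(\<Sum>i<r. (P * Q) $$ (i, i)) = (\<Sum>i<r. \<Sum>j<m. P $$ (i, j) * Q $$ (j, i))"
    using P Q by (intro sum.cong) (auto simp: scalar_prod_def atLeast0LessThan)
  also have "\<dots> = (\<Sum>j<m. \<Sum>i<r. Q $$ (j, i) * P $$ (i, j))"
    by (subst sum.swap) (simp add: mult.commute)
  also have "\<dots> = (\<Sum>j<m. (Q * P) $$ (j, j))"
    using P Q by (intro sum.cong) (auto simp: scalar_prod_def atLeast0LessThan)
  finally have "complex_of_nat r = complex_of_nat m" unfolding PQ QP by simp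
  then show ?thesis by simp
qed

lemma vec_eq_of_diff_zero:
  fixes v w :: "complex vec"
  assumes "v \<in> carrier_vec m" "w \<in> carrier_vec m" "v - w = 0\<^sub>v m"
  shows "v = w"
proof (rule eq_vecI)
  fix i assume i: "i < dim_vec w"
  then have "(v - w) $ i = 0" using assms by simp
  then show "v $ i = w $ i" using i by simp
qed (use assms in simp)

text \<open>Preimages of the unit vectors are the columns of a right inverse Q; injectivity makes it a left
inverse as well, since P (Q P x - x) = 0.\<close>

lemma mat_bijective_imp_square_invertible:
  fixes P :: "complex mat"
  assumes P: "P \<in> carrier_mat r m"
    and surj: "\<And>c. c \<in> carrier_vec r \<Longrightarrow> \<exists>q\<in>carrier_vec m. P *\<^sub>v q = c"
    and inj: "\<And>q. q \<in> carrier_vec m \<Longrightarrow> P *\<^sub>v q = 0\<^sub>v r \<Longrightarrow> q = 0\<^sub>v m"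
  shows "r = m \<and> det P \<noteq> 0"
proof -
  have "\<forall>i. \<exists>q. q \<in> carrier_vec m \<and> P *\<^sub>v q = unit_vec r i" using surj by (metis unit_vec_carrier)
  then obtain g where g: "\<And>i. g i \<in> carrier_vec m" "\<And>i. P *\<^sub>v g i = unit_vec r i" by metis
  define Q where "Q = mat_of_cols m (map g [0..<r])"
  have Q: "Q \<in> carrier_mat m r" unfolding Q_def using mat_of_cols_carrier(1)[of m "map g [0..<r]"] by simp
  have colQ: "col Q i = g i" if "i < r" for i unfolding Q_def using that g(1) by simp
  have PQ: "P * Q = 1\<^sub>m r"
  proof (rule mat_col_eqI)
    fix i assume "i < dim_col (1\<^sub>m r :: complex mat)"
    then have i: "i < r" by simp
    show "col (P * Q) i = col (1\<^sub>m r) i" using col_mult2[OF P Q i] colQ[OF i] g(2) i by simp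
  qed (use P Q in auto)
  have QP: "Q * P = 1\<^sub>m m"
  proof (rule mat_col_eqI)
    fix j assume "j < dim_col (1\<^sub>m m :: complex mat)"
    then have j: "j < m" by simp
    have cj: "col P j \<in> carrier_vec r" using P j by auto
    have Qc: "Q *\<^sub>v col P j \<in> carrier_vec m" using Q cj by auto
    have u: "unit_vec m j \<in> carrier_vec m" by simp
    have "P *\<^sub>v (Q *\<^sub>v col P j - unit_vec m j) = P *\<^sub>v (Q *\<^sub>v col P j) - P *\<^sub>v unit_vec m j"
      by (rule mult_minus_distrib_mat_vec[OF P Qc u])
    also have "P *\<^sub>v (Q *\<^sub>v col P j) = (P * Q) *\<^sub>v col P j" using assoc_mult_mat_vec[OF P Q cj] by simp
    also have "\<dots> = col P j" using PQ cj by simp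
    also have "P *\<^sub>v unit_vec m j = col P j"
      using P j by (intro eq_vecI) auto
    also have "col P j - col P j = 0\<^sub>v r" using cj by simp
    finally have "Q *\<^sub>v col P j - unit_vec m j = 0\<^sub>v m" by (intro inj) (use Qc in auto)
    then have "Q *\<^sub>v col P j = unit_vec m j" by (rule vec_eq_of_diff_zero[OF Qc u])
    then show "col (Q * P) j = col (1\<^sub>m m) j" using col_mult2[OF Q P j] j by simp
  qed (use P Q in auto)
  have rm: "r = m" by (rule mat_inverse_imp_dims_eq[OF P Q PQ QP])
  have "det P * det Q = 1" using det_mult[of P r Q] P Q PQ rm by simp
  then show ?thesis using rm by auto
qed

lemma det_nonzero_imp_inverse:
  fixes P :: "complex mat"
  assumes P: "P \<in> carrier_mat m m" and d: "det P \<noteq> 0"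
  obtains Q where "Q \<in> carrier_mat m m" "P * Q = 1\<^sub>m m" "Q * P = 1\<^sub>m m"
  using det_non_zero_imp_unit[OF P d, of "()"] unfolding Units_def by (auto simp: ring_mat_def)

lemma mult_mat_vec_index_sum:
  fixes P :: "complex mat"
  assumes "P \<in> carrier_mat r m" "v \<in> carrier_vec m" "i < r"
  shows "(P *\<^sub>v v) $ i = (\<Sum>j<m. P $$ (i, j) * v $ j)"
  using assms by (simp add: scalar_prod_def atLeast0LessThan)

lemma cvec_norm_nonneg: "0 \<le> cvec_norm v"
  unfolding cvec_norm_def by (intro sum_nonneg) auto

lemma cmod_index_le_cvec_norm: "i < dim_vec v \<Longrightarrow> cmod (v $ i) \<le> cvec_norm v"
  unfolding cvec_norm_def by (rule member_le_sum) auto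

lemma cvec_norm_diff_le:
  assumes "v \<in> carrier_vec m" "w \<in> carrier_vec m"
  shows "cvec_norm (v - w) \<le> cvec_norm v + cvec_norm w"
proof -
  have "cvec_norm (v - w) = (\<Sum>i<m. cmod (v $ i - w $ i))" using assms by (simp add: cvec_norm_def)
  also have "\<dots> \<le> (\<Sum>i<m. cmod (v $ i) + cmod (w $ i))" by (intro sum_mono norm_triangle_ineq4)
  also have "\<dots> = cvec_norm v + cvec_norm w" using assms by (simp add: cvec_norm_def sum.distrib)
  finally show ?thesis .
qed

lemma cvec_norm_mult_mat_vec_le:
  assumes P: "P \<in> carrier_mat r m"
  shows "\<exists>C\<ge>0. \<forall>v\<in>carrier_vec m. cvec_norm (P *\<^sub>v v) \<le> C * cvec_norm v"
proof (intro exI[of _ "\<Sum>i<r. \<Sum>j<m. cmod (P $$ (i, j))"] conjI ballI)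
  show "0 \<le> (\<Sum>i<r. \<Sum>j<m. cmod (P $$ (i, j)))" by (intro sum_nonneg) auto
  fix v :: "complex vec" assume v: "v \<in> carrier_vec m"
  have "cvec_norm (P *\<^sub>v v) = (\<Sum>i<r. cmod (\<Sum>j<m. P $$ (i, j) * v $ j))"
    unfolding cvec_norm_def using P by (intro sum.cong) (auto simp: mult_mat_vec_index_sum[OF P v] simp del: index_mult_mat_vec)
  also have "\<dots> \<le> (\<Sum>i<r. \<Sum>j<m. cmod (P $$ (i, j)) * cvec_norm v)"
  proof (intro sum_mono order_trans[OF norm_sum])
    fix i j assume "j \<in> {..<m}"
    then show "cmod (P $$ (i, j) * v $ j) \<le> cmod (P $$ (i, j)) * cvec_norm v"
      unfolding norm_mult using v by (intro mult_left_mono cmod_index_le_cvec_norm) auto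
  qed
  also have "\<dots> = (\<Sum>i<r. \<Sum>j<m. cmod (P $$ (i, j))) * cvec_norm v" by (simp add: sum_distrib_right)
  finally show "cvec_norm (P *\<^sub>v v) \<le> \<dots>" .
qed

section \<open>The boundary-value problem\<close>

abbreviation entries :: "(real \<Rightarrow> complex vec) \<Rightarrow> nat \<Rightarrow> real \<Rightarrow> complex" where
  "entries y \<equiv> (\<lambda>i t. y t $ i)"

context linear_system
begin

lemma integral_solution_cong:
  assumes sol: "integral_solution c f u"
    and c: "\<And>i. i < m \<Longrightarrow> c i = c' i"
    and f: "\<And>i t. i < m \<Longrightarrow> t \<in> {a..b} \<Longrightarrow> f i t = f' i t"
    and u: "\<And>i t. i < m \<Longrightarrow> t \<in> {a..b} \<Longrightarrow> u i t = u' i t"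
  shows "integral_solution c' f' u'"
  unfolding integral_solution_def
proof (intro allI impI conjI ballI)
  fix i assume i: "i < m"
  have "continuous_on {a..b} (u i)" using sol i by (simp add: integral_solution_def)
  then show "continuous_on {a..b} (u' i)" using continuous_on_cong[of "{a..b}" "{a..b}" "u i" "u' i"] u[OF i] by simp
  fix t assume t: "t \<in> {a..b}"
  have "integral {a..t} (\<lambda>s. f i s - Au u i s) = integral {a..t} (\<lambda>s. f' i s - Au u' i s)"
    by (rule integral_cong) (use f[OF i] u t in \<open>simp add: Au_def\<close>)
  then show "u' i t = c' i + integral {a..t} (\<lambda>s. f' i s - Au u' i s)"
    using sol i t c[OF i] u[OF i t] by (simp add: integral_solution_def)
qed

lemma integral_solution_lincomb:
  assumes u: "integral_solution c f u" and v: "integral_solution d g v"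
    and f: "\<And>i. i < m \<Longrightarrow> integrable M (f i)" and g: "\<And>i. i < m \<Longrightarrow> integrable M (g i)"
  shows "integral_solution (\<lambda>i. c i + z * d i) (\<lambda>i t. f i t + z * g i t) (\<lambda>i t. u i t + z * v i t)"
  unfolding integral_solution_def
proof (intro allI impI conjI ballI)
  fix i assume i: "i < m"
  have cu: "continuous_on {a..b} (u j)" and cv: "continuous_on {a..b} (v j)" if "j < m" for j
    using u v that by (auto simp: integral_solution_def)
  show "continuous_on {a..b} (\<lambda>t. u i t + z * v i t)" by (intro continuous_intros cu cv i)
  fix t assume t: "t \<in> {a..b}"
  then have sub: "{a..t} \<subseteq> {a..b}" by auto
  have 1: "(\<lambda>s. f i s - Au u i s) integrable_on {a..t}"
    by (rule L1_imp_integrable_on[OF Bochner_Integration.integrable_diff[OF f[OF i] Au_integrable[OF cu i]] sub])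
  have 2: "(\<lambda>s. g i s - Au v i s) integrable_on {a..t}"
    by (rule L1_imp_integrable_on[OF Bochner_Integration.integrable_diff[OF g[OF i] Au_integrable[OF cv i]] sub])
  have "integral {a..t} (\<lambda>s. (f i s - Au u i s) + z * (g i s - Au v i s))
      = integral {a..t} (\<lambda>s. f i s - Au u i s) + z * integral {a..t} (\<lambda>s. g i s - Au v i s)"
    using integral_add[OF 1 integrable_on_mult_right[OF 2]] by (simp only: integral_mult_right)
  moreover have "(\<lambda>s. (f i s - Au u i s) + z * (g i s - Au v i s))
      = (\<lambda>s. f i s + z * g i s - Au (\<lambda>i t. u i t + z * v i t) i s)"
    by (rule ext) (simp add: Au_def distrib_left right_diff_distrib sum.distrib sum_distrib_left mult_ac)
  ultimately show "u i t + z * v i t = c i + z * d i + integral {a..t} (\<lambda>s. f i s + z * g i s - Au (\<lambda>i t. u i t + z * v i t) i s)"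
    using u v i t by (simp add: integral_solution_def distrib_left)
qed

end

lemma (in sobolev_system) sum_norm_cong:
  assumes "\<And>i t. i < m \<Longrightarrow> t \<in> {a..b} \<Longrightarrow> u i t = v i t" "\<And>i. i < m \<Longrightarrow> u i \<in> Wp l"
  shows "sum_norm l v = sum_norm l u"
  unfolding sum_norm_def by (rule sum.cong) (use sobolev_cong[OF assms(1) assms(2)] in auto)

lemma (in sobolev_system) sum_norm_add:
  assumes "\<And>i. i < m \<Longrightarrow> u i \<in> Wp l" "\<And>i. i < m \<Longrightarrow> v i \<in> Wp l"
  shows "sum_norm l (\<lambda>i t. u i t + v i t) \<le> 4 * (sum_norm l u + sum_norm l v)"
proof -
  have "sum_norm l (\<lambda>i t. u i t + v i t) \<le> (\<Sum>i<m. 4 * (wnorm l (u i) + wnorm l (v i)))"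
    unfolding sum_norm_def by (rule sum_mono) (use sobolev_add assms in auto)
  then show ?thesis by (simp add: sum_norm_def sum_distrib_left sum.distrib distrib_left)
qed

locale boundary_problem = sobolev_system p a b m "\<lambda>i j t. A t $$ (i, j)" k
  for p :: ennreal and a b :: real and m :: nat and A :: "real \<Rightarrow> complex mat" and k :: nat +
  fixes r :: nat and B :: "(real \<Rightarrow> complex vec) \<Rightarrow> complex vec"
  assumes A_carrier: "\<And>t. t \<in> {a..b} \<Longrightarrow> A t \<in> carrier_mat m m"
    and B_op: "continuous_linear_op p a b (Suc k) m r B"
begin

abbreviation "W \<equiv> sobolev_vec p a b (Suc k) m"
abbreviation "V \<equiv> sobolev_vec p a b k m"
abbreviation "L \<equiv> diff_op a b m A"
abbreviation "Wnorm \<equiv> sobolev_vec_norm p a b (Suc k) m"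

definition vec_fun :: "(nat \<Rightarrow> real \<Rightarrow> complex) \<Rightarrow> real \<Rightarrow> complex vec" where
  "vec_fun u t = vec m (\<lambda>i. u i t)"

lemma sobolev_vec_carrier: "y \<in> sobolev_vec p a b l m \<Longrightarrow> t \<in> {a..b} \<Longrightarrow> y t \<in> carrier_vec m"
  by (simp add: sobolev_vec_def)

lemma sobolev_vec_entries: "y \<in> sobolev_vec p a b l m \<Longrightarrow> i < m \<Longrightarrow> entries y i \<in> Wp l"
  by (simp add: sobolev_vec_def)

lemma sobolev_vecI:
  assumes "\<And>t. t \<in> {a..b} \<Longrightarrow> y t \<in> carrier_vec m"
    and "\<And>i t. i < m \<Longrightarrow> t \<in> {a..b} \<Longrightarrow> y t $ i = u i t" and "\<And>i. i < m \<Longrightarrow> u i \<in> Wp l"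
  shows "y \<in> sobolev_vec p a b l m"
proof -
  have "entries y i \<in> Wp l" if i: "i < m" for i
    using sobolev_cong[of "u i" "entries y i" l] assms(2)[OF i] assms(3)[OF i] by simp
  then show ?thesis using assms(1) by (simp add: sobolev_vec_def)
qed

lemma vec_fun_in_sobolev_vec:
  "(\<And>i. i < m \<Longrightarrow> u i \<in> Wp l) \<Longrightarrow> vec_fun u \<in> sobolev_vec p a b l m"
  by (rule sobolev_vecI[where u=u]) (auto simp: vec_fun_def)

lemma sobolev_vec_norm_eq: "sobolev_vec_norm p a b l m y = sum_norm l (entries y)"
  by (simp add: sobolev_vec_norm_def sum_norm_def)

lemma sobolev_vec_add:
  assumes "u \<in> sobolev_vec p a b l m" "v \<in> sobolev_vec p a b l m"
  shows "(\<lambda>t. u t + v t) \<in> sobolev_vec p a b l m"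
proof (rule sobolev_vecI[where u="\<lambda>i t. u t $ i + v t $ i"])
  show "u t + v t \<in> carrier_vec m" if "t \<in> {a..b}" for t
    using sobolev_vec_carrier[OF assms(1) that] sobolev_vec_carrier[OF assms(2) that] by simp
  show "(u t + v t) $ i = u t $ i + v t $ i" if "i < m" "t \<in> {a..b}" for i t
    using sobolev_vec_carrier[OF assms(2) that(2)] that(1) by simp
  show "(\<lambda>t. u t $ i + v t $ i) \<in> Wp l" if "i < m" for i
    using sobolev_add sobolev_vec_entries[OF assms(1) that] sobolev_vec_entries[OF assms(2) that] by blast
qed

lemma sobolev_vec_smult:
  assumes "u \<in> sobolev_vec p a b l m"
  shows "(\<lambda>t. z \<cdot>\<^sub>v u t) \<in> sobolev_vec p a b l m"
proof (rule sobolev_vecI[where u="\<lambda>i t. z * u t $ i"])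
  show "z \<cdot>\<^sub>v u t \<in> carrier_vec m" if "t \<in> {a..b}" for t
    using sobolev_vec_carrier[OF assms(1) that] by simp
  show "(z \<cdot>\<^sub>v u t) $ i = z * u t $ i" if "i < m" "t \<in> {a..b}" for i t
    using sobolev_vec_carrier[OF assms(1) that(2)] that(1) by simp
  show "(\<lambda>t. z * u t $ i) \<in> Wp l" if "i < m" for i
    using sobolev_cmult sobolev_vec_entries[OF assms(1) that] by blast
qed

lemma sobolev_vec_diff:
  assumes "u \<in> sobolev_vec p a b l m" "v \<in> sobolev_vec p a b l m"
  shows "(\<lambda>t. u t - v t) \<in> sobolev_vec p a b l m"
proof (rule sobolev_vecI[where u="\<lambda>i t. u t $ i - v t $ i"])
  show "u t - v t \<in> carrier_vec m" if "t \<in> {a..b}" for t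
    using sobolev_vec_carrier[OF assms(1) that] sobolev_vec_carrier[OF assms(2) that] by simp
  show "(u t - v t) $ i = u t $ i - v t $ i" if "i < m" "t \<in> {a..b}" for i t
    using sobolev_vec_carrier[OF assms(2) that(2)] that(1) by simp
  show "(\<lambda>t. u t $ i - v t $ i) \<in> Wp l" if "i < m" for i
    using sobolev_diff sobolev_vec_entries[OF assms(1) that] sobolev_vec_entries[OF assms(2) that] by blast
qed

lemma L_index:
  assumes "y t \<in> carrier_vec m" "t \<in> {a..b}" "i < m"
  shows "L y t $ i = D (entries y i) t + Au (entries y) i t"
  using assms A_carrier[OF assms(2)] mult_mat_vec_index_sum[OF A_carrier[OF assms(2)] assms(1,3)]
  by (simp add: diff_op_def Au_def del: index_mult_mat_vec)

lemma L_carrier: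
  assumes "t \<in> {a..b}"
  shows "L y t \<in> carrier_vec m"
  using A_carrier[OF assms] by (intro carrier_vecI) (simp add: diff_op_def)

lemma L_in_V:
  assumes y: "y \<in> W"
  shows "L y \<in> V"
proof (rule sobolev_vecI[where u="\<lambda>i t. D (entries y i) t + Au (entries y) i t"])
  show "L y t \<in> carrier_vec m" if "t \<in> {a..b}" for t by (rule L_carrier[OF that])
  show "L y t $ i = D (entries y i) t + Au (entries y) i t" if "i < m" "t \<in> {a..b}" for i t
    by (rule L_index[of y t i, OF sobolev_vec_carrier[OF y that(2)] that(2,1)])
  fix i assume i: "i < m"
  have e: "entries y j \<in> Wp (Suc k)" if "j < m" for j by (rule sobolev_vec_entries[OF y that])
  have "entries y j \<in> Wp (max 1 k)" if "j < m" for j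
    using sobolev_subset[OF e[OF that], of "max 1 k"] by simp
  then have "Au (entries y) i \<in> Wp k" by (intro Au_in_sobolev i) auto
  then show "(\<lambda>t. D (entries y i) t + Au (entries y) i t) \<in> Wp k"
    using sobolev_add[OF sobolev_SucE(2)[OF e[OF i]]] by blast
qed

lemma entries_integrable: "f \<in> V \<Longrightarrow> i < m \<Longrightarrow> integrable M (entries f i)"
  using Lp_imp_L1[OF sobolev_in_Lp[OF sobolev_vec_entries]] by blast

text \<open>This lemma and the next one identify the solutions of L y = f in W with those of the integral
equation; uniqueness, bounds and superposition are then taken from the latter.\<close>

lemma L_eq_imp_integral_solution:
  assumes y: "y \<in> W" and eq: "AE t in M. L y t = f t"
  shows "integral_solution (\<lambda>i. y a $ i) (entries f) (entries y)"
proof (rule integral_solution_of_sobolev)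
  show "entries y i \<in> Wp (Suc k)" if "i < m" for i by (rule sobolev_vec_entries[OF y that])
  fix i assume i: "i < m"
  show "AE t in M. D (entries y i) t + Au (entries y) i t = f t $ i"
    using eq AE_space
  proof eventually_elim
    case (elim t)
    then have t: "t \<in> {a..b}" by simp
    show ?case using L_index[of y t i, OF sobolev_vec_carrier[OF y t] t i] elim(1) by simp
  qed
qed

lemma integral_solution_imp_L_eq:
  assumes y: "y \<in> W" and f: "f \<in> V" and sol: "integral_solution c (entries f) (entries y)"
  shows "AE t in M. L y t = f t"
proof -
  have "AE t in M. \<forall>i\<in>{..<m}. D (entries y i) t + Au (entries y) i t = f t $ i"
    by (rule AE_finite_allI) (use integral_solution_AE[OF sol sobolev_vec_entries[OF f]] in auto)
  then show ?thesis using AE_space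
  proof eventually_elim
    case (elim t)
    then have t: "t \<in> {a..b}" by simp
    show ?case
    proof (rule eq_vecI)
      show "dim_vec (L y t) = dim_vec (f t)" using L_carrier[OF t, of y] sobolev_vec_carrier[OF f t] by simp
      fix i assume "i < dim_vec (f t)"
      then have i: "i < m" using sobolev_vec_carrier[OF f t] by simp
      show "L y t $ i = f t $ i" using L_index[of y t i, OF sobolev_vec_carrier[OF y t] t i] elim(1) i by simp
    qed
  qed
qed

lemma solution_exists:
  assumes f: "f \<in> V"
  shows "\<exists>y\<in>W. (AE t in M. L y t = f t) \<and> integral_solution (\<lambda>i. c i) (entries f) (entries y)"
proof -
  obtain u where u: "integral_solution c (entries f) u"
    using integral_solution_exists[of "entries f" c, OF entries_integrable[OF f]] by blast
  have "u i \<in> Wp (Suc k)" if "i < m" for i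
    using integral_solution_regular[OF u sobolev_vec_entries[OF f] that] by simp
  then have y: "vec_fun u \<in> W" by (rule vec_fun_in_sobolev_vec)
  have sol: "integral_solution c (entries f) (entries (vec_fun u))"
    by (rule integral_solution_cong[OF u]) (auto simp: vec_fun_def)
  show ?thesis using y sol integral_solution_imp_L_eq[OF y f sol] by blast
qed

lemma integral_solution_vec_unique:
  assumes y: "y \<in> W" and z: "z \<in> W" and f: "f \<in> V"
    and "integral_solution c (entries f) (entries y)" "integral_solution c (entries f) (entries z)"
    and t: "t \<in> {a..b}"
  shows "y t = z t"
proof (rule eq_vecI)
  show "dim_vec (y t) = dim_vec (z t)" using sobolev_vec_carrier[OF y t] sobolev_vec_carrier[OF z t] by simp
  fix i assume "i < dim_vec (z t)"
  then have i: "i < m" using sobolev_vec_carrier[OF z t] by simp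
  show "y t $ i = z t $ i" by (rule integral_solution_unique[OF assms(4,5) entries_integrable[OF f] i t])
qed

lemma zero_in_sobolev_vec: "(\<lambda>t. 0\<^sub>v m) \<in> sobolev_vec p a b l m"
  by (rule sobolev_vecI[where u="\<lambda>i t. 0"]) (auto simp: sobolev_zero)

lemma B_carrier: "u \<in> W \<Longrightarrow> B u \<in> carrier_vec r"
  and B_add: "u \<in> W \<Longrightarrow> v \<in> W \<Longrightarrow> B (\<lambda>t. u t + v t) = B u + B v"
  and B_smult: "u \<in> W \<Longrightarrow> B (\<lambda>t. z \<cdot>\<^sub>v u t) = z \<cdot>\<^sub>v B u"
  and B_cont: "u \<in> W \<Longrightarrow> \<epsilon> > 0 \<Longrightarrow> \<exists>\<delta>>0. \<forall>v\<in>W.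
       Wnorm (\<lambda>t. v t - u t) < \<delta> \<longrightarrow> cvec_norm (B v - B u) < \<epsilon>"
  using B_op unfolding continuous_linear_op_def by blast+

text \<open>Two functions that agree on [a,b] are at distance 0, so continuity of B cannot separate their
images.\<close>

lemma B_cong:
  assumes u: "u \<in> W" and v: "v \<in> W" and eq: "\<And>t. t \<in> {a..b} \<Longrightarrow> u t = v t"
  shows "B u = B v"
proof -
  have "sum_norm (Suc k) (entries (\<lambda>t. v t - u t)) = sum_norm (Suc k) (\<lambda>i t. 0)"
  proof (rule sum_norm_cong)
    show "0 = (v t - u t) $ i" if "i < m" "t \<in> {a..b}" for i t
      using eq[OF that(2)] sobolev_vec_carrier[OF v that(2)] that(1) by simp
  qed (simp add: sobolev_zero)
  then have n0: "Wnorm (\<lambda>t. v t - u t) = 0"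
    by (simp add: sobolev_vec_norm_eq sum_norm_def sobolev_zero)
  have "cvec_norm (B v - B u) \<le> \<epsilon>" if \<epsilon>: "\<epsilon> > 0" for \<epsilon>
  proof -
    obtain \<delta> where d: "\<delta> > 0" "\<forall>v\<in>W. Wnorm (\<lambda>t. v t - u t) < \<delta> \<longrightarrow> cvec_norm (B v - B u) < \<epsilon>"
      using B_cont[OF u \<epsilon>] by blast
    have "Wnorm (\<lambda>t. v t - u t) < \<delta>" using d(1) n0 by simp
    from d(2)[rule_format, OF v this] show ?thesis by simp
  qed
  then have "cvec_norm (B v - B u) \<le> 0" by (rule field_le_epsilon[where y=0, simplified])
  then have z: "cmod ((B v - B u) $ i) \<le> 0" if "i < r" for i
  proof -
    have "cmod ((B v - B u) $ i) \<le> cvec_norm (B v - B u)"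
      by (rule cmod_index_le_cvec_norm) (use that B_carrier[OF u] in simp)
    with \<open>cvec_norm (B v - B u) \<le> 0\<close> show ?thesis by (rule order_trans[rotated])
  qed
  have "B v - B u = 0\<^sub>v r"
  proof (rule eq_vecI)
    fix i assume "i < dim_vec (0\<^sub>v r :: complex vec)"
    then show "(B v - B u) $ i = 0\<^sub>v r $ i" using z[of i] by simp
  qed (use B_carrier[OF u] in simp)
  then show ?thesis using vec_eq_of_diff_zero[OF B_carrier[OF v] B_carrier[OF u]] by simp
qed

lemma B_zero: "B (\<lambda>t. 0\<^sub>v m) = 0\<^sub>v r"
proof -
  have "B (\<lambda>t. 0 \<cdot>\<^sub>v 0\<^sub>v m) = 0 \<cdot>\<^sub>v B (\<lambda>t. 0\<^sub>v m)" by (rule B_smult[OF zero_in_sobolev_vec])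
  moreover have "(0 :: complex) \<cdot>\<^sub>v 0\<^sub>v m = 0\<^sub>v m" by (rule eq_vecI) auto
  moreover have "0 \<cdot>\<^sub>v B (\<lambda>t. 0\<^sub>v m) = 0\<^sub>v r"
    by (rule eq_vecI) (use B_carrier[OF zero_in_sobolev_vec] in auto)
  ultimately show ?thesis by simp
qed

lemma B_diff:
  assumes u: "u \<in> W" and v: "v \<in> W"
  shows "B (\<lambda>t. u t - v t) = B u - B v"
proof -
  have mv: "(\<lambda>t. (-1) \<cdot>\<^sub>v v t) \<in> W" by (rule sobolev_vec_smult[OF v])
  have "B (\<lambda>t. u t - v t) = B (\<lambda>t. u t + (-1) \<cdot>\<^sub>v v t)"
  proof (rule B_cong)
    show "u t - v t = u t + (-1) \<cdot>\<^sub>v v t" if "t \<in> {a..b}" for t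
      using sobolev_vec_carrier[OF u that] sobolev_vec_carrier[OF v that] by (intro eq_vecI) auto
  qed (intro sobolev_vec_diff sobolev_vec_add u v mv)+
  also have "\<dots> = B u + (-1) \<cdot>\<^sub>v B v" by (simp only: B_add[OF u mv] B_smult[OF v])
  also have "\<dots> = B u - B v" using B_carrier[OF u] B_carrier[OF v] by (intro eq_vecI) auto
  finally show ?thesis .
qed

lemma B_cont_zero:
  assumes "\<epsilon> > 0"
  shows "\<exists>\<delta>>0. \<forall>v\<in>W. Wnorm v < \<delta> \<longrightarrow> cvec_norm (B v) < \<epsilon>"
proof -
  obtain \<delta> where d: "\<delta> > 0" "\<forall>v\<in>W. Wnorm (\<lambda>t. v t - 0\<^sub>v m) < \<delta> \<longrightarrow> cvec_norm (B v - B (\<lambda>t. 0\<^sub>v m)) < \<epsilon>"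
    using B_cont[OF zero_in_sobolev_vec assms] by blast
  have "cvec_norm (B v) < \<epsilon>" if v: "v \<in> W" and n: "Wnorm v < \<delta>" for v
  proof -
    have "sum_norm (Suc k) (entries (\<lambda>t. v t - 0\<^sub>v m)) = sum_norm (Suc k) (entries v)"
      by (rule sum_norm_cong) (use v sobolev_vec_entries in auto)
    then have "cvec_norm (B v - B (\<lambda>t. 0\<^sub>v m)) < \<epsilon>" using d(2) v n by (simp add: sobolev_vec_norm_eq)
    moreover have "B v - B (\<lambda>t. 0\<^sub>v m) = B v" unfolding B_zero using B_carrier[OF v] by (intro eq_vecI) auto
    ultimately show ?thesis by simp
  qed
  then show ?thesis using d(1) by blast
qed

section \<open>The matrix Cauchy problem\<close>

definition init_col :: "nat \<Rightarrow> nat \<Rightarrow> complex" where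
  "init_col j i = (if i = j then 1 else 0)"

abbreviation columns :: "(real \<Rightarrow> complex mat) \<Rightarrow> nat \<Rightarrow> nat \<Rightarrow> real \<Rightarrow> complex" where
  "columns Y j \<equiv> (\<lambda>i t. Y t $$ (i, j))"

lemma zero_in_V: "(\<lambda>t. 0\<^sub>v m) \<in> V"
  by (rule zero_in_sobolev_vec)

lemma zero_solution_cong:
  "integral_solution c (entries (\<lambda>t. 0\<^sub>v m)) u \<longleftrightarrow> integral_solution c (\<lambda>_ _. 0) u"
  by (auto elim!: integral_solution_cong)

lemma Cauchy_index:
  assumes "Y t \<in> carrier_mat m m" "t \<in> {a..b}" "i < m" "j < m"
  shows "(mat m m (\<lambda>(i, j). D (\<lambda>s. Y s $$ (i, j)) t) + A t * Y t) $$ (i, j)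
     = D (columns Y j i) t + Au (columns Y j) i t"
  using assms A_carrier[OF assms(2)] by (simp add: Au_def scalar_prod_def atLeast0LessThan)

text \<open>The matrix equation says that each column of Y solves the homogeneous vector equation, with a
unit vector as initial value.\<close>

lemma Cauchy_imp_integral_solution:
  assumes Y: "solves_matrix_Cauchy p a b (Suc k) m A Y" and j: "j < m"
  shows "integral_solution (init_col j) (\<lambda>_ _. 0) (columns Y j)"
proof -
  have Ys: "columns Y j i \<in> Wp (Suc k)" if "i < m" for i
    using Y that j by (simp add: solves_matrix_Cauchy_def sobolev_mat_def)
  have Yc: "Y t \<in> carrier_mat m m" if "t \<in> {a..b}" for t
    using Y that by (simp add: solves_matrix_Cauchy_def sobolev_mat_def)
  have ae: "AE t in M. mat m m (\<lambda>(i, j). D (\<lambda>s. Y s $$ (i, j)) t) + A t * Y t = 0\<^sub>m m m"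
    using Y by (simp add: solves_matrix_Cauchy_def)
  have "integral_solution (\<lambda>i. columns Y j i a) (\<lambda>_ _. 0) (columns Y j)"
  proof (rule integral_solution_of_sobolev[OF Ys])
    fix i assume i: "i < m"
    show "AE t in M. D (columns Y j i) t + Au (columns Y j) i t = 0"
      using ae AE_space
    proof eventually_elim
      case (elim t)
      then have t: "t \<in> {a..b}" by simp
      show ?case using Cauchy_index[of Y t i j, OF Yc[OF t] t i j] elim(1) i j by simp
    qed
  qed
  then show ?thesis
  proof (rule integral_solution_cong)
    show "columns Y j i a = init_col j i" if "i < m" for i
      using Y that j by (simp add: solves_matrix_Cauchy_def init_col_def)
  qed auto
qed

lemma Cauchy_solution_exists: "\<exists>Y. solves_matrix_Cauchy p a b (Suc k) m A Y"
proof -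
  have "\<forall>j. \<exists>u. integral_solution (init_col j) (\<lambda>_ _. 0) u"
    using integral_solution_exists[of "\<lambda>_ _. 0"] by simp
  then obtain U where U: "\<And>j. integral_solution (init_col j) (\<lambda>_ _. 0) (U j)" by metis
  define Y where "Y t = mat m m (\<lambda>(i, j). U j i t)" for t
  have Yc: "Y t \<in> carrier_mat m m" for t by (simp add: Y_def)
  have colY: "columns Y j i = U j i" if "i < m" "j < m" for i j using that by (simp add: Y_def)
  have Us: "U j i \<in> Wp (Suc k)" if "i < m" for i j
    using integral_solution_regular[OF U _ that] sobolev_zero by simp
  have Y_sob: "Y \<in> sobolev_mat p a b (Suc k) m"
    using Us colY Yc by (simp add: sobolev_mat_def)
  have ae1: "AE t in M. D (U j i) t + Au (U j) i t = 0" if "i < m" for i j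
    using integral_solution_AE[OF U _ that, of j] sobolev_zero by simp
  have ae2: "AE t in M. \<forall>i\<in>{..<m}. D (U j i) t + Au (U j) i t = 0" for j
    by (rule AE_finite_allI) (use ae1 in auto)
  have "AE t in M. \<forall>j\<in>{..<m}. \<forall>i\<in>{..<m}. D (U j i) t + Au (U j) i t = 0"
    by (rule AE_finite_allI) (use ae2 in auto)
  then have "AE t in M. mat m m (\<lambda>(i, j). D (\<lambda>s. Y s $$ (i, j)) t) + A t * Y t = 0\<^sub>m m m"
    using AE_space
  proof eventually_elim
    case (elim t)
    then have t: "t \<in> {a..b}" by simp
    show ?case
    proof (rule eq_matI)
      fix i j assume "i < dim_row (0\<^sub>m m m :: complex mat)" "j < dim_col (0\<^sub>m m m :: complex mat)"
      then have ij: "i < m" "j < m" by auto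
      have "Au (columns Y j) i t = Au (U j) i t" using colY[OF _ ij(2)] by (simp add: Au_def Y_def ij)
      then show "(mat m m (\<lambda>(i, j). D (\<lambda>s. Y s $$ (i, j)) t) + A t * Y t) $$ (i, j) = 0\<^sub>m m m $$ (i, j)"
        unfolding Cauchy_index[of Y t i j, OF Yc t ij] using elim(1) ij by (simp add: colY[OF ij])
    qed (use A_carrier[OF t] Yc[of t] in auto)
  qed
  moreover have "Y a = 1\<^sub>m m"
    by (rule eq_matI) (use integral_solution_initial[OF U] in \<open>auto simp: Y_def init_col_def\<close>)
  ultimately show ?thesis using Y_sob unfolding solves_matrix_Cauchy_def by blast
qed

lemma Cauchy_solution_unique:
  assumes Y: "solves_matrix_Cauchy p a b (Suc k) m A Y" and Z: "solves_matrix_Cauchy p a b (Suc k) m A Z"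
    and t: "t \<in> {a..b}"
  shows "Z t = Y t"
proof (rule eq_matI)
  have c: "Y t \<in> carrier_mat m m" "Z t \<in> carrier_mat m m"
    using Y Z t by (auto simp: solves_matrix_Cauchy_def sobolev_mat_def)
  then show "dim_row (Z t) = dim_row (Y t)" "dim_col (Z t) = dim_col (Y t)" by auto
  fix i j assume "i < dim_row (Y t)" "j < dim_col (Y t)"
  then have ij: "i < m" "j < m" using c by auto
  show "Z t $$ (i, j) = Y t $$ (i, j)"
    using integral_solution_unique[OF Cauchy_imp_integral_solution[OF Z ij(2)] Cauchy_imp_integral_solution[OF Y ij(2)] _ ij(1) t]
    by simp
qed

end

section \<open>The fundamental matrix and the criterion\<close>

locale fundamental_matrix = boundary_problem +
  fixes Y :: "real \<Rightarrow> complex mat"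
  assumes Y: "solves_matrix_Cauchy p a b (Suc k) m A Y"
begin

abbreviation "BY \<equiv> op_on_cols r m B Y"
abbreviation "Yq q \<equiv> (\<lambda>t. Y t *\<^sub>v q)"

lemma Y_carrier: "t \<in> {a..b} \<Longrightarrow> Y t \<in> carrier_mat m m"
  using Y by (simp add: solves_matrix_Cauchy_def sobolev_mat_def)

lemma Y_entry: "i < m \<Longrightarrow> j < m \<Longrightarrow> (\<lambda>t. Y t $$ (i, j)) \<in> Wp (Suc k)"
  using Y by (simp add: solves_matrix_Cauchy_def sobolev_mat_def)

lemma Yq_index:
  assumes "q \<in> carrier_vec m" "t \<in> {a..b}" "i < m"
  shows "(Y t *\<^sub>v q) $ i = (\<Sum>j<m. q $ j * Y t $$ (i, j))"
  using mult_mat_vec_index_sum[OF Y_carrier[OF assms(2)] assms(1,3)] by (simp add: mult.commute)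

lemma add_Yq_index: "t \<in> {a..b} \<Longrightarrow> i < m \<Longrightarrow> (v + Y t *\<^sub>v q) $ i = v $ i + (Y t *\<^sub>v q) $ i"
  using Y_carrier[of t] by simp

lemma Y_lincomb_solution:
  "l \<le> m \<Longrightarrow> integral_solution (\<lambda>i. \<Sum>j<l. q $ j * init_col j i) (\<lambda>_ _. 0) (\<lambda>i t. \<Sum>j<l. q $ j * Y t $$ (i, j))"
proof (induction l)
  case 0
  show ?case by (simp add: integral_solution_def Au_def)
next
  case (Suc l)
  have "integral_solution (\<lambda>i. (\<Sum>j<l. q $ j * init_col j i) + q $ l * init_col l i) (\<lambda>i t. 0 + q $ l * 0)
    (\<lambda>i t. (\<Sum>j<l. q $ j * Y t $$ (i, j)) + q $ l * Y t $$ (i, l))"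
    by (rule integral_solution_lincomb[OF Suc.IH Cauchy_imp_integral_solution[OF Y]]) (use Suc.prems in auto)
  then show ?case by simp
qed

lemma Yq_entries_sobolev:
  assumes "i < m"
  shows "(\<lambda>t. \<Sum>j<m. q $ j * Y t $$ (i, j)) \<in> Wp (Suc k) \<and>
    wnorm (Suc k) (\<lambda>t. \<Sum>j<m. q $ j * Y t $$ (i, j))
      \<le> 4 ^ m * (\<Sum>j<m. cmod (q $ j) * wnorm (Suc k) (\<lambda>t. Y t $$ (i, j)))"
proof -
  have 1: "(\<lambda>t. q $ j * Y t $$ (i, j)) \<in> Wp (Suc k) \<and>
     wnorm (Suc k) (\<lambda>t. q $ j * Y t $$ (i, j)) \<le> cmod (q $ j) * wnorm (Suc k) (\<lambda>t. Y t $$ (i, j))"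
    if "j < m" for j
    by (rule sobolev_cmult[OF Y_entry[OF assms that]])
  have 2: "(\<lambda>t. \<Sum>j<m. q $ j * Y t $$ (i, j)) \<in> Wp (Suc k)"
    "wnorm (Suc k) (\<lambda>t. \<Sum>j<m. q $ j * Y t $$ (i, j))
     \<le> 4 ^ m * (\<Sum>j<m. wnorm (Suc k) (\<lambda>t. q $ j * Y t $$ (i, j)))"
    using sobolev_sum[of "{..<m}" "\<lambda>j t. q $ j * Y t $$ (i, j)" "Suc k"] 1 by auto
  note 2(2)
  also have "4 ^ m * (\<Sum>j<m. wnorm (Suc k) (\<lambda>t. q $ j * Y t $$ (i, j)))
     \<le> 4 ^ m * (\<Sum>j<m. cmod (q $ j) * wnorm (Suc k) (\<lambda>t. Y t $$ (i, j)))"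
    by (intro mult_left_mono sum_mono) (use 1 in auto)
  finally show ?thesis using 2(1) by blast
qed

lemma Yq_in_W:
  assumes q: "q \<in> carrier_vec m"
  shows "(Yq q) \<in> W"
proof (rule sobolev_vecI[where u="\<lambda>i t. \<Sum>j<m. q $ j * Y t $$ (i, j)"])
  show "Y t *\<^sub>v q \<in> carrier_vec m" if "t \<in> {a..b}" for t using Y_carrier[OF that] by (intro carrier_vecI) simp
qed (use Yq_index[OF q] Yq_entries_sobolev in auto)

lemma Yq_solution:
  assumes q: "q \<in> carrier_vec m"
  shows "integral_solution (\<lambda>i. q $ i) (\<lambda>_ _. 0) (entries (Yq q))"
proof (rule integral_solution_cong[OF Y_lincomb_solution[of m q]])
  show "(\<Sum>j<m. q $ j * init_col j i) = q $ i" if "i < m" for i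
    using that by (simp add: init_col_def if_distrib[of "\<lambda>x. _ * x"] cong: if_cong)
qed (use Yq_index[OF q] in auto)

lemma add_Yq_solution:
  assumes f: "f \<in> V" and y0: "integral_solution (\<lambda>_. 0) (entries f) (entries y0)" and q: "q \<in> carrier_vec m"
  shows "integral_solution (\<lambda>i. q $ i) (entries f) (entries (\<lambda>t. y0 t + Y t *\<^sub>v q))"
proof (rule integral_solution_cong)
  show "integral_solution (\<lambda>i. 0 + 1 * q $ i) (\<lambda>i t. entries f i t + 1 * 0)
      (\<lambda>i t. entries y0 i t + 1 * entries (Yq q) i t)"
    by (rule integral_solution_lincomb[OF y0 Yq_solution[OF q] entries_integrable[OF f]]) auto
qed (simp_all add: add_Yq_index del: index_mult_mat_vec)

lemma Yq_norm_bound: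
  "\<exists>C\<ge>0. \<forall>q\<in>carrier_vec m. Wnorm (Yq q) \<le> C * cvec_norm q"
proof (intro exI[of _ "\<Sum>i<m. 4 ^ m * (\<Sum>j<m. wnorm (Suc k) (\<lambda>t. Y t $$ (i, j)))"] conjI ballI)
  let ?S = "\<lambda>i. \<Sum>j<m. wnorm (Suc k) (\<lambda>t. Y t $$ (i, j))"
  show "0 \<le> (\<Sum>i<m. 4 ^ m * ?S i)"
    by (intro sum_nonneg mult_nonneg_nonneg sobolev_norm_nonneg Y_entry) auto
  fix q :: "complex vec" assume q: "q \<in> carrier_vec m"
  have "Wnorm (Yq q) = sum_norm (Suc k) (\<lambda>i t. \<Sum>j<m. q $ j * Y t $$ (i, j))"
    unfolding sobolev_vec_norm_eq
    by (rule sum_norm_cong) (use Yq_index[OF q] Yq_entries_sobolev in auto)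
  also have "\<dots> \<le> (\<Sum>i<m. 4 ^ m * (\<Sum>j<m. cmod (q $ j) * wnorm (Suc k) (\<lambda>t. Y t $$ (i, j))))"
    unfolding sum_norm_def by (rule sum_mono) (use Yq_entries_sobolev in auto)
  also have "\<dots> \<le> (\<Sum>i<m. 4 ^ m * (\<Sum>j<m. cvec_norm q * wnorm (Suc k) (\<lambda>t. Y t $$ (i, j))))"
    by (intro sum_mono mult_left_mono mult_right_mono cmod_index_le_cvec_norm sobolev_norm_nonneg Y_entry)
      (use q in auto)
  also have "\<dots> = (\<Sum>i<m. 4 ^ m * ?S i) * cvec_norm q"
    by (simp add: sum_distrib_left sum_distrib_right mult_ac)
  finally show "Wnorm (Yq q) \<le> (\<Sum>i<m. 4 ^ m * ?S i) * cvec_norm q" .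
qed

lemma col_in_W: "j < m \<Longrightarrow> (\<lambda>t. col (Y t) j) \<in> W"
  by (rule sobolev_vecI[where u="columns Y j"]) (use Y_carrier Y_entry in \<open>force intro!: carrier_vecI\<close>)+

lemma BY_carrier: "BY \<in> carrier_mat r m"
  unfolding op_on_cols_def using mat_of_cols_carrier(1)[of r "map (\<lambda>j. B (\<lambda>t. col (Y t) j)) [0..<m]"] by simp

lemma BY_index: "i < r \<Longrightarrow> j < m \<Longrightarrow> BY $$ (i, j) = B (\<lambda>t. col (Y t) j) $ i"
  unfolding op_on_cols_def by (simp add: mat_of_cols_index)

text \<open>Y q is a linear combination of the columns of Y. Since B is additive for two summands, an
induction over the number of columns is needed to apply it to this sum.\<close>

lemma B_Yq:
  assumes q: "q \<in> carrier_vec m"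
  shows "B (Yq q) = BY *\<^sub>v q"
proof -
  define P where "P l t = vec m (\<lambda>i. \<Sum>j<l. q $ j * Y t $$ (i, j))" for l t
  have PW: "P l \<in> W" if "l \<le> m" for l
  proof (rule sobolev_vecI[where u="\<lambda>i t. \<Sum>j<l. q $ j * Y t $$ (i, j)"])
    fix i assume i: "i < m"
    show "(\<lambda>t. \<Sum>j<l. q $ j * Y t $$ (i, j)) \<in> Wp (Suc k)"
      using sobolev_sum[of "{..<l}" "\<lambda>j t. q $ j * Y t $$ (i, j)" "Suc k"] sobolev_cmult Y_entry[OF i] that by auto
  qed (auto simp: P_def)
  have BP: "B (P l) $ i = (\<Sum>j<l. BY $$ (i, j) * q $ j)" if i: "i < r" and "l \<le> m" for l i
    using that(2)
  proof (induction l)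
    case 0
    have "B (P 0) = B (\<lambda>t. 0\<^sub>v m)"
      by (rule arg_cong[where f=B]) (auto simp: P_def intro!: ext eq_vecI)
    then show ?case using i by (simp add: B_zero)
  next
    case (Suc l)
    then have l: "l < m" "l \<le> m" by auto
    note cW = col_in_W[OF l(1)]
    have sW: "(\<lambda>t. q $ l \<cdot>\<^sub>v col (Y t) l) \<in> W" by (rule sobolev_vec_smult[OF cW])
    have "B (P (Suc l)) = B (\<lambda>t. P l t + q $ l \<cdot>\<^sub>v col (Y t) l)"
    proof (rule B_cong[OF PW[OF Suc.prems] sobolev_vec_add[OF PW[OF l(2)] sW]])
      fix t assume t: "t \<in> {a..b}"
      show "P (Suc l) t = P l t + q $ l \<cdot>\<^sub>v col (Y t) l"
        by (rule eq_vecI) (use Y_carrier[OF t] l in \<open>auto simp: P_def\<close>)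
    qed
    also have "\<dots> = B (P l) + q $ l \<cdot>\<^sub>v B (\<lambda>t. col (Y t) l)"
      by (simp only: B_add[OF PW[OF l(2)] sW] B_smult[OF cW])
    finally have "B (P (Suc l)) $ i = B (P l) $ i + q $ l * B (\<lambda>t. col (Y t) l) $ i"
      using B_carrier[OF cW] i by simp
    then show ?case using Suc.IH[OF l(2)] BY_index[OF i l(1)] by simp
  qed
  have "B (Yq q) = B (P m)"
  proof (rule B_cong[OF Yq_in_W[OF q] PW])
    fix t assume t: "t \<in> {a..b}"
    show "Y t *\<^sub>v q = P m t"
      by (rule eq_vecI) (use Y_carrier[OF t] Yq_index[OF q t] in \<open>auto simp: P_def simp del: index_mult_mat_vec\<close>)
  qed simp
  also have "\<dots> = BY *\<^sub>v q"
  proof (rule eq_vecI)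
    show "dim_vec (B (P m)) = dim_vec (BY *\<^sub>v q)" using B_carrier[OF PW[of m]] BY_carrier by simp
    fix i assume "i < dim_vec (BY *\<^sub>v q)"
    then have i: "i < r" using BY_carrier by simp
    show "B (P m) $ i = (BY *\<^sub>v q) $ i"
      using BP[OF i, of m] mult_mat_vec_index_sum[OF BY_carrier q i] by simp
  qed
  finally show ?thesis .
qed

lemma L_Yq:
  assumes q: "q \<in> carrier_vec m"
  shows "AE t in M. L (Yq q) t = 0\<^sub>v m"
  by (rule integral_solution_imp_L_eq[OF Yq_in_W[OF q] zero_in_V])
    (use Yq_solution[OF q] in \<open>simp add: zero_solution_cong del: index_zero_vec\<close>)

lemma Yq_initial:
  assumes q: "q \<in> carrier_vec m"
  shows "Y a *\<^sub>v q = q"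
  using Y q by (simp add: solves_matrix_Cauchy_def)

text \<open>Both sides solve the same Cauchy problem.\<close>

lemma homogeneous_solution:
  assumes y: "y \<in> W" and eq: "AE t in M. L y t = 0\<^sub>v m" and t: "t \<in> {a..b}"
  shows "y t = Y t *\<^sub>v y a"
proof -
  have q: "y a \<in> carrier_vec m" using sobolev_vec_carrier[OF y, of a] ab by simp
  show ?thesis
    by (rule integral_solution_vec_unique[OF y Yq_in_W[OF q] zero_in_V L_eq_imp_integral_solution[OF y eq] _ t])
      (simp only: zero_solution_cong Yq_solution[OF q])
qed

text \<open>The problems L y = 0, B y = c are the linear systems [BY] q = c in disguise: solvability gives
surjectivity, and uniqueness gives injectivity because q is the value of Y q at a.\<close>

lemma invertible_pair_imp_BY_invertible:
  assumes inv: "invertible_pair p a b (Suc k) m r L B"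
  shows "r = m \<and> det BY \<noteq> 0"
proof (rule mat_bijective_imp_square_invertible[OF BY_carrier])
  have bij: "\<exists>y\<in>W. (AE t in M. L y t = 0\<^sub>v m) \<and> B y = c \<and>
      (\<forall>z\<in>W. (AE t in M. L z t = 0\<^sub>v m) \<and> B z = c \<longrightarrow> (\<forall>t\<in>{a..b}. z t = y t))"
    if "c \<in> carrier_vec r" for c
    using inv zero_in_V that unfolding invertible_pair_def by fastforce
  have a: "a \<in> {a..b}" using ab by simp
  {
    fix c :: "complex vec" assume "c \<in> carrier_vec r"
    then obtain y where y: "y \<in> W" "AE t in M. L y t = 0\<^sub>v m" "B y = c" using bij by blast
    have q: "y a \<in> carrier_vec m" by (rule sobolev_vec_carrier[OF y(1) a])
    have "B y = B (Yq (y a))"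
      by (rule B_cong[OF y(1) Yq_in_W[OF q] homogeneous_solution[OF y(1,2)]])
    then show "\<exists>q\<in>carrier_vec m. BY *\<^sub>v q = c" using q y(3) B_Yq[OF q] by auto
  next
    fix q :: "complex vec" assume q: "q \<in> carrier_vec m" and BYq: "BY *\<^sub>v q = 0\<^sub>v r"
    have z: "0\<^sub>v m \<in> carrier_vec m" by simp
    have BYz: "BY *\<^sub>v 0\<^sub>v m = 0\<^sub>v r" by (rule eq_vecI) (use BY_carrier in auto)
    obtain y where y: "\<forall>z\<in>W. (AE t in M. L z t = 0\<^sub>v m) \<and> B z = 0\<^sub>v r \<longrightarrow> (\<forall>t\<in>{a..b}. z t = y t)"
      using bij[of "0\<^sub>v r"] by auto
    have *: "Y a *\<^sub>v x = y a" if x: "x \<in> carrier_vec m" "BY *\<^sub>v x = 0\<^sub>v r" for x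
      using bspec[OF y Yq_in_W[OF x(1)]] L_Yq[OF x(1)] B_Yq[OF x(1)] x(2) a by simp
    show "q = 0\<^sub>v m" using *[OF q BYq] *[OF z BYz] Yq_initial[OF q] Yq_initial[OF z] by simp
  }
qed

text \<open>Every w in W is y0 + Y q with L y0 = L w, y0(a) = 0 and q = [BY]^-1 (B w - B y0). Uniqueness and
continuity are read off from this splitting, and reversing it gives existence; for continuity it
is applied to the difference w of two functions.\<close>

lemma BY_invertible_imp_invertible_pair:
  assumes rm: "r = m" and d: "det BY \<noteq> 0"
  shows "invertible_pair p a b (Suc k) m r L B"
proof -
  have BYm: "BY \<in> carrier_mat m m" using BY_carrier rm by simp
  obtain Q where Q: "Q \<in> carrier_mat m m" and BYQ: "BY * Q = 1\<^sub>m m" and QBY: "Q * BY = 1\<^sub>m m"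
    using det_nonzero_imp_inverse[OF BYm d] by blast
  have BQ: "BY *\<^sub>v (Q *\<^sub>v x) = x" if "x \<in> carrier_vec m" for x
    using assoc_mult_mat_vec[OF BYm Q that] BYQ that by simp
  have QB: "Q *\<^sub>v (BY *\<^sub>v x) = x" if "x \<in> carrier_vec m" for x
    using assoc_mult_mat_vec[OF Q BYm that] QBY that by simp
  have Qc: "Q *\<^sub>v x \<in> carrier_vec m" for x using Q by (intro carrier_vecI) simp
  have Bc: "B u \<in> carrier_vec m" if "u \<in> W" for u using B_carrier[OF that] rm by simp
  have a: "a \<in> {a..b}" using ab by simp
  have split: "\<exists>y0\<in>W. \<exists>q\<in>carrier_vec m. integral_solution (\<lambda>_. 0) (entries g) (entries y0) \<and>
      (\<forall>t\<in>{a..b}. w t = y0 t + Y t *\<^sub>v q) \<and> q = Q *\<^sub>v (B w - B y0)"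
    if w: "w \<in> W" and g: "g \<in> V" and sol: "integral_solution (\<lambda>i. w a $ i) (entries g) (entries w)" for w g
  proof -
    obtain y0 where y0: "y0 \<in> W" "integral_solution (\<lambda>_. 0) (entries g) (entries y0)"
      using solution_exists[OF g, of "\<lambda>_. 0"] by blast
    define q where "q = w a"
    have q: "q \<in> carrier_vec m" unfolding q_def by (rule sobolev_vec_carrier[OF w a])
    have yq: "(\<lambda>t. y0 t + Y t *\<^sub>v q) \<in> W" by (rule sobolev_vec_add[OF y0(1) Yq_in_W[OF q]])
    have sol': "integral_solution (\<lambda>i. w a $ i) (entries g) (entries (\<lambda>t. y0 t + Y t *\<^sub>v q))"
      using add_Yq_solution[OF g y0(2) q] by (simp only: q_def)
    have eq: "w t = y0 t + Y t *\<^sub>v q" if t: "t \<in> {a..b}" for t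
      by (rule integral_solution_vec_unique[OF w yq g sol sol' t])
    have "B w = B y0 + BY *\<^sub>v q"
      using B_cong[OF w yq eq] B_add[OF y0(1) Yq_in_W[OF q]] B_Yq[OF q] by simp
    then have "B w - B y0 = BY *\<^sub>v q"
      using Bc[OF y0(1)] BYm by (intro eq_vecI) auto
    then have "q = Q *\<^sub>v (B w - B y0)" using QB[OF q] by simp
    then show ?thesis using y0 q eq by (intro bexI[of _ y0] bexI[of _ q] conjI ballI)
  qed
  have wd: "\<forall>y\<in>W. L y \<in> sobolev_vec p a b (Suc k - 1) m \<and> B y \<in> carrier_vec r"
    using L_in_V B_carrier by simp
  have bij: "\<forall>f\<in>sobolev_vec p a b (Suc k - 1) m. \<forall>c\<in>carrier_vec r.
       \<exists>y\<in>W. (AE t in M. L y t = f t) \<and> B y = c \<and>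
         (\<forall>z\<in>W. (AE t in M. L z t = f t) \<and> B z = c \<longrightarrow> (\<forall>t\<in>{a..b}. z t = y t))"
  proof (intro ballI)
    fix f and c :: "complex vec" assume "f \<in> sobolev_vec p a b (Suc k - 1) m" and "c \<in> carrier_vec r"
    then have f: "f \<in> V" and c: "c \<in> carrier_vec m" using rm by auto
    obtain y0 where y0: "y0 \<in> W" "integral_solution (\<lambda>_. 0) (entries f) (entries y0)"
      using solution_exists[OF f, of "\<lambda>_. 0"] by blast
    define q where "q = Q *\<^sub>v (c - B y0)"
    have q: "q \<in> carrier_vec m" unfolding q_def by (rule Qc)
    define y where "y t = y0 t + Y t *\<^sub>v q" for t
    have yW: "y \<in> W" unfolding y_def[abs_def] by (rule sobolev_vec_add[OF y0(1) Yq_in_W[OF q]])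
    have soly: "integral_solution (\<lambda>i. q $ i) (entries f) (entries y)"
      unfolding y_def[abs_def] by (rule add_Yq_solution[OF f y0(2) q])
    have Ly: "AE t in M. L y t = f t" by (rule integral_solution_imp_L_eq[OF yW f soly])
    have cB: "c - B y0 \<in> carrier_vec m" using c Bc[OF y0(1)] by simp
    have "B y = B y0 + BY *\<^sub>v q"
      unfolding y_def[abs_def] using B_add[OF y0(1) Yq_in_W[OF q]] B_Yq[OF q] by simp
    also have "BY *\<^sub>v q = c - B y0" unfolding q_def by (rule BQ[OF cB])
    also have "B y0 + (c - B y0) = c" using c Bc[OF y0(1)] by (intro eq_vecI) auto
    finally have By: "B y = c" .
    have uniq: "z t = y t" if z: "z \<in> W" "AE t in M. L z t = f t" "B z = c" and t: "t \<in> {a..b}" for z t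
    proof -
      obtain z0 q' where z0: "z0 \<in> W" "q' \<in> carrier_vec m" "integral_solution (\<lambda>_. 0) (entries f) (entries z0)"
          "\<forall>t\<in>{a..b}. z t = z0 t + Y t *\<^sub>v q'" "q' = Q *\<^sub>v (B z - B z0)"
        using split[OF z(1) f L_eq_imp_integral_solution[OF z(1,2)]] by blast
      have eq0: "z0 t = y0 t" if "t \<in> {a..b}" for t
        by (rule integral_solution_vec_unique[OF z0(1) y0(1) f z0(3) y0(2) that])
      have "q' = q" using z0(5) z(3) B_cong[OF z0(1) y0(1) eq0] by (simp add: q_def)
      then show ?thesis using z0(4) t eq0[OF t] by (simp add: y_def)
    qed
    show "\<exists>y\<in>W. (AE t in M. L y t = f t) \<and> B y = c \<and>
         (\<forall>z\<in>W. (AE t in M. L z t = f t) \<and> B z = c \<longrightarrow> (\<forall>t\<in>{a..b}. z t = y t))"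
      using yW Ly By uniq by blast
  qed
  have cont: "\<forall>y\<in>W. \<forall>\<epsilon>>0. \<exists>\<delta>>0. \<forall>z\<in>W.
       sobolev_vec_norm p a b (Suc k - 1) m (\<lambda>t. L z t - L y t) + cvec_norm (B z - B y) < \<delta> \<longrightarrow>
       Wnorm (\<lambda>t. z t - y t) < \<epsilon>"
  proof (intro ballI allI impI)
    fix y and \<epsilon> :: real assume y: "y \<in> W" and \<epsilon>: "\<epsilon> > 0"
    obtain C where C: "C \<ge> 0" "\<forall>f u. (\<forall>i<m. f i \<in> Wp k) \<and> integral_solution (\<lambda>_. 0) f u \<longrightarrow>
       sum_norm (Suc k) u \<le> C * sum_norm k f" using integral_solution_norm_bound by blast
    obtain CY where CY: "CY \<ge> 0" "\<forall>q\<in>carrier_vec m. Wnorm (Yq q) \<le> CY * cvec_norm q"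
      using Yq_norm_bound by blast
    obtain CQ where CQ: "CQ \<ge> 0" "\<forall>v\<in>carrier_vec m. cvec_norm (Q *\<^sub>v v) \<le> CQ * cvec_norm v"
      using cvec_norm_mult_mat_vec_le[OF Q] by blast
    (* chosen for the final estimate 4 * (\<eta> + 2 * (CY * CQ * \<eta>)) < \<epsilon>; the factor 4 is that of the triangle inequality *)
    define \<eta> where "\<eta> = \<epsilon> / (16 * (CY * CQ + 1))"
    have CYQ: "0 \<le> CY * CQ" using CY(1) CQ(1) by simp
    have \<eta>: "\<eta> > 0" unfolding \<eta>_def using \<epsilon> CYQ by simp
    have \<eta>_eq: "CY * CQ * \<eta> + \<eta> = \<epsilon> / 16" 
    proof -
      have "CY * CQ * \<eta> + \<eta> = (CY * CQ + 1) * \<eta>" by (simp add: distrib_right)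
      also have "\<dots> = \<epsilon> / 16"
      proof -
        have "x * (\<epsilon> / (16 * x)) = \<epsilon> / 16" if "x > 0" for x :: real using that by simp
        moreover have "CY * CQ + 1 > 0" using CYQ by simp
        ultimately show ?thesis unfolding \<eta>_def by blast
      qed
      finally show ?thesis .
    qed
    obtain \<delta>1 where \<delta>1: "\<delta>1 > 0" "\<forall>v\<in>W. Wnorm v < \<delta>1 \<longrightarrow> cvec_norm (B v) < \<eta>"
      using B_cont_zero[OF \<eta>] by blast
    (* the norm of y0 is at most C * \<delta>, which must be below both \<delta>1 and \<eta>; C may be 0, hence C + 1 *)
    define \<delta> where "\<delta> = min \<eta> (min (\<delta>1 / (C + 1)) (\<eta> / (C + 1)))"
    have \<delta>: "\<delta> > 0" unfolding \<delta>_def using \<eta> \<delta>1(1) C(1) by simp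
    show "\<exists>\<delta>>0. \<forall>z\<in>W.
       sobolev_vec_norm p a b (Suc k - 1) m (\<lambda>t. L z t - L y t) + cvec_norm (B z - B y) < \<delta> \<longrightarrow>
       Wnorm (\<lambda>t. z t - y t) < \<epsilon>"
    proof (intro exI[of _ \<delta>] conjI ballI impI \<delta>)
      fix z assume z: "z \<in> W" and
        lt: "sobolev_vec_norm p a b (Suc k - 1) m (\<lambda>t. L z t - L y t) + cvec_norm (B z - B y) < \<delta>"
      define g where "g t = L z t - L y t" for t
      define w where "w t = z t - y t" for t
      have gV: "g \<in> V" unfolding g_def[abs_def] by (rule sobolev_vec_diff[OF L_in_V[OF z] L_in_V[OF y]])
      have wW: "w \<in> W" unfolding w_def[abs_def] by (rule sobolev_vec_diff[OF z y])
      have Bw: "B w = B z - B y" unfolding w_def[abs_def] by (rule B_diff[OF z y])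
      have gn: "0 \<le> sum_norm k (entries g)" by (rule sum_norm_nonneg) (rule sobolev_vec_entries[OF gV])
      have lt': "sum_norm k (entries g) < \<delta>" "cvec_norm (B w) < \<delta>"
        using lt gn cvec_norm_nonneg[of "B w"]
        by (simp_all add: sobolev_vec_norm_eq Bw g_def)
      have dims: "dim_vec (y t) = m" "dim_vec (L y t) = m" if "t \<in> {a..b}" for t
        using sobolev_vec_carrier[OF y that] L_carrier[OF that, of y] by auto
      have sol: "integral_solution (\<lambda>i. w a $ i) (entries g) (entries w)"
      proof (rule integral_solution_cong)
        show "integral_solution (\<lambda>i. z a $ i + (-1) * y a $ i) (\<lambda>i t. entries (L z) i t + (-1) * entries (L y) i t)
            (\<lambda>i t. entries z i t + (-1) * entries y i t)"
          by (rule integral_solution_lincomb[OF L_eq_imp_integral_solution[OF z] L_eq_imp_integral_solution[OF y]])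
            (use entries_integrable[OF L_in_V[OF z]] entries_integrable[OF L_in_V[OF y]] in auto)
      qed (use dims a in \<open>simp_all add: g_def w_def\<close>)
      obtain y0 q where y0: "y0 \<in> W" "q \<in> carrier_vec m" "integral_solution (\<lambda>_. 0) (entries g) (entries y0)"
          "\<forall>t\<in>{a..b}. w t = y0 t + Y t *\<^sub>v q" "q = Q *\<^sub>v (B w - B y0)"
        using split[OF wW gV sol] by blast
      define N0 where "N0 = sum_norm (Suc k) (entries y0)"
      have e0: "entries y0 i \<in> Wp (Suc k)" if "i < m" for i by (rule sobolev_vec_entries[OF y0(1) that])
      have eY: "entries (Yq q) i \<in> Wp (Suc k)" if "i < m" for i
        by (rule sobolev_vec_entries[OF Yq_in_W[OF y0(2)] that])
      have "\<forall>i<m. entries g i \<in> Wp k" using sobolev_vec_entries[OF gV] by simp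
      then have "N0 \<le> C * sum_norm k (entries g)"
        unfolding N0_def using C(2)[rule_format, of "entries g" "entries y0"] y0(3) by simp
      also have "\<dots> \<le> (C + 1) * sum_norm k (entries g)" using gn by (intro mult_right_mono) auto
      also have "\<dots> < (C + 1) * \<delta>" using lt'(1) C(1) by (intro mult_strict_left_mono) auto
      finally have N0: "N0 < (C + 1) * \<delta>" .
      have "(C + 1) * \<delta> \<le> (C + 1) * (\<delta>1 / (C + 1))" "(C + 1) * \<delta> \<le> (C + 1) * (\<eta> / (C + 1))"
        unfolding \<delta>_def using C(1) by (intro mult_left_mono; simp)+
      then have N0': "N0 < \<delta>1" "N0 < \<eta>" using N0 C(1) by auto
      then have By0: "cvec_norm (B y0) < \<eta>" using \<delta>1(2) y0(1) by (simp add: sobolev_vec_norm_eq N0_def)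
      have "cvec_norm (B w - B y0) \<le> cvec_norm (B w) + cvec_norm (B y0)"
        by (rule cvec_norm_diff_le[OF Bc[OF wW] Bc[OF y0(1)]])
      also have "\<dots> \<le> 2 * \<eta>" using lt'(2) By0 by (simp add: \<delta>_def)
      finally have "CQ * cvec_norm (B w - B y0) \<le> CQ * (2 * \<eta>)" using CQ(1) by (rule mult_left_mono)
      moreover have "cvec_norm q \<le> CQ * cvec_norm (B w - B y0)"
        using CQ(2) Bc[OF wW] Bc[OF y0(1)] y0(5) by simp
      ultimately have "CY * cvec_norm q \<le> CY * (CQ * (2 * \<eta>))" using CY(1) by (intro mult_left_mono) auto
      then have NY: "sum_norm (Suc k) (entries (Yq q)) \<le> 2 * (CY * CQ * \<eta>)"
        using CY(2) y0(2) by (fastforce simp: sobolev_vec_norm_eq)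
      have "sum_norm (Suc k) (entries w) = sum_norm (Suc k) (\<lambda>i t. entries y0 i t + entries (Yq q) i t)"
      proof (rule sum_norm_cong)
        show "entries y0 i t + entries (Yq q) i t = entries w i t" if "i < m" "t \<in> {a..b}" for i t
          using y0(4) that by (simp add: add_Yq_index del: index_mult_mat_vec)
        show "(\<lambda>t. entries y0 i t + entries (Yq q) i t) \<in> Wp (Suc k)" if "i < m" for i
          using sobolev_add[OF e0[OF that] eY[OF that]] by blast
      qed
      also have "\<dots> \<le> 4 * (N0 + sum_norm (Suc k) (entries (Yq q)))"
        unfolding N0_def by (rule sum_norm_add[OF e0 eY])
      also have "\<dots> \<le> 4 * (\<eta> + 2 * (CY * CQ * \<eta>))" using N0'(2) NY by simp
      also have "\<dots> < \<epsilon>"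
      proof -
        have "CY * CQ * \<eta> = \<epsilon> / 16 - \<eta>" using \<eta>_eq by simp
        then show ?thesis using \<eta> \<epsilon> by simp
      qed
      finally show "Wnorm (\<lambda>t. z t - y t) < \<epsilon>"
        by (simp add: sobolev_vec_norm_eq w_def)
    qed
  qed
  show ?thesis unfolding invertible_pair_def using wd bij cont by blast
qed

end

theorem theorem2:
  fixes a b :: real and m n r :: nat and p :: ennreal
    and A :: "real \<Rightarrow> complex mat"
    and B :: "(real \<Rightarrow> complex vec) \<Rightarrow> complex vec"
  assumes "a < b" and "1 \<le> m" and "1 \<le> n" and "1 \<le> r" and "1 \<le> p"
    and "A \<in> sobolev_mat p a b (n - 1) m"
    and "continuous_linear_op p a b n m r B"
  shows "(\<exists>Y. solves_matrix_Cauchy p a b n m A Y \<and>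
           (\<forall>Z. solves_matrix_Cauchy p a b n m A Z \<longrightarrow> (\<forall>t\<in>{a..b}. Z t = Y t))) \<and>
         (\<forall>Y. solves_matrix_Cauchy p a b n m A Y \<longrightarrow>
           (invertible_pair p a b n m r (diff_op a b m A) B \<longleftrightarrow>
             r = m \<and> det (op_on_cols r m B Y) \<noteq> 0))"
proof -
  obtain k where n: "n = Suc k" using assms(3) by (cases n) auto
  interpret boundary_problem p a b m A k r B
    using assms n by unfold_locales (auto simp: sobolev_mat_def)
  have "invertible_pair p a b n m r (diff_op a b m A) B \<longleftrightarrow> r = m \<and> det (op_on_cols r m B Y) \<noteq> 0"
    if "solves_matrix_Cauchy p a b n m A Y" for Y
  proof -
    interpret fundamental_matrix p a b m A k r B Y
      using that n by unfold_locales simp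
    show ?thesis
      using invertible_pair_imp_BY_invertible BY_invertible_imp_invertible_pair n by blast
  qed
  then show ?thesis using Cauchy_solution_exists Cauchy_solution_unique n by blast
qed

end
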